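(* Consider $s,L>0$, $\log_2 n\le m=O(n^{\frac{2s}{1+2s}}/\log^2 n)$ and communication constraints $B^{(1)},\dots,B^{(m)}>0$ ($m$ and the $B^{(i)}$ may depend on $n$). Let the sequence $\delta_n=o(1)$ be defined as the solution to the equation $$\delta_n=\min\Big\{\frac{m}{n\log_2 n},\ \frac{m}{n\sum_{i=1}^m\big[(\log_2(n)\,\delta_n^{\frac{1}{1+2s}}B^{(i)})\wedge 1\big]}\Big\}.$$ Then in the distributed random design nonparametric regression model $$\inf_{\hat f\in\mathcal F_{dist}(B^{(1)},\dots,B^{(m)};B^s_{2,\infty}(L))}\ \sup_{f_0\in B^s_{2,\infty}(L)}\mathbb E_{f_0,T}\|\hat f-f_0\|_2^2\ \gtrsim\ L^{\frac{2}{1+2s}}\,\delta_n^{\frac{2s}{1+2s}} ,$$ where $\gtrsim$ means that the inequality holds up to a universal positive multiplicative constant.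
   Context: Model. The total sample size is $n$ and there are $m$ local machines with $n/m\in\mathbb N$. Machine $i\in\{1,\dots,m\}$ observes pairs $(T^{(i)}_\ell,X^{(i)}_\ell)$, $\ell=1,\dots,n/m$, with $X^{(i)}_\ell=f_0(T^{(i)}_\ell)+\sigma\varepsilon^{(i)}_\ell$, where the $T^{(i)}_\ell$ are iid uniform on $(0,1)$, the $\varepsilon^{(i)}_\ell$ are iid $N(0,1)$, independent of the design, $\sigma>0$, and $f_0\in L_2[0,1]$ is unknown and common to all machines. $\mathbb E_{f_0,T}$ is expectation under the joint law of all data. Distributed estimators. Machine $i$ sends to a central machine a finite binary string $Y^{(i)}$ which is a measurable function of its local data; $l(Y)$ denotes the length of a string $Y$. For $\mathcal F\subset L_2[0,1]$, $\mathcal F_{dist}(B^{(1)},\dots,B^{(m)};\mathcal F)$ is the class of estimators $\hat f$ that are measurable functions of $(Y^{(1)},\dots,Y^{(m)})$ for such strings satisfying $\mathbb E_{f_0,T}[l(Y^{(i)})]\le B^{(i)}$ for all $f_0\in\mathcal F$ and all $i=1,\dots,m$. Besov balls. $\psi_{jk}$ ($j\ge 0$, $0\le k\le 2^j-1$) is a Cohen–Daubechies–Vial compactly supported orthonormal wavelet basis of $L_2[0,1]$ with $N>s$ vanishing moments (coarsest-level scaling functions included in the indexing), $f_{jk}=\langle f,\psi_{jk}\rangle$, $\|f\|_{B^s_{2,\infty}}^2=\sup_{j}2^{2js}\sum_{k=0}^{2^j-1}f_{jk}^2$ and $B^s_{2,\infty}(L)=\{f\in L_2[0,1]:\|f\|_{B^s_{2,\infty}}<L\}$.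 Notation. $a\wedge b=\min(a,b)$. For positive sequences, $a_n\lesssim b_n$ (equivalently $b_n\gtrsim a_n$) means that there exists a universal positive constant $C$ such that $a_n\le Cb_n$.
   Formalization: The constant is not fully universal: it may depend on s, σ, the wavelet basis and a prescribed lower bound L_0>0 for L (uniform over L≥L_0, m and B), and the bound is for all large n; with one constant for all σ, L and n the claim fails. *)

theory Defs
  imports "HOL-Probability.Probability" "HOL-Library.Landau_Symbols"
begin

section \<open>The space \<open>L\<^sub>2[0,1]\<close>\<close>

text \<open>
  Elements of \<open>L\<^sub>2[0,1]\<close> are represented by Borel functions on the real line, of which only
  the restriction to the unit interval matters.
\<close>

definition L2_01 :: "(real \<Rightarrow> real) set" where
  "L2_01 = {f \<in> borel_measurable borel. set_integrable lborel {0..1} (\<lambda>x. (f x)\<^sup>2)}"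

definition inner01 :: "(real \<Rightarrow> real) \<Rightarrow> (real \<Rightarrow> real) \<Rightarrow> real" where
  "inner01 f g = (LINT x:{0..1}|lborel. f x * g x)"

definition sq_dist01 :: "(real \<Rightarrow> real) \<Rightarrow> (real \<Rightarrow> real) \<Rightarrow> ennreal" where
  "sq_dist01 f g = (\<integral>\<^sup>+x\<in>{0..1}. ennreal ((f x - g x)\<^sup>2) \<partial>lborel)"

section \<open>Cohen--Daubechies--Vial wavelets\<close>

text \<open>
  The compactly supported Daubechies pair with \<open>N\<close> vanishing moments: a filter \<open>h\<close> with
  \<open>2 N\<close> taps, centred so that father and mother are both supported in \<open>[1 - N, N]\<close>.
\<close>

definition daubechies_pair :: "nat \<Rightarrow> (real \<Rightarrow> real) \<Rightarrow> (real \<Rightarrow> real) \<Rightarrow> bool" where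
  "daubechies_pair N \<phi> \<psi> \<longleftrightarrow>
     1 \<le> N \<and>
     \<phi> \<in> borel_measurable borel \<and> bounded (range \<phi>) \<and>
     (\<forall>x. x \<notin> {1 - real N..real N} \<longrightarrow> \<phi> x = 0) \<and>
     (LINT x|lborel. \<phi> x) = 1 \<and>
     (\<forall>l::int. (LINT x|lborel. \<phi> x * \<phi> (x - of_int l)) = of_bool (l = 0)) \<and>
     (\<exists>h :: int \<Rightarrow> real.
        (\<forall>l. l \<notin> {1 - int N..int N} \<longrightarrow> h l = 0) \<and>
        (\<forall>x. \<phi> x = sqrt 2 * (\<Sum>l = 1 - int N..int N. h l * \<phi> (2 * x - of_int l))) \<and>
        (\<forall>x. \<psi> x = sqrt 2 * (\<Sum>l = 1 - int N..int N.
                 (- 1) powi l * h (1 - l) * \<phi> (2 * x - of_int l)))) \<and>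
     (\<forall>p<N. (LINT x|lborel. x ^ p * \<psi> x) = 0)"

text \<open>
  Edge scaling functions on the half-line \<open>[0, \<infinity>)\<close>. The inner sum is the function
  \<open>\<Sum>\<^sub>n (n choose p) \<phi>(x + n - N + 1)\<close>, \<open>p \<le> n \<le> 2 N - 2\<close>, of Cohen, Daubechies and Vial; together
  with the interior translates these functions reproduce polynomials of degree less than \<open>N\<close>.
  The matrix \<open>a\<close> is the change of basis that orthonormalises them; orthonormality
  is imposed in \<open>cdv_basis\<close> below.
\<close>

definition edge_scaling :: "nat \<Rightarrow> (real \<Rightarrow> real) \<Rightarrow> (nat \<Rightarrow> real \<Rightarrow> real) \<Rightarrow> bool" where
  "edge_scaling N \<phi> e \<longleftrightarrow>
     (\<exists>a :: nat \<Rightarrow> nat \<Rightarrow> real. \<forall>r<N. \<forall>x. e r x =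
        (if 0 \<le> x
         then (\<Sum>p<N. a r p * (\<Sum>n = p..2 * N - 2. real (n choose p) * \<phi> (x + real n - real N + 1)))
         else 0))"

definition edge_wavelet :: "nat \<Rightarrow> (nat \<Rightarrow> real \<Rightarrow> real) \<Rightarrow> bool" where
  "edge_wavelet N e \<longleftrightarrow>
     (\<forall>r<N. e r \<in> borel_measurable borel \<and> (\<forall>x. x \<notin> {0..2 * real N - 1} \<longrightarrow> e r x = 0))"

text \<open>
  The \<open>2\<^sup>j\<close> functions of level \<open>j\<close>: \<open>N\<close> at the left edge, \<open>2\<^sup>j - 2 N\<close> interior translates, and
  \<open>N\<close> at the right edge, the latter being given on \<open>[0, \<infinity>)\<close> and reflected at \<open>x = 1\<close>.
\<close>

definition cdv_family ::
  "nat \<Rightarrow> (nat \<Rightarrow> real \<Rightarrow> real) \<Rightarrow> (real \<Rightarrow> real) \<Rightarrow> (nat \<Rightarrow> real \<Rightarrow> real) \<Rightarrow>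
   nat \<Rightarrow> nat \<Rightarrow> real \<Rightarrow> real" where
  "cdv_family N gL g gR j k x =
     sqrt (2 ^ j) *
     (if k < N then gL k (2 ^ j * x)
      else if k < 2 ^ j - N then g (2 ^ j * x - real k)
      else gR (2 ^ j - 1 - k) (2 ^ j * (1 - x)))"

text \<open>
  \<open>\<Phi> j0 k\<close>, \<open>k < 2\<^sup>j\<^sup>0\<close>, are the scaling functions of the coarsest level \<open>j0\<close> and
  \<open>\<Psi> j k\<close>, \<open>j \<ge> j0\<close>, \<open>k < 2\<^sup>j\<close>, the wavelets; together they form an orthonormal basis.
  The condition \<open>2 N \<le> 2\<^sup>j\<^sup>0\<close> separates the two edges.
\<close>

definition cdv_basis ::
  "nat \<Rightarrow> nat \<Rightarrow> (nat \<Rightarrow> nat \<Rightarrow> real \<Rightarrow> real) \<Rightarrow> (nat \<Rightarrow> nat \<Rightarrow> real \<Rightarrow> real) \<Rightarrow> bool" where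
  "cdv_basis N j0 \<Phi> \<Psi> \<longleftrightarrow>
     2 * N \<le> 2 ^ j0 \<and>
     (\<exists>\<phi> \<psi> \<phi>L \<phi>R \<psi>L \<psi>R.
        daubechies_pair N \<phi> \<psi> \<and>
        edge_scaling N \<phi> \<phi>L \<and> edge_scaling N (\<lambda>x. \<phi> (1 - x)) \<phi>R \<and>
        edge_wavelet N \<psi>L \<and> edge_wavelet N \<psi>R \<and>
        \<Phi> = cdv_family N \<phi>L \<phi> \<phi>R \<and> \<Psi> = cdv_family N \<psi>L \<psi> \<psi>R) \<and>
     \<comment> \<open>\<open>\<Psi> j\<close> lies in the span \<open>V\<^bsub>j+1\<^esub>\<close> of \<open>\<Phi> (j + 1)\<close> and is orthogonal to \<open>V\<^sub>j\<close>\<close>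
     (\<forall>j\<ge>j0. \<forall>k<2 ^ j. \<forall>l<2 ^ j. inner01 (\<Phi> j k) (\<Phi> j l) = of_bool (k = l)) \<and>
     (\<forall>j\<ge>j0. \<forall>k<2 ^ j. \<forall>l<2 ^ j. inner01 (\<Phi> j k) (\<Psi> j l) = 0) \<and>
     (\<forall>j\<ge>j0. \<forall>k<2 ^ j. \<exists>b :: nat \<Rightarrow> real.
        AE x in lborel. x \<in> {0..1} \<longrightarrow> \<Psi> j k x = (\<Sum>l<2 ^ (j + 1). b l * \<Phi> (j + 1) l x)) \<and>
     \<comment> \<open>orthonormal basis of \<open>L\<^sub>2[0,1]\<close>\<close>
     (\<forall>i\<ge>j0. \<forall>j\<ge>j0. \<forall>k<2 ^ i. \<forall>l<2 ^ j.
        inner01 (\<Psi> i k) (\<Psi> j l) = of_bool (i = j \<and> k = l)) \<and>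
     (\<forall>j\<ge>j0. \<forall>k<2 ^ j0. \<forall>l<2 ^ j. inner01 (\<Phi> j0 k) (\<Psi> j l) = 0) \<and>
     (\<forall>f\<in>L2_01. (\<forall>k<2 ^ j0. inner01 f (\<Phi> j0 k) = 0) \<longrightarrow>
        (\<forall>j\<ge>j0. \<forall>k<2 ^ j. inner01 f (\<Psi> j k) = 0) \<longrightarrow>
        (AE x in lborel. x \<in> {0..1} \<longrightarrow> f x = 0))"

section \<open>Besov balls\<close>

text \<open>
  Squared norm of \<open>B\<^sup>s\<^bsub>2,\<infinity>\<^esub>\<close>. The \<open>2\<^sup>j\<^sup>0\<close> coefficients with respect to the coarsest scaling
  functions form a block of their own, with the weight of level \<open>j0\<close>.
\<close>

definition besov_norm_sq ::
  "nat \<Rightarrow> (nat \<Rightarrow> nat \<Rightarrow> real \<Rightarrow> real) \<Rightarrow> (nat \<Rightarrow> nat \<Rightarrow> real \<Rightarrow> real) \<Rightarrow> real \<Rightarrow>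
   (real \<Rightarrow> real) \<Rightarrow> ennreal" where
  "besov_norm_sq j0 \<Phi> \<Psi> s f =
     sup (ennreal (2 powr (2 * real j0 * s) * (\<Sum>k<2 ^ j0. (inner01 f (\<Phi> j0 k))\<^sup>2)))
         (SUP j\<in>{j0..}. ennreal (2 powr (2 * real j * s) * (\<Sum>k<2 ^ j. (inner01 f (\<Psi> j k))\<^sup>2)))"

definition besov_ball ::
  "nat \<Rightarrow> (nat \<Rightarrow> nat \<Rightarrow> real \<Rightarrow> real) \<Rightarrow> (nat \<Rightarrow> nat \<Rightarrow> real \<Rightarrow> real) \<Rightarrow> real \<Rightarrow> real \<Rightarrow>
   (real \<Rightarrow> real) set" where
  "besov_ball j0 \<Phi> \<Psi> s L = {f \<in> L2_01. besov_norm_sq j0 \<Phi> \<Psi> s f < ennreal (L\<^sup>2)}"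

section \<open>Distributed random design regression\<close>

text \<open>Law of one pair \<open>(T, X)\<close>, \<open>X = f T + \<sigma> \<epsilon>\<close>.\<close>

definition obs_law :: "real \<Rightarrow> (real \<Rightarrow> real) \<Rightarrow> (real \<times> real) measure" where
  "obs_law \<sigma> f =
     distr (uniform_measure lborel {0<..<1} \<Otimes>\<^sub>M density lborel (\<lambda>x. ennreal (std_normal_density x)))
       (borel \<Otimes>\<^sub>M borel) (\<lambda>(t, e). (t, f t + \<sigma> * e))"

text \<open>
  Joint law of all data for \<open>m\<close> machines (numbered from \<open>0\<close>) with \<open>q\<close> observations each:
  observation \<open>l\<close> of machine \<open>i\<close> in data set \<open>x\<close> is \<open>x i l\<close>.
\<close>

definition data_law ::
  "nat \<Rightarrow> nat \<Rightarrow> real \<Rightarrow> (real \<Rightarrow> real) \<Rightarrow> (nat \<Rightarrow> nat \<Rightarrow> real \<times> real) measure" where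
  "data_law m q \<sigma> f = (\<Pi>\<^sub>M i\<in>{..<m}. \<Pi>\<^sub>M l\<in>{..<q}. obs_law \<sigma> f)"

text \<open>
  Distributed estimators, as functions of the whole data. Machine \<open>i\<close> sends the binary string
  \<open>Y i\<close>, which may be empty. There are only countably many tuples of
  strings, so every decoder \<open>g\<close> is measurable.
\<close>

definition dist_estimators ::
  "nat \<Rightarrow> nat \<Rightarrow> real \<Rightarrow> (nat \<Rightarrow> real) \<Rightarrow> (real \<Rightarrow> real) set \<Rightarrow>
   ((nat \<Rightarrow> nat \<Rightarrow> real \<times> real) \<Rightarrow> real \<Rightarrow> real) set" where
  "dist_estimators m q \<sigma> B F =
     {fhat. \<exists>(Y :: nat \<Rightarrow> (nat \<Rightarrow> real \<times> real) \<Rightarrow> bool list) (g :: (nat \<Rightarrow> bool list) \<Rightarrow> real \<Rightarrow> real).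
        (\<forall>i<m. Y i \<in> measurable (\<Pi>\<^sub>M l\<in>{..<q}. borel \<Otimes>\<^sub>M borel) (count_space UNIV)) \<and>
        (\<forall>f\<in>F. \<forall>i<m. (\<integral>\<^sup>+x. ennreal (real (length (Y i (x i)))) \<partial>data_law m q \<sigma> f) \<le> ennreal (B i)) \<and>
        (\<forall>y. g y \<in> L2_01) \<and>
        fhat = (\<lambda>x. g (\<lambda>i\<in>{..<m}. Y i (x i)))}"

definition dist_minimax_risk ::
  "nat \<Rightarrow> nat \<Rightarrow> real \<Rightarrow> (nat \<Rightarrow> real) \<Rightarrow> (real \<Rightarrow> real) set \<Rightarrow> ennreal" where
  "dist_minimax_risk m q \<sigma> B F =
     (INF fhat\<in>dist_estimators m q \<sigma> B F. SUP f\<in>F. \<integral>\<^sup>+x. sq_dist01 (fhat x) f \<partial>data_law m q \<sigma> f)"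

text \<open>
  The equation for \<open>\<delta>\<^sub>n\<close>. Its positive solution is unique, the right-hand side being nonincreasing
  in \<open>d\<close>; positivity is required because division by zero would make \<open>d = 0\<close> a spurious solution.
\<close>

definition solves_delta :: "real \<Rightarrow> nat \<Rightarrow> nat \<Rightarrow> (nat \<Rightarrow> real) \<Rightarrow> real \<Rightarrow> bool" where
  "solves_delta s n m B d \<longleftrightarrow>
     0 < d \<and>
     d = min (real m / (real n * log 2 (real n)))
             (real m / (real n * (\<Sum>i<m. min (log 2 (real n) * d powr (1 / (1 + 2 * s)) * B i) 1)))"

end

theory Submission
  imports Defs
begin

text \<open>
  Assouad's method on the hypercube of functions \<open>a \<Sum>\<^sub>k \<plusminus>\<psi>\<^sub>k\<close>, where the \<open>\<psi>\<^sub>k\<close> are wavelets of one level \<open>j\<close>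
  with disjoint supports, \<open>2\<^sup>j\<close> is of order \<open>(L\<^sup>2/\<delta>\<^sub>n)\<^bsup>1/(1+2s)\<^esup>\<close> and \<open>a\<^sup>2\<close> is a small multiple of \<open>\<delta>\<^sub>n\<close>.
  Given its design, the data of a machine are Gaussian, and the normalised likelihood difference
  of two neighbours in the hypercube is the hyperbolic tangent of a linear form. The centred vector
  of these functions is sub-Gaussian by Lipschitz concentration, so by the entropy (Gibbs) inequality
  its conditional mean given a message of probability \<open>p\<close> has squared length at most of order
  \<open>(n a\<^sup>2/m) log (1/p)\<close>. Summed over the messages, the triangular discriminations between neighbours
  are therefore bounded by the description length of the message, that is by \<open>B log n\<close>; trivially they
  are bounded by the number of wavelets. Hellinger affinities multiply over the machines, and the
  equation for \<open>\<delta>\<^sub>n\<close> balances the total.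
\<close>

section \<open>Product measures and Gaussian regression data\<close>

text \<open>Neighbouring densities are compared relative to their sum because (p - p') / (p + p') is
  exactly a hyperbolic tangent: bounded and Lipschitz, unlike p / p'. The price is that the tangents
  are not centred; but two neighbours have the same mean of their own tangent, it is at most 1/2,
  and so it costs a constant factor. Triangular discrimination suits every step: it is jointly
  convex, so the design can be averaged out; it never exceeds p + p', which deals with atypical
  designs; and it dominates the squared Hellinger distance. Budgets may be far below one bit, so
  entropy is bounded by a code that is almost free for the empty string; this is where the log n in
  the equation for \<delta>_n comes from. The growth condition on m keeps the number of design
  points per cell of order at least log n, so that a Chernoff bound controls all cells at once.
  Uniformity in L >= L0 rests on K \<delta>_n^{1/(1+2s)}, with K the number of wavelets used,
  staying away from 0.\<close>

lemma PiM_density: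
  assumes fin: "finite I"
    and M: "\<And>i. sigma_finite_measure (M i)"
    and D: "\<And>i. sigma_finite_measure (density (M i) (f i))"
    and f: "\<And>i. i \<in> I \<Longrightarrow> f i \<in> borel_measurable (M i)"
  shows "PiM I (\<lambda>i. density (M i) (f i)) = density (PiM I M) (\<lambda>x. \<Prod>i\<in>I. f i (x i))"
proof -
  interpret M: product_sigma_finite M by (simp add: product_sigma_finite_def M)
  interpret D: product_sigma_finite "\<lambda>i. density (M i) (f i)"
    by (simp add: product_sigma_finite_def D)
  note f[measurable]
  show ?thesis
  proof (rule D.PiM_eqI[symmetric, OF fin])
    show "sets (density (PiM I M) (\<lambda>x. \<Prod>i\<in>I. f i (x i))) = sets (PiM I (\<lambda>i. density (M i) (f i)))"
      by (simp cong: sets_PiM_cong)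
  next
    fix A assume "\<And>i. i \<in> I \<Longrightarrow> A i \<in> sets (density (M i) (f i))"
    then have A[measurable]: "\<And>i. i \<in> I \<Longrightarrow> A i \<in> sets (M i)" by simp
    have meas: "Pi\<^sub>E I A \<in> sets (PiM I M)" using fin A by (intro sets_PiM_I_finite) auto
    have "emeasure (density (PiM I M) (\<lambda>x. \<Prod>i\<in>I. f i (x i))) (Pi\<^sub>E I A)
        = (\<integral>\<^sup>+x. (\<Prod>i\<in>I. f i (x i)) * indicator (Pi\<^sub>E I A) x \<partial>PiM I M)"
      using fin meas by (intro emeasure_density) auto
    also have "\<dots> = (\<integral>\<^sup>+x. (\<Prod>i\<in>I. f i (x i) * indicator (A i) (x i)) \<partial>PiM I M)"
    proof (rule nn_integral_cong)
      fix x assume x: "x \<in> space (PiM I M)"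
      have "indicator (Pi\<^sub>E I A) x = (\<Prod>i\<in>I. indicator (A i) (x i) :: ennreal)"
        using x fin by (auto simp: indicator_def space_PiM PiE_def Pi_def split: if_splits)
      then show "(\<Prod>i\<in>I. f i (x i)) * indicator (Pi\<^sub>E I A) x = (\<Prod>i\<in>I. f i (x i) * indicator (A i) (x i))"
        by (simp add: prod.distrib)
    qed
    also have "\<dots> = (\<Prod>i\<in>I. \<integral>\<^sup>+x. f i x * indicator (A i) x \<partial>M i)"
      using fin by (intro M.product_nn_integral_prod) auto
    also have "\<dots> = (\<Prod>i\<in>I. emeasure (density (M i) (f i)) (A i))"
      by (intro prod.cong refl) (simp add: emeasure_density)
    finally show "emeasure (density (PiM I M) (\<lambda>x. \<Prod>i\<in>I. f i (x i))) (Pi\<^sub>E I A) = \<dots>" .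
  qed
qed

section \<open>Laws of messages with countably many values\<close>

lemma nn_integral_countable_image:
  assumes Y: "Y \<in> measurable M (count_space C)" and C: "countable C"
  shows "(\<integral>\<^sup>+x. F (Y x) \<partial>M) = (\<integral>\<^sup>+y. F y * emeasure M {x\<in>space M. Y x = y} \<partial>count_space C)"
proof -
  have S: "{x\<in>space M. Y x = y} \<in> sets M" if "y \<in> C" for y
    using measurable_sets[OF Y, of "{y}"] that by (simp add: vimage_def Int_def conj_commute)
  have "(\<integral>\<^sup>+x. F (Y x) \<partial>M) = (\<integral>\<^sup>+x. \<integral>\<^sup>+y. F y * indicator {x\<in>space M. Y x = y} x \<partial>count_space C \<partial>M)"
  proof (rule nn_integral_cong)
    fix x assume x: "x \<in> space M"
    then have YC: "Y x \<in> C" using measurable_space[OF Y] by simp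
    have "(\<integral>\<^sup>+y. F y * indicator {x\<in>space M. Y x = y} x \<partial>count_space C)
        = (\<integral>\<^sup>+y. F (Y x) * indicator {Y x} y \<partial>count_space C)"
      using x by (intro nn_integral_cong) (auto simp: indicator_def)
    also have "\<dots> = F (Y x)" using YC by (simp add: nn_integral_cmult_indicator)
    finally show "F (Y x) = (\<integral>\<^sup>+y. F y * indicator {x\<in>space M. Y x = y} x \<partial>count_space C)" ..
  qed
  also have "\<dots> = (\<integral>\<^sup>+y. \<integral>\<^sup>+x. F y * indicator {x\<in>space M. Y x = y} x \<partial>M \<partial>count_space C)"
    using S by (intro nn_integral_count_space_nn_integral C) auto
  also have "\<dots> = (\<integral>\<^sup>+y. F y * emeasure M {x\<in>space M. Y x = y} \<partial>count_space C)"
    using S by (intro nn_integral_cong) (simp add: nn_integral_cmult_indicator)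
  finally show ?thesis .
qed

lemma sets_message:
  "Y \<in> measurable M (count_space UNIV) \<Longrightarrow> {x\<in>space M. Y x = y} \<in> sets M"
  using measurable_sets[of Y M "count_space UNIV" "{y}"] by (simp add: vimage_def Int_def conj_commute)

lemma (in prob_space) nn_integral_prob_message:
  fixes Y :: "'a \<Rightarrow> 'b :: countable"
  assumes "Y \<in> measurable M (count_space UNIV)"
  shows "(\<integral>\<^sup>+y. ennreal (prob {x\<in>space M. Y x = y}) \<partial>count_space UNIV) = 1"
  using nn_integral_countable_image[OF assms, of "\<lambda>_. 1"] prob_space by (simp add: emeasure_eq_measure)

text \<open>The restriction matters: functions from \<open>nat\<close> to \<open>bool list\<close>
  form an uncountable set, but the extensional ones on \<open>{..<m}\<close> form a countable one,
  so composing with an arbitrary decoder preserves measurability.\<close>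

definition messages :: "nat \<Rightarrow> (nat \<Rightarrow> 'a \<Rightarrow> 'b) \<Rightarrow> (nat \<Rightarrow> 'a) \<Rightarrow> nat \<Rightarrow> 'b" where
  "messages m Y x = (\<lambda>i\<in>{..<m}. Y i (x i))"

lemma measurable_messages:
  fixes Y :: "nat \<Rightarrow> 'a \<Rightarrow> 'b :: countable"
  assumes Y: "\<forall>i<m. Y i \<in> measurable (R i) (count_space UNIV)"
  shows "messages m Y \<in> measurable (PiM {..<m} R) (count_space (PiE {..<m} (\<lambda>_. UNIV)))"
    and "y \<in> PiE {..<m} (\<lambda>_. UNIV) \<Longrightarrow>
      {x\<in>space (PiM {..<m} R). messages m Y x = y} = PiE {..<m} (\<lambda>i. {x\<in>space (R i). Y i x = y i})"
proof -
  have eq: "{x\<in>space (PiM {..<m} R). messages m Y x = y} = PiE {..<m} (\<lambda>i. {x\<in>space (R i). Y i x = y i})"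
    if "y \<in> PiE {..<m} (\<lambda>_. UNIV)" for y
    using that by (auto simp: space_PiM PiE_def Pi_def messages_def extensional_def fun_eq_iff)
  then show "y \<in> PiE {..<m} (\<lambda>_. UNIV) \<Longrightarrow>
      {x\<in>space (PiM {..<m} R). messages m Y x = y} = PiE {..<m} (\<lambda>i. {x\<in>space (R i). Y i x = y i})" .
  have "countable (PiE {..<m} (\<lambda>_. UNIV) :: (nat \<Rightarrow> 'b) set)" by (intro countable_PiE) auto
  then show "messages m Y \<in> measurable (PiM {..<m} R) (count_space (PiE {..<m} (\<lambda>_. UNIV)))"
  proof (subst measurable_count_space_eq_countable, assumption, intro conjI ballI)
    fix y assume y: "y \<in> PiE {..<m} (\<lambda>_. UNIV :: 'b set)"
    have "messages m Y -` {y} \<inter> space (PiM {..<m} R) = {x\<in>space (PiM {..<m} R). messages m Y x = y}" by auto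
    also have "\<dots> \<in> sets (PiM {..<m} R)"
      unfolding eq[OF y] using Y by (intro sets_PiM_I_finite sets_message) auto
    finally show "messages m Y -` {y} \<inter> space (PiM {..<m} R) \<in> sets (PiM {..<m} R)" .
  qed (auto simp: messages_def)
qed

text \<open>The machines are independent and the event is a box. This is the source of the products
  over machines in \<open>two_point_bound\<close>.\<close>

lemma emeasure_messages:
  fixes Y :: "nat \<Rightarrow> 'a \<Rightarrow> 'b :: countable"
  assumes R: "\<And>i. prob_space (R i)" and Y: "\<forall>i<m. Y i \<in> measurable (R i) (count_space UNIV)"
    and y: "y \<in> PiE {..<m} (\<lambda>_. UNIV)"
  shows "emeasure (PiM {..<m} R) {x\<in>space (PiM {..<m} R). messages m Y x = y}
      = ennreal (\<Prod>i<m. measure (R i) {x\<in>space (R i). Y i x = y i})"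
proof -
  interpret R: prob_space "R i" for i by (rule R)
  interpret PR: product_sigma_finite R by (simp add: product_sigma_finite_def R.sigma_finite_measure_axioms)
  show ?thesis
    unfolding measurable_messages(2)[OF Y y]
    using Y by (subst PR.emeasure_PiM) (auto simp: R.emeasure_eq_measure prod_ennreal intro!: sets_message)
qed

section \<open>Gaussian noise and the law of the regression data\<close>

abbreviation normal_law :: "real \<Rightarrow> real \<Rightarrow> real measure" where
  "normal_law \<mu> \<sigma> \<equiv> density lborel (\<lambda>x. ennreal (normal_density \<mu> \<sigma> x))"

lemma distr_affine_std_normal:
  assumes "0 < \<sigma>"
  shows "distr (normal_law 0 1) borel (\<lambda>x. \<mu> + \<sigma> * x) = normal_law \<mu> \<sigma>"
proof -
  interpret prob_space "normal_law 0 1" by (simp add: prob_space_normal_density)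
  have "distributed (normal_law 0 1) lborel (\<lambda>x. x) (normal_density 0 1)"
    by (auto simp: distributed_def distr_id2)
  from normal_density_affine[OF this, of \<sigma> \<mu>] assms
  have "distributed (normal_law 0 1) lborel (\<lambda>x. \<mu> + \<sigma> * x) (normal_density \<mu> \<sigma>)" by simp
  from distributed_distr_eq_density[OF this] show ?thesis
    by (simp cong: distr_cong)
qed

lemma distr_affine_PiM:
  assumes "0 < \<sigma>" "finite I"
  shows "distr (PiM I (\<lambda>_. normal_law 0 1)) (PiM I (\<lambda>_. borel)) (\<lambda>z. \<lambda>l\<in>I. v l + \<sigma> * z l)
     = PiM I (\<lambda>l. normal_law (v l) \<sigma>)"
proof -
  interpret D: product_sigma_finite "\<lambda>l. normal_law (v l) \<sigma>"
    by (intro product_sigma_finite.intro prob_space_imp_sigma_finite prob_space_normal_density assms)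
  interpret N: product_sigma_finite "\<lambda>l. normal_law 0 1"
    by (intro product_sigma_finite.intro prob_space_imp_sigma_finite prob_space_normal_density) simp
  show ?thesis
  proof (rule D.PiM_eqI)
    show "finite I" by fact
    show "sets (distr (PiM I (\<lambda>_. normal_law 0 1)) (PiM I (\<lambda>_. borel)) (\<lambda>z. \<lambda>l\<in>I. v l + \<sigma> * z l))
      = sets (PiM I (\<lambda>l. normal_law (v l) \<sigma>))"
      by (simp cong: sets_PiM_cong)
  next
    fix A assume A: "\<And>i. i \<in> I \<Longrightarrow> A i \<in> sets (normal_law (v i) \<sigma>)"
    have A': "A i \<in> sets borel" if "i \<in> I" for i using A[OF that] by simp
    let ?X = "\<lambda>z. \<lambda>l\<in>I. v l + \<sigma> * z l"
    let ?N = "PiM I (\<lambda>_. normal_law 0 1)"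
    have X: "?X \<in> measurable ?N (PiM I (\<lambda>_. borel))"
      by (rule measurable_restrict) measurable
    have pre: "(\<lambda>x. v i + \<sigma> * x) -` A i \<in> sets borel" if "i \<in> I" for i
      using measurable_sets[of "\<lambda>x. v i + \<sigma> * x" borel borel "A i"] A'[OF that] by simp
    have "emeasure (distr ?N (PiM I (\<lambda>_. borel)) ?X) (Pi\<^sub>E I A) = emeasure ?N (?X -` Pi\<^sub>E I A \<inter> space ?N)"
      using assms A' by (intro emeasure_distr X sets_PiM_I_finite) auto
    also have "?X -` Pi\<^sub>E I A \<inter> space ?N = (\<Pi>\<^sub>E i\<in>I. (\<lambda>x. v i + \<sigma> * x) -` A i)"
      by (auto simp: space_PiM PiE_def Pi_def)
    also have "emeasure ?N \<dots> = (\<Prod>i\<in>I. emeasure (normal_law 0 1) ((\<lambda>x. v i + \<sigma> * x) -` A i))"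
      using assms pre by (intro N.emeasure_PiM) auto
    also have "\<dots> = (\<Prod>i\<in>I. emeasure (normal_law (v i) \<sigma>) (A i))"
      using A' by (intro prod.cong refl)
        (simp add: distr_affine_std_normal[OF assms(1), symmetric] emeasure_distr)
    finally show "emeasure (distr ?N (PiM I (\<lambda>_. borel)) ?X) (Pi\<^sub>E I A) = \<dots>" .
  qed
qed

abbreviation unif :: "real measure" where
  "unif \<equiv> uniform_measure lborel {0<..<1}"

lemma prob_space_unif: "prob_space unif"
  by (intro prob_space_uniform_measure) auto

lemma prob_space_obs_law:
  assumes [measurable]: "f \<in> borel_measurable borel"
  shows "prob_space (obs_law \<sigma> f)"
proof -
  interpret N: prob_space "normal_law 0 1" by (intro prob_space_normal_density) simp
  interpret U: prob_space unif by (rule prob_space_unif)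
  interpret P: pair_prob_space unif "normal_law 0 1" ..
  show ?thesis
    unfolding obs_law_def std_normal_density_def[symmetric] by (intro P.prob_space_distr) simp
qed

text \<open>The model draws one pair (design point, response) after the other. Regrouping them into
  the whole design and the whole noise vector is what makes conditioning on the design of a machine
  possible.\<close>

lemma PiM_obs_law:
  assumes [measurable]: "f \<in> borel_measurable borel" and "finite I"
  shows "PiM I (\<lambda>_. obs_law \<sigma> f) =
    distr (PiM I (\<lambda>_. unif) \<Otimes>\<^sub>M PiM I (\<lambda>_. normal_law 0 1)) (PiM I (\<lambda>_. borel \<Otimes>\<^sub>M borel))
      (\<lambda>(t, z). \<lambda>l\<in>I. (t l, f (t l) + \<sigma> * z l))"
proof -
  interpret N1: prob_space "normal_law 0 1" by (intro prob_space_normal_density) simp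
  interpret U1: prob_space unif by (rule prob_space_unif)
  interpret N: product_prob_space "\<lambda>_. normal_law 0 1" I ..
  interpret U: product_prob_space "\<lambda>_. unif" I ..
  interpret D: product_sigma_finite "\<lambda>_. obs_law \<sigma> f"
    by (intro product_sigma_finite.intro prob_space_imp_sigma_finite prob_space_obs_law) simp
  have sfN: "sigma_finite_measure (PiM I (\<lambda>_. normal_law 0 1))"
    by (intro prob_space_imp_sigma_finite prob_space_PiM N1.prob_space_axioms)
  have so: "sets (obs_law \<sigma> f) = sets (borel \<Otimes>\<^sub>M borel)" by (simp add: obs_law_def)
  let ?X = "\<lambda>(t, z). \<lambda>l\<in>I. (t l, f (t l) + \<sigma> * z l)"
  let ?N = "PiM I (\<lambda>_. normal_law 0 1)" and ?U = "PiM I (\<lambda>_. unif)"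
  have X[measurable]: "?X \<in> measurable (?U \<Otimes>\<^sub>M ?N) (PiM I (\<lambda>_. borel \<Otimes>\<^sub>M borel))"
    unfolding case_prod_beta by (rule measurable_restrict) measurable
  show ?thesis
  proof (rule D.PiM_eqI[symmetric])
    show "finite I" by fact
    show "sets (distr (?U \<Otimes>\<^sub>M ?N) (PiM I (\<lambda>_. borel \<Otimes>\<^sub>M borel)) ?X) = sets (PiM I (\<lambda>_. obs_law \<sigma> f))"
      using so by (simp cong: sets_PiM_cong)
  next
    fix A assume A: "\<And>i. i \<in> I \<Longrightarrow> A i \<in> sets (obs_law \<sigma> f)"
    have [measurable]: "A i \<in> sets (borel \<Otimes>\<^sub>M borel)" if "i \<in> I" for i using A[OF that] so by simp
    have PA[measurable]: "Pi\<^sub>E I A \<in> sets (PiM I (\<lambda>_. borel \<Otimes>\<^sub>M borel))"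
      using assms by (intro sets_PiM_I_finite) auto
    have ind: "indicator (Pi\<^sub>E I A) (?X (t, z)) = (\<Prod>i\<in>I. indicator (A i) (t i, f (t i) + \<sigma> * z i) :: ennreal)" for t z
      using \<open>finite I\<close> by (auto simp: indicator_def PiE_def Pi_def split: if_splits)
    have "emeasure (distr (?U \<Otimes>\<^sub>M ?N) (PiM I (\<lambda>_. borel \<Otimes>\<^sub>M borel)) ?X) (Pi\<^sub>E I A)
      = (\<integral>\<^sup>+x. indicator (Pi\<^sub>E I A) x \<partial>distr (?U \<Otimes>\<^sub>M ?N) (PiM I (\<lambda>_. borel \<Otimes>\<^sub>M borel)) ?X)"
      by (rule nn_integral_indicator[symmetric]) simp
    also have "\<dots> = (\<integral>\<^sup>+x. indicator (Pi\<^sub>E I A) (?X x) \<partial>(?U \<Otimes>\<^sub>M ?N))"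
      by (intro nn_integral_distr) auto
    also have "\<dots> = (\<integral>\<^sup>+t. \<integral>\<^sup>+z. indicator (Pi\<^sub>E I A) (?X (t, z)) \<partial>?N \<partial>?U)"
      by (intro sigma_finite_measure.nn_integral_fst[OF sfN, symmetric]) auto
    also have "\<dots> = (\<integral>\<^sup>+t. \<integral>\<^sup>+z. (\<Prod>i\<in>I. indicator (A i) (t i, f (t i) + \<sigma> * z i)) \<partial>?N \<partial>?U)"
      by (simp only: ind)
    also have "\<dots> = (\<integral>\<^sup>+t. (\<Prod>i\<in>I. \<integral>\<^sup>+z. indicator (A i) (t i, f (t i) + \<sigma> * z) \<partial>normal_law 0 1) \<partial>?U)"
    proof (rule nn_integral_cong, rule N.product_nn_integral_prod)
      fix t i assume "i \<in> I"
      then show "(\<lambda>z. indicator (A i) (t i, f (t i) + \<sigma> * z) :: ennreal) \<in> borel_measurable (normal_law 0 1)"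
        by measurable
    qed (use assms in auto)
    also have "\<dots> = (\<Prod>i\<in>I. \<integral>\<^sup>+t. \<integral>\<^sup>+z. indicator (A i) (t, f t + \<sigma> * z) \<partial>normal_law 0 1 \<partial>unif)"
    proof (rule U.product_nn_integral_prod)
      fix i assume "i \<in> I"
      then show "(\<lambda>t. \<integral>\<^sup>+z. indicator (A i) (t, f t + \<sigma> * z) \<partial>normal_law 0 1) \<in> borel_measurable unif"
        by measurable
    qed (use assms in auto)
    also have "\<dots> = (\<Prod>i\<in>I. emeasure (obs_law \<sigma> f) (A i))"
    proof (rule prod.cong[OF refl])
      fix i assume i: "i \<in> I"
      note [measurable] = i
      have "emeasure (obs_law \<sigma> f) (A i) = (\<integral>\<^sup>+x. indicator (A i) x \<partial>obs_law \<sigma> f)"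
        using A i by (intro nn_integral_indicator[symmetric]) auto
      also have "\<dots> = (\<integral>\<^sup>+x. indicator (A i) (case x of (t, e) \<Rightarrow> (t, f t + \<sigma> * e)) \<partial>(unif \<Otimes>\<^sub>M normal_law 0 1))"
        unfolding obs_law_def using i by (subst nn_integral_distr) auto
      also have "\<dots> = (\<integral>\<^sup>+t. \<integral>\<^sup>+z. indicator (A i) (t, f t + \<sigma> * z) \<partial>normal_law 0 1 \<partial>unif)"
        using i by (subst N1.nn_integral_fst[symmetric]) auto
      finally show "(\<integral>\<^sup>+t. \<integral>\<^sup>+z. indicator (A i) (t, f t + \<sigma> * z) \<partial>normal_law 0 1 \<partial>unif) = emeasure (obs_law \<sigma> f) (A i)" ..
    qed
    finally show "emeasure (distr (?U \<Otimes>\<^sub>M ?N) (PiM I (\<lambda>_. borel \<Otimes>\<^sub>M borel)) ?X) (Pi\<^sub>E I A) = \<dots>" .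
  qed
qed

section \<open>Lipschitz concentration\<close>

lemma tanh_real_lipschitz: "\<bar>tanh x - tanh y\<bar> \<le> \<bar>x - y :: real\<bar>"
proof -
  have *: "tanh b - tanh a \<le> b - a" if "a \<le> b" for a b :: real
  proof -
    have "a - tanh a \<le> b - tanh b"
    proof (rule DERIV_nonneg_imp_nondecreasing[OF that])
      fix z :: real
      have "((\<lambda>x. x - tanh x) has_real_derivative 1 - (1 - tanh z ^ 2) * 1) (at z)"
        by (auto intro!: derivative_eq_intros)
      then show "\<exists>y. ((\<lambda>x. x - tanh x) has_real_derivative y) (at z) \<and> 0 \<le> y"
        by (intro exI conjI) auto
    qed
    then show ?thesis by simp
  qed
  show ?thesis
    using *[of x y] *[of y x] by (cases "x \<le> y") (auto simp: abs_if)
qed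

text \<open>The supporting line of the exponential at \<open>z0\<close>. Integrated with
  \<open>z0\<close> a mean, it gives Jensen's inequality, and restricted to an event it gives the
  entropy inequality.\<close>

lemma exp_tangent: "exp z0 * (1 + z - z0) \<le> exp (z::real)"
proof -
  have "exp z0 * (1 + (z - z0)) \<le> exp z0 * exp (z - z0)"
    by (intro mult_left_mono exp_ge_add_one_self) auto
  then show ?thesis by (simp add: exp_diff algebra_simps)
qed

lemma nn_integral_exp_normal:
  assumes "0 < \<sigma>"
  shows "(\<integral>\<^sup>+x. ennreal (exp (b * x)) \<partial>normal_law \<mu> \<sigma>) = ennreal (exp (b * \<mu> + b\<^sup>2 * \<sigma>\<^sup>2 / 2))"
proof -
  interpret prob_space "normal_law (\<mu> + b * \<sigma>\<^sup>2) \<sigma>" by (intro prob_space_normal_density assms)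
  have eq: "normal_density \<mu> \<sigma> x * exp (b * x) = exp (b * \<mu> + b\<^sup>2 * \<sigma>\<^sup>2 / 2) * normal_density (\<mu> + b * \<sigma>\<^sup>2) \<sigma> x" for x
  proof -
    have "- (x - \<mu>)\<^sup>2 / (2 * \<sigma>\<^sup>2) + b * x = (b * \<mu> + b\<^sup>2 * \<sigma>\<^sup>2 / 2) + (- (x - (\<mu> + b * \<sigma>\<^sup>2))\<^sup>2 / (2 * \<sigma>\<^sup>2))"
      using assms by (simp add: field_simps power2_eq_square)
    then have "exp (- (x - \<mu>)\<^sup>2 / (2 * \<sigma>\<^sup>2)) * exp (b * x)
       = exp (b * \<mu> + b\<^sup>2 * \<sigma>\<^sup>2 / 2) * exp (- (x - (\<mu> + b * \<sigma>\<^sup>2))\<^sup>2 / (2 * \<sigma>\<^sup>2))"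
      by (simp only: exp_add[symmetric])
    then have "k * exp (- (x - \<mu>)\<^sup>2 / (2 * \<sigma>\<^sup>2)) * exp (b * x)
       = exp (b * \<mu> + b\<^sup>2 * \<sigma>\<^sup>2 / 2) * (k * exp (- (x - (\<mu> + b * \<sigma>\<^sup>2))\<^sup>2 / (2 * \<sigma>\<^sup>2)))" for k
      by (simp only: mult.assoc mult.left_commute[of _ k])
    then show ?thesis
      unfolding normal_density_def .
  qed
  have "(\<integral>\<^sup>+x. ennreal (exp (b * x)) \<partial>normal_law \<mu> \<sigma>)
     = (\<integral>\<^sup>+x. ennreal (normal_density \<mu> \<sigma> x * exp (b * x)) \<partial>lborel)"
    by (subst nn_integral_density) (auto simp: ennreal_mult intro!: nn_integral_cong)
  also have "\<dots> = (\<integral>\<^sup>+x. ennreal (exp (b * \<mu> + b\<^sup>2 * \<sigma>\<^sup>2 / 2)) * ennreal (normal_density (\<mu> + b * \<sigma>\<^sup>2) \<sigma> x) \<partial>lborel)"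
    unfolding eq by (simp add: ennreal_mult)
  also have "\<dots> = ennreal (exp (b * \<mu> + b\<^sup>2 * \<sigma>\<^sup>2 / 2)) * (\<integral>\<^sup>+x. ennreal (normal_density (\<mu> + b * \<sigma>\<^sup>2) \<sigma> x) \<partial>lborel)"
    by (intro nn_integral_cmult) auto
  also have "(\<integral>\<^sup>+x. ennreal (normal_density (\<mu> + b * \<sigma>\<^sup>2) \<sigma> x) \<partial>lborel) = 1"
    using emeasure_space_1 by (simp add: emeasure_density)
  finally show ?thesis by simp
qed

text \<open>Symmetrisation against an independent copy reduces the claim to the moment generating
  function of the difference of two copies.\<close>

lemma nn_integral_exp_lipschitz_normal:
  fixes g :: "real \<Rightarrow> real"
  assumes "0 < \<sigma>" and [measurable]: "g \<in> borel_measurable borel" and bnd: "\<And>x. \<bar>g x\<bar> \<le> C"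
    and lip: "\<And>x y. \<bar>g x - g y\<bar> \<le> c * \<bar>x - y\<bar>"
  shows "(\<integral>\<^sup>+x. ennreal (exp (g x - (\<integral>y. g y \<partial>normal_law \<mu> \<sigma>))) \<partial>normal_law \<mu> \<sigma>) \<le> ennreal (exp (c\<^sup>2 * \<sigma>\<^sup>2))"
proof -
  let ?N = "normal_law \<mu> \<sigma>"
  interpret prob_space ?N by (intro prob_space_normal_density assms)
  interpret P: pair_sigma_finite ?N ?N ..
  have int: "integrable ?N g"
    by (rule integrable_const_bound[of _ C]) (use bnd in auto)
  let ?m = "\<integral>y. g y \<partial>?N"
  \<comment> \<open>Jensen's inequality for an independent copy \<open>y\<close>: it replaces the
    unknown mean in the exponent by an average over \<open>y\<close>.\<close>
  have jensen: "ennreal (exp (- ?m)) \<le> (\<integral>\<^sup>+y. ennreal (exp (- g y)) \<partial>?N)"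
  proof -
    have ie: "integrable ?N (\<lambda>y. exp (- g y))"
      by (rule integrable_const_bound[of _ "exp C"]) (use bnd in \<open>auto intro!: AE_I2 simp: abs_le_iff minus_le_iff\<close>)
    have "exp (- ?m) = (\<integral>y. exp (- ?m) * (1 + - g y - - ?m) \<partial>?N)"
      using int prob_space by simp
    also have "\<dots> \<le> (\<integral>y. exp (- g y) \<partial>?N)"
      using int ie by (intro integral_mono exp_tangent) auto
    finally have "ennreal (exp (- ?m)) \<le> ennreal (\<integral>y. exp (- g y) \<partial>?N)"
      by (rule ennreal_leI)
    also have "\<dots> = (\<integral>\<^sup>+y. ennreal (exp (- g y)) \<partial>?N)"
      using ie by (intro nn_integral_eq_integral[symmetric]) auto
    finally show ?thesis .
  qed
  let ?D = "\<integral>\<^sup>+x. \<integral>\<^sup>+y. ennreal (exp (g x - g y)) \<partial>?N \<partial>?N"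
  have "(\<integral>\<^sup>+x. ennreal (exp (g x - ?m)) \<partial>?N) = (\<integral>\<^sup>+x. ennreal (exp (g x)) * ennreal (exp (- ?m)) \<partial>?N)"
    by (simp add: exp_diff exp_minus ennreal_mult[symmetric] field_simps)
  also have "\<dots> \<le> (\<integral>\<^sup>+x. ennreal (exp (g x)) * (\<integral>\<^sup>+y. ennreal (exp (- g y)) \<partial>?N) \<partial>?N)"
    by (intro nn_integral_mono mult_left_mono jensen) auto
  also have "\<dots> = ?D"
    by (intro nn_integral_cong)
       (simp add: nn_integral_cmult[symmetric] ennreal_mult[symmetric] exp_add[symmetric])
  finally have 1: "(\<integral>\<^sup>+x. ennreal (exp (g x - ?m)) \<partial>?N) \<le> ?D" .
  have sym: "(\<integral>\<^sup>+x. \<integral>\<^sup>+y. ennreal (exp (g y - g x)) \<partial>?N \<partial>?N) = ?D"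
    by (rule P.Fubini') auto
  \<comment> \<open>Adding the version with the two copies exchanged turns the exponential into a
    hyperbolic cosine, which is even and increasing in the absolute value. There the Lipschitz bound
    can be inserted, and the linear function \<open>c * x\<close> takes the place of
    \<open>g\<close>.\<close>
  have "2 * ?D = ?D + (\<integral>\<^sup>+x. \<integral>\<^sup>+y. ennreal (exp (g y - g x)) \<partial>?N \<partial>?N)"
    unfolding sym by (simp add: mult_2)
  also have "\<dots> = (\<integral>\<^sup>+x. (\<integral>\<^sup>+y. ennreal (exp (g x - g y)) \<partial>?N) + (\<integral>\<^sup>+y. ennreal (exp (g y - g x)) \<partial>?N) \<partial>?N)"
    by (rule nn_integral_add[symmetric]) measurable
  also have "\<dots> = (\<integral>\<^sup>+x. \<integral>\<^sup>+y. ennreal (exp (g x - g y) + exp (g y - g x)) \<partial>?N \<partial>?N)"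
    by (intro nn_integral_cong) (simp add: nn_integral_add ennreal_plus)
  also have "\<dots> \<le> (\<integral>\<^sup>+x. \<integral>\<^sup>+y. ennreal (exp (c * x) * exp (- c * y) + exp (- c * x) * exp (c * y)) \<partial>?N \<partial>?N)"
  proof (intro nn_integral_mono ennreal_leI)
    fix x y :: real
    have "exp (g x - g y) + exp (g y - g x) = 2 * cosh (g x - g y)"
      by (simp add: cosh_field_def)
    also have "\<dots> = 2 * cosh \<bar>g x - g y\<bar>" by (simp add: abs_if)
    also have "\<dots> \<le> 2 * cosh (c * \<bar>x - y\<bar>)"
    proof -
      have "cosh \<bar>g x - g y\<bar> \<le> cosh (c * \<bar>x - y\<bar>)"
        using lip[of x y] by (subst cosh_real_nonneg_le_iff) (auto intro: order_trans[OF abs_ge_zero])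
      then show ?thesis by simp
    qed
    also have "\<dots> = 2 * cosh (c * (x - y))" by (simp add: abs_if cosh_minus[of "c * (x - y)", symmetric] algebra_simps del: cosh_minus)
    also have "\<dots> = exp (c * x) * exp (- c * y) + exp (- c * x) * exp (c * y)"
      by (simp add: cosh_field_def exp_add[symmetric] algebra_simps)
    finally show "exp (g x - g y) + exp (g y - g x) \<le> exp (c * x) * exp (- c * y) + exp (- c * x) * exp (c * y)" .
  qed
  also have "\<dots> = (\<integral>\<^sup>+x. ennreal (exp (c * x)) \<partial>?N) * (\<integral>\<^sup>+y. ennreal (exp (- c * y)) \<partial>?N)
        + (\<integral>\<^sup>+x. ennreal (exp (- c * x)) \<partial>?N) * (\<integral>\<^sup>+y. ennreal (exp (c * y)) \<partial>?N)"
    by (simp add: ennreal_plus ennreal_mult nn_integral_add nn_integral_cmult nn_integral_multc)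
  \<comment> \<open>The difference of two independent copies has variance 2 \<sigma>^2; hence the
    exponent is twice that of a centred linear function of one copy.\<close>
  also have "\<dots> = 2 * ennreal (exp (c\<^sup>2 * \<sigma>\<^sup>2))"
    unfolding nn_integral_exp_normal[OF assms(1)]
    by (simp add: ennreal_mult[symmetric] exp_add[symmetric] mult_2 mult.commute)
  finally have "2 * ?D \<le> 2 * ennreal (exp (c\<^sup>2 * \<sigma>\<^sup>2))" .
  then have "?D \<le> ennreal (exp (c\<^sup>2 * \<sigma>\<^sup>2))"
    by (simp add: ennreal_mult_le_mult_iff)
  with 1 show ?thesis by (rule order_trans)
qed

abbreviation normal_PiM :: "nat set \<Rightarrow> (nat \<Rightarrow> real) \<Rightarrow> real \<Rightarrow> (nat \<Rightarrow> real) measure" where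
  "normal_PiM I v \<sigma> \<equiv> PiM I (\<lambda>l. normal_law (v l) \<sigma>)"

lemma prob_space_normal_PiM: "0 < \<sigma> \<Longrightarrow> prob_space (normal_PiM I v \<sigma>)"
  by (intro prob_space_PiM prob_space_normal_density)

lemma measurable_normal_PiM: "measurable (normal_PiM I v \<sigma>) M = measurable (PiM I (\<lambda>_. borel)) M"
  by (intro measurable_cong_sets sets_PiM_cong) auto

text \<open>Induction on the coordinates: integrating one of them out preserves the Lipschitz property
  in each of the others.\<close>

lemma nn_integral_exp_lipschitz_normal_PiM:
  fixes f :: "(nat \<Rightarrow> real) \<Rightarrow> real"
  assumes "0 < \<sigma>" "finite I" "f \<in> borel_measurable (PiM I (\<lambda>_. borel))"
    and "\<And>x. x \<in> extensional I \<Longrightarrow> \<bar>f x\<bar> \<le> C"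
    and "\<And>x l u u'. x \<in> extensional I \<Longrightarrow> l \<in> I \<Longrightarrow> \<bar>f (x(l := u)) - f (x(l := u'))\<bar> \<le> c l * \<bar>u - u'\<bar>"
  shows "(\<integral>\<^sup>+x. ennreal (exp (f x - (\<integral>y. f y \<partial>normal_PiM I v \<sigma>))) \<partial>normal_PiM I v \<sigma>)
      \<le> ennreal (exp (\<Sum>l\<in>I. (c l)\<^sup>2 * \<sigma>\<^sup>2))"
  using assms(2-)
proof (induction I arbitrary: f rule: finite_induct)
  case empty
  show ?case by (simp add: PiM_empty nn_integral_count_space_finite lebesgue_integral_count_space_finite)
next
  case (insert i J)
  interpret N: product_sigma_finite "\<lambda>l. normal_law (v l) \<sigma>"
    by (intro product_sigma_finite.intro prob_space_imp_sigma_finite prob_space_normal_density assms)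
  interpret Ni: prob_space "normal_law (v i) \<sigma>" by (intro prob_space_normal_density assms)
  interpret NJ: prob_space "normal_PiM J v \<sigma>" by (intro prob_space_normal_PiM assms)
  interpret NI: prob_space "normal_PiM (insert i J) v \<sigma>" by (intro prob_space_normal_PiM assms)
  have f[measurable]: "f \<in> borel_measurable (PiM (insert i J) (\<lambda>_. borel))" by fact
  have f': "f \<in> borel_measurable (normal_PiM (insert i J) v \<sigma>)"
    using f by (simp add: measurable_normal_PiM)
  have bnd: "\<And>x. x \<in> extensional (insert i J) \<Longrightarrow> \<bar>f x\<bar> \<le> C" by (rule insert.prems)
  have ext: "x(i := u) \<in> extensional (insert i J)" if "x \<in> extensional J" for x u
    using that by (auto simp: extensional_def)
  have space: "space (normal_PiM K v \<sigma>) = extensional K" for K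
    by (auto simp: space_PiM PiE_def)
  define g where "g x = (\<integral>u. f (x(i := u)) \<partial>normal_law (v i) \<sigma>)" for x
  have upd: "(\<lambda>(x, u). x(i := u)) \<in> measurable (PiM J (\<lambda>_. borel) \<Otimes>\<^sub>M borel) (PiM (insert i J) (\<lambda>_. borel))"
    by (rule measurable_add_dim)
  have fu: "(\<lambda>(x, u). f (x(i := u))) \<in> borel_measurable (PiM J (\<lambda>_. borel) \<Otimes>\<^sub>M borel)"
    using measurable_compose[OF upd f] by (simp add: case_prod_beta)
  have fx: "(\<lambda>u. f (x(i := u))) \<in> borel_measurable borel" if "x \<in> extensional J" for x
    using measurable_Pair2[OF fu, of x] that by (simp add: space_PiM PiE_def)
  have fint: "integrable (normal_law (v i) \<sigma>) (\<lambda>u. f (x(i := u)))" if "x \<in> extensional J" for x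
    by (rule Ni.integrable_const_bound[of _ C]) (use fx[OF that] bnd[OF ext[OF that]] in auto)
  have sg: "sets (PiM J (\<lambda>_. borel) \<Otimes>\<^sub>M borel) = sets (PiM J (\<lambda>_. borel) \<Otimes>\<^sub>M normal_law (v i) \<sigma>)"
    by (intro sets_pair_measure_cong) auto
  have g: "g \<in> borel_measurable (PiM J (\<lambda>_. borel))"
    unfolding g_def using fu
    by (intro sigma_finite_measure.borel_measurable_lebesgue_integral prob_space_imp_sigma_finite Ni.prob_space_axioms) (simp add: measurable_cong_sets[OF sg])
  have gb: "\<bar>g x\<bar> \<le> C" if "x \<in> extensional J" for x
  proof -
    have "\<bar>g x\<bar> \<le> (\<integral>u. \<bar>f (x(i := u))\<bar> \<partial>normal_law (v i) \<sigma>)"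
      unfolding g_def by (rule integral_abs_bound)
    also have "\<dots> \<le> (\<integral>u. C \<partial>normal_law (v i) \<sigma>)"
      using fint[OF that] bnd[OF ext[OF that]] by (intro integral_mono) auto
    finally show ?thesis using Ni.prob_space by simp
  qed
  have gl: "\<bar>g (x(l := u)) - g (x(l := u'))\<bar> \<le> c l * \<bar>u - u'\<bar>" if x: "x \<in> extensional J" and l: "l \<in> J" for x l u u'
  proof -
    have e: "x(l := w) \<in> extensional J" for w using x l by (auto simp: extensional_def)
    have il: "i \<noteq> l" using l insert by auto
    have "\<bar>g (x(l := u)) - g (x(l := u'))\<bar> = \<bar>\<integral>w. f (x(l := u, i := w)) - f (x(l := u', i := w)) \<partial>normal_law (v i) \<sigma>\<bar>"
      unfolding g_def by (subst Bochner_Integration.integral_diff) (auto intro!: fint e)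
    also have "\<dots> \<le> (\<integral>w. \<bar>f (x(l := u, i := w)) - f (x(l := u', i := w))\<bar> \<partial>normal_law (v i) \<sigma>)"
      by (rule integral_abs_bound)
    also have "\<dots> \<le> (\<integral>w. c l * \<bar>u - u'\<bar> \<partial>normal_law (v i) \<sigma>)"
    proof (intro integral_mono integrable_abs Bochner_Integration.integrable_diff fint e)
      fix w
      show "\<bar>f (x(l := u, i := w)) - f (x(l := u', i := w))\<bar> \<le> c l * \<bar>u - u'\<bar>"
        unfolding fun_upd_twist[OF il[symmetric]]
          using l by (intro insert.prems(3) ext x) auto
    qed simp
    finally show ?thesis using Ni.prob_space by simp
  qed
  have IH: "(\<integral>\<^sup>+x. ennreal (exp (g x - (\<integral>y. g y \<partial>normal_PiM J v \<sigma>))) \<partial>normal_PiM J v \<sigma>)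
      \<le> ennreal (exp (\<Sum>l\<in>J. (c l)\<^sup>2 * \<sigma>\<^sup>2))"
    by (rule insert.IH[OF g gb gl])
  have fI: "integrable (normal_PiM (insert i J) v \<sigma>) f"
    by (rule NI.integrable_const_bound[of _ C]) (use bnd f' in \<open>auto simp: space\<close>)
  have m: "(\<integral>y. f y \<partial>normal_PiM (insert i J) v \<sigma>) = (\<integral>y. g y \<partial>normal_PiM J v \<sigma>)" (is "?m = ?m'")
    unfolding g_def using insert fI by (intro N.product_integral_insert) auto
  have "(\<integral>\<^sup>+x. ennreal (exp (f x - ?m)) \<partial>normal_PiM (insert i J) v \<sigma>)
     = (\<integral>\<^sup>+x. \<integral>\<^sup>+u. ennreal (exp (f (x(i := u)) - ?m)) \<partial>normal_law (v i) \<sigma> \<partial>normal_PiM J v \<sigma>)"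
    using insert f' by (intro N.product_nn_integral_insert) auto
  \<comment> \<open>With the coordinates in \<open>J\<close> fixed, \<open>g x\<close> is the mean
    of \<open>f\<close> over coordinate \<open>i\<close>, so the one-dimensional bound contributes a
    factor free of \<open>x\<close>. What remains is the exponential moment of
    \<open>g\<close>.\<close>
  also have "\<dots> \<le> (\<integral>\<^sup>+x. ennreal (exp (g x - ?m)) * ennreal (exp ((c i)\<^sup>2 * \<sigma>\<^sup>2)) \<partial>normal_PiM J v \<sigma>)"
  proof (rule nn_integral_mono)
    fix x assume "x \<in> space (normal_PiM J v \<sigma>)"
    then have x: "x \<in> extensional J" by (simp add: space)
    have lip: "\<bar>f (x(i := u)) - f (x(i := u'))\<bar> \<le> c i * \<bar>u - u'\<bar>" for u u'
      using insert.prems(3)[OF ext[OF x, of 0], of i u u'] unfolding fun_upd_upd by blast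
    have "(\<integral>\<^sup>+u. ennreal (exp (f (x(i := u)) - ?m)) \<partial>normal_law (v i) \<sigma>)
       = (\<integral>\<^sup>+u. ennreal (exp (g x - ?m)) * ennreal (exp (f (x(i := u)) - g x)) \<partial>normal_law (v i) \<sigma>)"
      by (intro nn_integral_cong) (simp add: ennreal_mult[symmetric] exp_add[symmetric])
    also have "\<dots> = ennreal (exp (g x - ?m)) * (\<integral>\<^sup>+u. ennreal (exp (f (x(i := u)) - g x)) \<partial>normal_law (v i) \<sigma>)"
      using fx[OF x] by (intro nn_integral_cmult) auto
    also have "\<dots> \<le> ennreal (exp (g x - ?m)) * ennreal (exp ((c i)\<^sup>2 * \<sigma>\<^sup>2))"
      unfolding g_def
      using bnd[OF ext[OF x]] lip
      by (intro mult_left_mono nn_integral_exp_lipschitz_normal assms fx x) auto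
    finally show "(\<integral>\<^sup>+u. ennreal (exp (f (x(i := u)) - ?m)) \<partial>normal_law (v i) \<sigma>)
      \<le> ennreal (exp (g x - ?m)) * ennreal (exp ((c i)\<^sup>2 * \<sigma>\<^sup>2))" .
  qed
  also have "\<dots> = (\<integral>\<^sup>+x. ennreal (exp (g x - ?m')) \<partial>normal_PiM J v \<sigma>) * ennreal (exp ((c i)\<^sup>2 * \<sigma>\<^sup>2))"
    unfolding m using g by (intro nn_integral_multc) (auto simp: measurable_normal_PiM)
  also have "\<dots> \<le> ennreal (exp (\<Sum>l\<in>J. (c l)\<^sup>2 * \<sigma>\<^sup>2)) * ennreal (exp ((c i)\<^sup>2 * \<sigma>\<^sup>2))"
    by (intro mult_right_mono IH) auto
  also have "\<dots> = ennreal (exp (\<Sum>l\<in>insert i J. (c l)\<^sup>2 * \<sigma>\<^sup>2))"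
    using insert by (simp add: ennreal_mult[symmetric] exp_add[symmetric] add.commute)
  finally show ?case .
qed

section \<open>Information carried by a message\<close>

text \<open>\<open>S\<close> is a vector of scores and \<open>subgauss\<close> controls it jointly
  in every direction \<open>u\<close>; a bound for each coordinate separately would not give the
  dimension-free estimate of the squared length. The bound \<open>C\<close> supplies
  integrability.\<close>

locale message_information = prob_space P for P :: "'x measure" +
  fixes Y :: "'x \<Rightarrow> 'y :: countable" and S :: "'k \<Rightarrow> 'x \<Rightarrow> real" and I :: "'k set" and A C :: real
  assumes Y[measurable]: "Y \<in> measurable P (count_space UNIV)"
    and fin: "finite I" and A: "0 < A"
    and S[measurable]: "\<And>k. k \<in> I \<Longrightarrow> S k \<in> borel_measurable P"
    and bnd: "\<And>k x. k \<in> I \<Longrightarrow> x \<in> space P \<Longrightarrow> \<bar>S k x\<bar> \<le> C"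
    and subgauss: "\<And>u. (\<integral>\<^sup>+x. ennreal (exp (\<Sum>k\<in>I. u k * S k x)) \<partial>P) \<le> ennreal (exp (A * (\<Sum>k\<in>I. (u k)\<^sup>2)))"
begin

definition msg :: "'y \<Rightarrow> 'x set" where "msg y = {x\<in>space P. Y x = y}"
text \<open>Left unnormalised so that messages of probability zero need no convention:
  \<open>e k y / prob (msg y)\<close> is the conditional mean of the score given the message
  \<open>y\<close>.\<close>

definition e :: "'k \<Rightarrow> 'y \<Rightarrow> real" where "e k y = (\<integral>x. S k x * indicator (msg y) x \<partial>P)"

lemma msg[measurable]: "msg y \<in> events"
  unfolding msg_def by (rule sets_message[OF Y])

lemma int_S: "k \<in> I \<Longrightarrow> integrable P (S k)"
  by (rule integrable_const_bound[of _ C]) (use bnd in auto)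

lemma int_ind: "integrable P f \<Longrightarrow> integrable P (\<lambda>x. f x * indicator (msg y) x :: real)"
  by (rule integrable_real_mult_indicator) (rule msg)

lemma int_msg: "integrable P (\<lambda>x. indicator (msg y) x :: real)"
  using int_ind[of "\<lambda>_. 1"] by simp

lemma e_zero: "prob (msg y) = 0 \<Longrightarrow> e k y = 0"
proof -
  assume "prob (msg y) = 0"
  then have "msg y \<in> null_sets P" by (auto simp: null_sets_def emeasure_eq_measure)
  then have "AE x in P. S k x * indicator (msg y) x = 0"
    by (rule eventually_mono[OF AE_not_in]) auto
  then show "e k y = 0" unfolding e_def by (intro integral_eq_zero_AE)
qed

text \<open>The conditional mean of any \<open>z\<close> given an event of probability p is at most
  log E exp z + log (1/p). Testing this with \<open>z\<close> pointing along the conditional mean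
  vector itself puts the squared length of that vector on the left.\<close>

lemma sum_e_sq_le:
  assumes "0 < prob (msg y)"
  shows "(\<Sum>k\<in>I. (e k y)\<^sup>2) \<le> 4 * A * (prob (msg y))\<^sup>2 * ln (1 / prob (msg y))"
proof -
  define p where "p = prob (msg y)"
  define D where "D = (\<Sum>k\<in>I. (e k y)\<^sup>2)"
  \<comment> \<open>The maximiser of \<open>lam * D / p - A * lam^2 * D\<close>: the conditional
    mean of \<open>z\<close> minus the sub-Gaussian bound on its log-moment.\<close>
  define lam where "lam = 1 / (2 * A * p)"
  define z where "z x = (\<Sum>k\<in>I. lam * e k y * S k x)" for x
  define z0 where "z0 = lam * D / p"
  have p: "0 < p" using assms by (simp add: p_def)
  have zi: "integrable P z" unfolding z_def by (intro Bochner_Integration.integrable_sum integrable_mult_right int_S)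
  have zm[measurable]: "z \<in> borel_measurable P" using zi by (rule borel_measurable_integrable)
  have zb: "\<bar>z x\<bar> \<le> (\<Sum>k\<in>I. \<bar>lam * e k y\<bar> * C)" if "x \<in> space P" for x
    unfolding z_def using bnd that
    by (intro order_trans[OF sum_abs] sum_mono) (auto simp: abs_mult intro!: mult_left_mono)
  have ezi: "integrable P (\<lambda>x. exp (z x))"
    by (rule integrable_const_bound[of _ "exp (\<Sum>k\<in>I. \<bar>lam * e k y\<bar> * C)"])
       (use zb in \<open>auto simp: abs_le_iff\<close>)
  have zE: "(\<integral>x. z x * indicator (msg y) x \<partial>P) = lam * D"
  proof -
    have "(\<integral>x. z x * indicator (msg y) x \<partial>P) = (\<integral>x. (\<Sum>k\<in>I. lam * e k y * (S k x * indicator (msg y) x)) \<partial>P)"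
      unfolding z_def by (simp add: sum_distrib_right mult.assoc)
    also have "\<dots> = (\<Sum>k\<in>I. lam * e k y * e k y)"
      unfolding e_def by (subst Bochner_Integration.integral_sum) (auto intro!: int_ind int_S)
    finally show ?thesis by (simp add: D_def power2_eq_square sum_distrib_left mult.assoc)
  qed
  \<comment> \<open>The tangent at the conditional mean \<open>z0\<close> of \<open>z\<close>,
    integrated over the message only: the terms in \<open>z0\<close> cancel, which is Jensen's
    inequality for the conditional law.\<close>
  have "exp z0 * p = (\<integral>x. exp z0 * (1 - z0) * indicator (msg y) x + exp z0 * (z x * indicator (msg y) x) \<partial>P)"
  proof -
    have "(\<integral>x. exp z0 * (1 - z0) * indicator (msg y) x + exp z0 * (z x * indicator (msg y) x) \<partial>P)
        = exp z0 * (1 - z0) * p + exp z0 * (lam * D)"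
      unfolding p_def zE[symmetric]
      by (subst Bochner_Integration.integral_add)
         (auto intro!: integrable_mult_right int_ind int_msg zi simp: measure_def[symmetric] simp del: integral_mult_right)
    also have "lam * D = z0 * p" using p by (simp add: z0_def)
    finally show ?thesis by (simp add: algebra_simps)
  qed
  also have "\<dots> \<le> (\<integral>x. exp (z x) \<partial>P)"
  proof (rule integral_mono)
    show "exp z0 * (1 - z0) * indicator (msg y) x + exp z0 * (z x * indicator (msg y) x) \<le> exp (z x)" for x
      using exp_tangent[of z0 "z x"] by (auto simp: indicator_def algebra_simps)
  qed (auto intro!: int_ind zi ezi Bochner_Integration.integrable_add integrable_mult_right int_msg)
  finally have "exp z0 * p \<le> (\<integral>x. exp (z x) \<partial>P)" .
  also have "\<dots> \<le> exp (A * (\<Sum>k\<in>I. (lam * e k y)\<^sup>2))"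
  proof -
    have "ennreal (\<integral>x. exp (z x) \<partial>P) = (\<integral>\<^sup>+x. ennreal (exp (z x)) \<partial>P)"
      using ezi by (intro nn_integral_eq_integral[symmetric]) auto
    also have "\<dots> \<le> ennreal (exp (A * (\<Sum>k\<in>I. (lam * e k y)\<^sup>2)))"
      unfolding z_def by (rule subgauss)
    finally show ?thesis by simp
  qed
  also have "A * (\<Sum>k\<in>I. (lam * e k y)\<^sup>2) = A * lam\<^sup>2 * D"
    by (simp add: D_def power_mult_distrib sum_distrib_left mult.assoc)
  finally have "ln (exp z0 * p) \<le> ln (exp (A * lam\<^sup>2 * D))"
    using p by (subst ln_le_cancel_iff) auto
  then have "z0 + ln p \<le> A * lam\<^sup>2 * D" using p by (simp add: ln_mult)
  moreover have "z0 = D / (2 * A * p\<^sup>2)" using p A by (simp add: z0_def lam_def field_simps power2_eq_square)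
  moreover have "A * lam\<^sup>2 * D = D / (4 * A * p\<^sup>2)" using p A by (simp add: lam_def field_simps power2_eq_square)
  ultimately have "D / (2 * A * p\<^sup>2) - D / (4 * A * p\<^sup>2) \<le> ln (1 / p)"
    using p by (simp add: ln_div)
  also have "D / (2 * A * p\<^sup>2) - D / (4 * A * p\<^sup>2) = D / (4 * A * p\<^sup>2)"
    using p A by (simp add: field_simps)
  finally show ?thesis using p A unfolding D_def[symmetric] p_def[symmetric]
    by (simp add: field_simps)
qed

lemma sum_e_sq_div_le:
  "(\<Sum>k\<in>I. (e k y)\<^sup>2 / prob (msg y)) \<le> 4 * A * (prob (msg y) * ln (1 / prob (msg y)))"
proof (cases "prob (msg y) = 0")
  case True then show ?thesis by simp
next
  case False
  then have p: "0 < prob (msg y)" using measure_nonneg[of P "msg y"] by linarith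
  have "(\<Sum>k\<in>I. (e k y)\<^sup>2 / prob (msg y)) = (\<Sum>k\<in>I. (e k y)\<^sup>2) / prob (msg y)"
    by (simp add: sum_divide_distrib)
  also have "\<dots> \<le> 4 * A * (prob (msg y))\<^sup>2 * ln (1 / prob (msg y)) / prob (msg y)"
    using p by (intro divide_right_mono sum_e_sq_le) auto
  also have "\<dots> = 4 * A * (prob (msg y) * ln (1 / prob (msg y)))"
    using p by (simp add: power2_eq_square)
  finally show ?thesis .
qed

text \<open>Apply \<open>subgauss\<close> along plus and minus the k-th axis at the scale
  \<open>1 / sqrt A\<close>, where both exponential moments are at most e. Since 2 + t^2 <= exp t +
  exp (-t) and 2 e <= 6, the rescaled second moment is at most 4.\<close>

lemma nn_integral_sq_le:
  assumes k: "k \<in> I"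
  shows "(\<integral>\<^sup>+x. ennreal ((S k x)\<^sup>2) \<partial>P) \<le> ennreal (4 * A)"
proof -
  note k[measurable]
  define lam where "lam = 1 / sqrt A"
  have lam: "lam\<^sup>2 * A = 1" using A by (simp add: lam_def power_divide)
  have sg: "(\<integral>\<^sup>+x. ennreal (exp (c * S k x)) \<partial>P) \<le> ennreal (exp 1)" if "c\<^sup>2 = lam\<^sup>2" for c
  proof -
    have 1: "(\<Sum>j\<in>I. (if j = k then c else 0) * S j x) = c * S k x" for x
      using fin k by (simp add: if_distrib[of "\<lambda>a. a * _"] sum.delta cong: if_cong)
    have 2: "(\<Sum>j\<in>I. (if j = k then c else 0)\<^sup>2) = c\<^sup>2"
      using fin k by (simp add: if_distrib[of "\<lambda>a. a\<^sup>2"] sum.delta cong: if_cong)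
    show ?thesis
      using subgauss[of "\<lambda>j. if j = k then c else 0"] lam unfolding 1 2 that by (simp add: mult.commute)
  qed
  have "2 + ennreal (lam\<^sup>2) * (\<integral>\<^sup>+x. ennreal ((S k x)\<^sup>2) \<partial>P)
     = (\<integral>\<^sup>+x. ennreal 2 + ennreal (lam\<^sup>2) * ennreal ((S k x)\<^sup>2) \<partial>P)"
    by (subst nn_integral_add) (auto simp: nn_integral_cmult emeasure_space_1)
  also have "\<dots> \<le> (\<integral>\<^sup>+x. ennreal (exp (lam * S k x)) + ennreal (exp (- lam * S k x)) \<partial>P)"
  proof (rule nn_integral_mono)
    fix x
    have "2 + t\<^sup>2 \<le> exp t + exp (- t)" for t :: real
    proof -
      have "1 + t\<^sup>2 / 2 \<le> cosh t"
      proof -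
        have "sinh (t/2) ^ 2 \<ge> (t/2)^2"
        proof -
          have *: "u \<le> sinh u" if "0 \<le> u" for u :: real
          proof -
            have "sinh 0 - 0 \<le> sinh u - u"
            proof (rule DERIV_nonneg_imp_nondecreasing[OF that])
              fix z :: real
              have "((\<lambda>x. sinh x - x) has_real_derivative cosh z * 1 - 1) (at z)"
                by (auto intro!: derivative_eq_intros)
              then show "\<exists>y. ((\<lambda>x. sinh x - x) has_real_derivative y) (at z) \<and> 0 \<le> y"
                using cosh_real_ge_1[of z] by (intro exI conjI) auto
            qed
            then show ?thesis by simp
          qed
          have "\<bar>t/2\<bar> \<le> \<bar>sinh (t/2)\<bar>" using *[of "t/2"] *[of "- (t/2)"] by (cases "0 \<le> t") (auto simp: abs_if)
          then show ?thesis by (simp only: abs_le_square_iff)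
        qed
        moreover have "cosh t = 1 + 2 * sinh (t/2)^2"
          using cosh_double[of "t/2"] cosh_square_eq[of "t/2"] by simp
        ultimately show ?thesis by (simp add: power2_eq_square)
      qed
      then show ?thesis by (simp add: cosh_field_def)
    qed
    from ennreal_leI[OF this[of "lam * S k x"]]
    show "ennreal 2 + ennreal (lam\<^sup>2) * ennreal ((S k x)\<^sup>2) \<le> ennreal (exp (lam * S k x)) + ennreal (exp (- lam * S k x))"
      by (simp add: ennreal_mult power_mult_distrib)
  qed
  also have "\<dots> = (\<integral>\<^sup>+x. ennreal (exp (lam * S k x)) \<partial>P) + (\<integral>\<^sup>+x. ennreal (exp (- lam * S k x)) \<partial>P)"
    by (intro nn_integral_add) auto
  also have "\<dots> \<le> ennreal (exp 1) + ennreal (exp 1)"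
    by (intro add_mono sg) auto
  also have "\<dots> \<le> 2 + ennreal 4"
    using exp_le by (simp add: ennreal_plus[symmetric] del: ennreal_plus flip: ennreal_numeral)
  finally have "ennreal (lam\<^sup>2) * (\<integral>\<^sup>+x. ennreal ((S k x)\<^sup>2) \<partial>P) \<le> ennreal 4"
    unfolding ennreal_add_left_cancel_le by simp
  then have "ennreal A * (ennreal (lam\<^sup>2) * (\<integral>\<^sup>+x. ennreal ((S k x)\<^sup>2) \<partial>P)) \<le> ennreal A * ennreal 4"
    by (rule mult_left_mono) simp
  moreover have "ennreal A * (ennreal (lam\<^sup>2) * J) = J" for J
  proof -
    have "ennreal A * ennreal (lam\<^sup>2) = 1" using A lam by (simp add: ennreal_mult[symmetric] mult.commute)
    then show ?thesis by (simp add: mult.assoc[symmetric])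
  qed
  ultimately show ?thesis using A by (simp add: ennreal_mult mult.commute)
qed

lemma sum_prob_msg: "(\<integral>\<^sup>+y. ennreal (prob (msg y)) \<partial>count_space UNIV) = 1"
  unfolding msg_def by (rule nn_integral_prob_message[OF Y])

text \<open>Conditioning does not increase second moments. This bound ignores the length of the
  message and yields the alternative \<open>card I\<close> in
  \<open>information_bound\<close>.\<close>

lemma nn_integral_e_sq_div_le:
  assumes k: "k \<in> I"
  shows "(\<integral>\<^sup>+y. ennreal ((e k y)\<^sup>2 / prob (msg y)) \<partial>count_space UNIV) \<le> ennreal (4 * A)"
proof -
  note k[measurable]
  have "ennreal ((e k y)\<^sup>2 / prob (msg y)) \<le> (\<integral>\<^sup>+x. ennreal ((S k x)\<^sup>2) * indicator (msg y) x \<partial>P)" for y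
  proof (cases "prob (msg y) = 0")
    case False
    then have p: "0 < prob (msg y)" using measure_nonneg[of P "msg y"] by linarith
    \<comment> \<open>The conditional mean. Cauchy-Schwarz on the event is obtained by integrating
      \<open>(S k x - r)^2 >= 0\<close> over it.\<close>
    define r where "r = e k y / prob (msg y)"
    have i2: "integrable P (\<lambda>x. (S k x)\<^sup>2)"
      by (rule integrable_const_bound[of _ "C\<^sup>2"]) (use bnd[OF k] in \<open>auto simp: power2_le_iff_abs_le abs_le_square_iff[symmetric] intro: order_trans[OF _ abs_ge_self]\<close>)
    have "(e k y)\<^sup>2 / prob (msg y) = 2 * r * e k y - r\<^sup>2 * prob (msg y)"
      using p by (simp add: r_def power2_eq_square)
    also have "\<dots> = (\<integral>x. 2 * r * (S k x * indicator (msg y) x) - r\<^sup>2 * indicator (msg y) x \<partial>P)"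
      unfolding e_def by (subst Bochner_Integration.integral_diff) (auto intro!: integrable_mult_right int_msg int_ind int_S k)
    also have "\<dots> \<le> (\<integral>x. (S k x)\<^sup>2 * indicator (msg y) x \<partial>P)"
    proof (rule integral_mono)
      show "2 * r * (S k x * indicator (msg y) x) - r\<^sup>2 * indicator (msg y) x \<le> (S k x)\<^sup>2 * indicator (msg y) x" for x
        using zero_le_power2[of "S k x - r"] by (auto simp: indicator_def power2_diff mult_ac)
    qed (auto intro!: int_ind int_S k i2 Bochner_Integration.integrable_diff integrable_mult_right int_msg)
    finally have "ennreal ((e k y)\<^sup>2 / prob (msg y)) \<le> ennreal (\<integral>x. (S k x)\<^sup>2 * indicator (msg y) x \<partial>P)"
      by (rule ennreal_leI)
    also have "\<dots> = (\<integral>\<^sup>+x. ennreal ((S k x)\<^sup>2 * indicator (msg y) x) \<partial>P)"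
      by (intro nn_integral_eq_integral[symmetric] int_ind i2) auto
    also have "\<dots> = (\<integral>\<^sup>+x. ennreal ((S k x)\<^sup>2) * indicator (msg y) x \<partial>P)"
      by (intro nn_integral_cong) (auto simp: indicator_def)
    finally show ?thesis .
  qed simp
  then have "(\<integral>\<^sup>+y. ennreal ((e k y)\<^sup>2 / prob (msg y)) \<partial>count_space UNIV)
     \<le> (\<integral>\<^sup>+y. \<integral>\<^sup>+x. ennreal ((S k x)\<^sup>2) * indicator (msg y) x \<partial>P \<partial>count_space UNIV)"
    by (intro nn_integral_mono)
  also have "\<dots> = (\<integral>\<^sup>+x. \<integral>\<^sup>+y. ennreal ((S k x)\<^sup>2) * indicator (msg y) x \<partial>count_space UNIV \<partial>P)"
    by (intro nn_integral_count_space_nn_integral[symmetric]) auto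
  also have "\<dots> = (\<integral>\<^sup>+x. ennreal ((S k x)\<^sup>2) \<partial>P)"
  proof (rule nn_integral_cong)
    fix x assume x: "x \<in> space P"
    have "(\<integral>\<^sup>+y. ennreal ((S k x)\<^sup>2) * indicator (msg y) x \<partial>count_space UNIV)
       = (\<integral>\<^sup>+y. ennreal ((S k x)\<^sup>2) * indicator {Y x} y \<partial>count_space UNIV)"
      using x by (intro nn_integral_cong) (auto simp: indicator_def msg_def)
    then show "(\<integral>\<^sup>+y. ennreal ((S k x)\<^sup>2) * indicator (msg y) x \<partial>count_space UNIV) = ennreal ((S k x)\<^sup>2)"
      by (simp add: nn_integral_cmult_indicator)
  qed
  also have "\<dots> \<le> ennreal (4 * A)" by (rule nn_integral_sq_le[OF k])
  finally show ?thesis .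
qed

text \<open>Relative entropy with respect to a subprobability is nonnegative: the entropy of the
  message is at most its mean description length under any code, where \<open>ln (1 / w y)\<close>
  is the length in nats of the code word for \<open>y\<close>.\<close>

lemma entropy_le:
  assumes w: "\<And>y. 0 < w y" "\<And>y. w y \<le> 1" "(\<integral>\<^sup>+y. ennreal (w y) \<partial>count_space UNIV) \<le> 1"
  shows "(\<integral>\<^sup>+y. ennreal (prob (msg y) * ln (1 / prob (msg y))) \<partial>count_space UNIV)
     \<le> (\<integral>\<^sup>+y. ennreal (prob (msg y) * ln (1 / w y)) \<partial>count_space UNIV)" (is "?X \<le> ?Z")
proof -
  \<comment> \<open>The masses of the two weights are added before comparing, so that the comparison
    is pointwise between nonnegative terms; subtraction would fail for infinite sums in
    \<open>ennreal\<close>.\<close>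
  have "?X + 1 = (\<integral>\<^sup>+y. ennreal (prob (msg y) * ln (1 / prob (msg y))) + ennreal (prob (msg y)) \<partial>count_space UNIV)"
    by (subst nn_integral_add) (auto simp: sum_prob_msg)
  also have "\<dots> \<le> (\<integral>\<^sup>+y. ennreal (prob (msg y) * ln (1 / w y)) + ennreal (w y) \<partial>count_space UNIV)"
  proof (rule nn_integral_mono)
    fix y
    let ?p = "prob (msg y)"
    have 1: "0 \<le> ?p * ln (1 / ?p)"
    proof (cases "?p = 0")
      case False
      then have "0 < ?p" using measure_nonneg[of P "msg y"] by linarith
      then show ?thesis by (intro mult_nonneg_nonneg ln_ge_zero) auto
    qed simp
    have 2: "0 \<le> ?p * ln (1 / w y)"
      using w by (intro mult_nonneg_nonneg ln_ge_zero) auto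
    have "?p * ln (1 / ?p) + ?p \<le> ?p * ln (1 / w y) + w y"
    proof (cases "?p = 0")
      case True then show ?thesis using w(1)[of y] by simp
    next
      case False
      then have p: "0 < ?p" using measure_nonneg[of P "msg y"] by linarith
      have "ln (w y / ?p) \<le> w y / ?p - 1" using p w(1)[of y] by (intro ln_le_minus_one) auto
      then have "?p * ln (w y / ?p) \<le> ?p * (w y / ?p - 1)" using p by (intro mult_left_mono) auto
      then show ?thesis using p w(1)[of y] by (simp add: ln_div algebra_simps)
    qed
    then show "ennreal (?p * ln (1 / ?p)) + ennreal ?p \<le> ennreal (?p * ln (1 / w y)) + ennreal (w y)"
      using 1 2 w(1)[of y] by (simp add: ennreal_plus[symmetric] less_imp_le del: ennreal_plus)
  qed
  also have "\<dots> = ?Z + (\<integral>\<^sup>+y. ennreal (w y) \<partial>count_space UNIV)"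
    by (intro nn_integral_add) auto
  also have "\<dots> \<le> ?Z + 1" by (intro add_left_mono w)
  finally have "1 + ?X \<le> 1 + ?Z" by (simp add: add.commute)
  then show ?thesis by (simp add: ennreal_add_left_cancel_le)
qed

lemma information_bound:
  assumes w: "\<And>y. 0 < w y" "\<And>y. w y \<le> 1" "(\<integral>\<^sup>+y. ennreal (w y) \<partial>count_space UNIV) \<le> 1"
  shows "(\<integral>\<^sup>+y. (\<Sum>k\<in>I. ennreal ((e k y)\<^sup>2 / prob (msg y))) \<partial>count_space UNIV)
     \<le> ennreal (4 * A) * min (of_nat (card I)) (\<integral>\<^sup>+y. ennreal (prob (msg y) * ln (1 / w y)) \<partial>count_space UNIV)"
    (is "?L \<le> _ * min _ ?H")
proof -
  have "?L = (\<Sum>k\<in>I. \<integral>\<^sup>+y. ennreal ((e k y)\<^sup>2 / prob (msg y)) \<partial>count_space UNIV)"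
    by (rule nn_integral_sum) auto
  also have "\<dots> \<le> (\<Sum>k\<in>I. ennreal (4 * A))"
    by (intro sum_mono nn_integral_e_sq_div_le)
  finally have 1: "?L \<le> ennreal (4 * A) * of_nat (card I)" by (simp add: mult.commute)
  have "?L \<le> (\<integral>\<^sup>+y. ennreal (4 * A) * ennreal (prob (msg y) * ln (1 / prob (msg y))) \<partial>count_space UNIV)"
  proof (rule nn_integral_mono)
    fix y
    have "(\<Sum>k\<in>I. ennreal ((e k y)\<^sup>2 / prob (msg y))) = ennreal (\<Sum>k\<in>I. (e k y)\<^sup>2 / prob (msg y))"
      by (intro sum_ennreal) auto
    also have "\<dots> \<le> ennreal (4 * A * (prob (msg y) * ln (1 / prob (msg y))))"
      by (intro ennreal_leI sum_e_sq_div_le)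
    also have "\<dots> = ennreal (4 * A) * ennreal (prob (msg y) * ln (1 / prob (msg y)))"
      using A by (intro ennreal_mult'') (auto intro!: mult_nonneg_nonneg simp: ln_div zero_less_measure_iff
         intro: ccontr)
    finally show "(\<Sum>k\<in>I. ennreal ((e k y)\<^sup>2 / prob (msg y))) \<le> ennreal (4 * A) * ennreal (prob (msg y) * ln (1 / prob (msg y)))" .
  qed
  also have "\<dots> = ennreal (4 * A) * (\<integral>\<^sup>+y. ennreal (prob (msg y) * ln (1 / prob (msg y))) \<partial>count_space UNIV)"
    by (intro nn_integral_cmult) auto
  also have "\<dots> \<le> ennreal (4 * A) * ?H"
    by (intro mult_left_mono entropy_le w) auto
  finally have 2: "?L \<le> ennreal (4 * A) * ?H" .
  show ?thesis using 1 2 by (simp add: min_def)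
qed

end

section \<open>Sign perturbations with a fixed design\<close>

lemma borel_measurable_tanh[measurable (raw)]:
  fixes f :: "'a \<Rightarrow> real"
  assumes "f \<in> borel_measurable M"
  shows "(\<lambda>x. tanh (f x)) \<in> borel_measurable M"
proof -
  have "continuous_on UNIV (tanh :: real \<Rightarrow> real)"
    by (intro continuous_intros) auto
  from measurable_compose[OF assms borel_measurable_continuous_onI[OF this]] show ?thesis .
qed

lemma abs_tanh_le_1: "\<bar>tanh (x::real)\<bar> \<le> 1"
  using tanh_real_bounds[of x] by (auto simp: abs_le_iff)

lemma tanh_real_exp: "tanh (x::real) = (exp (2 * x) - 1) / (exp (2 * x) + 1)"
proof -
  have "1 - exp (- 2 * x) = (exp (2 * x) - 1) / exp (2 * x)" "1 + exp (- 2 * x) = (exp (2 * x) + 1) / exp (2 * x)"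
    by (simp_all add: exp_minus diff_divide_distrib add_divide_distrib inverse_eq_divide)
  then show ?thesis by (simp add: tanh_real_altdef)
qed

text \<open>Vertices of the hypercube are coded as subsets of \<open>{..<K}\<close>, so that
  averages over it are sums over \<open>Pow {..<K}\<close> and neighbours differ by one
  \<open>flip\<close>.\<close>

definition pm_sign :: "nat set \<Rightarrow> nat \<Rightarrow> real" where
  "pm_sign X k = (if k \<in> X then 1 else - 1)"

definition flip :: "nat \<Rightarrow> nat set \<Rightarrow> nat set" where
  "flip k X = (if k \<in> X then X - {k} else insert k X)"

lemma pm_sign_sq[simp]: "(pm_sign X k)\<^sup>2 = 1" "pm_sign X k * pm_sign X k = 1" "\<bar>pm_sign X k\<bar> = 1"
  by (auto simp: pm_sign_def)

lemma pm_sign_flip: "pm_sign (flip k X) j = (if j = k then - pm_sign X k else pm_sign X j)"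
  by (cases "k \<in> X"; cases "j = k") (simp_all add: pm_sign_def flip_def)

lemma flip_flip[simp]: "flip k (flip k X) = X"
  by (auto simp: flip_def)

lemma sum_flip:
  assumes "k < K"
  shows "(\<Sum>X\<in>Pow {..<K}. F (flip k X)) = (\<Sum>X\<in>Pow {..<K}. F X :: 'a :: comm_monoid_add)"
  by (rule sum.reindex_bij_witness[of _ "flip k" "flip k"]) (use assms in \<open>auto simp: flip_def split: if_splits\<close>)

lemma power2_sum_orthogonal:
  fixes a :: "'a \<Rightarrow> real"
  assumes "finite I" "\<And>i j. i \<in> I \<Longrightarrow> j \<in> I \<Longrightarrow> i \<noteq> j \<Longrightarrow> a i * a j = 0"
  shows "(\<Sum>i\<in>I. a i)\<^sup>2 = (\<Sum>i\<in>I. (a i)\<^sup>2)"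
proof -
  have "(\<Sum>i\<in>I. a i)\<^sup>2 = (\<Sum>i\<in>I. \<Sum>j\<in>I. a i * a j)"
    by (simp add: power2_eq_square sum_product)
  also have "\<dots> = (\<Sum>i\<in>I. \<Sum>j\<in>I. if j = i then (a i)\<^sup>2 else 0)"
    using assms by (intro sum.cong refl) (auto simp: power2_eq_square)
  finally show ?thesis using assms(1) by simp
qed

text \<open>At \<open>(0, 0)\<close> division by zero gives 0, the right value for a string that
  neither of the two laws produces.\<close>

definition triangular :: "real \<Rightarrow> real \<Rightarrow> real" where
  "triangular x y = (x - y)\<^sup>2 / (x + y)"

lemma triangular_nonneg: "0 \<le> x \<Longrightarrow> 0 \<le> y \<Longrightarrow> 0 \<le> triangular x y"
  by (simp add: triangular_def)

text \<open>Here \<open>a\<close> and \<open>a'\<close> stand for the centred score integrals over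
  one message and \<open>c\<close> for the common bias. Dividing by \<open>1 - c >= 1/2\<close>
  costs the factor 4; the rest is Cauchy-Schwarz,
  \<open>(a - a')^2 <= (a^2 / p + a'^2 / p') * (p + p')\<close>.\<close>

lemma triangular_le_sq_div:
  assumes "0 \<le> p" "0 \<le> p'" "p = 0 \<Longrightarrow> a = 0" "p' = 0 \<Longrightarrow> a' = 0"
    and eq: "(1 - c) * (p - p') = a - a'" and c: "c \<le> 1 / 2"
  shows "triangular p p' \<le> 4 * (a\<^sup>2 / p + a'\<^sup>2 / p')"
proof -
  have "(p - p')\<^sup>2 \<le> 4 * (a - a')\<^sup>2"
  proof -
    have "(1/2) * \<bar>p - p'\<bar> \<le> (1 - c) * \<bar>p - p'\<bar>" using c by (intro mult_right_mono) auto
    also have "\<dots> = \<bar>a - a'\<bar>" using c by (simp add: eq[symmetric] abs_mult)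
    finally have "\<bar>p - p'\<bar> \<le> \<bar>2 * (a - a')\<bar>" unfolding abs_mult by simp
    then have "(p - p')\<^sup>2 \<le> (2 * (a - a'))\<^sup>2" by (simp only: abs_le_square_iff)
    then show ?thesis unfolding power_mult_distrib by simp
  qed
  then have "triangular p p' \<le> 4 * (a - a')\<^sup>2 / (p + p')"
    unfolding triangular_def using assms by (intro divide_right_mono) auto
  also have "\<dots> = 4 * ((a - a')\<^sup>2 / (p + p'))" by simp
  also have "(a - a')\<^sup>2 / (p + p') \<le> a\<^sup>2 / p + a'\<^sup>2 / p'"
  proof (cases "p = 0 \<or> p' = 0")
    case True then show ?thesis using assms by auto
  next
    case False
    then have p: "0 < p" "0 < p'" using assms by auto
    have "0 \<le> (a * p' + a' * p)\<^sup>2" by simp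
    then have "(a - a')\<^sup>2 * (p * p') \<le> (a\<^sup>2 * p' + a'\<^sup>2 * p) * (p + p')"
      by (simp add: power2_eq_square algebra_simps)
    then show ?thesis using p by (simp add: field_simps)
  qed
  finally show ?thesis by simp
qed

text \<open>\<open>b k l\<close> is the value of the k-th perturbation at the l-th design point;
  \<open>orth\<close> says that no design point sees two perturbations. \<open>A\<close> bounds the
  signal-to-noise ratio of a single perturbation and reappears as the sub-Gaussian constant of the
  scores; the value 1/8 is what keeps the bias below 1/2.\<close>

locale sign_design =
  fixes \<sigma> A :: real and q K :: nat and b :: "nat \<Rightarrow> nat \<Rightarrow> real"
  assumes sigma: "0 < \<sigma>" and A: "0 < A" "A \<le> 1 / 8"
    and orth: "\<And>k k' l. k < K \<Longrightarrow> k' < K \<Longrightarrow> k \<noteq> k' \<Longrightarrow> l < q \<Longrightarrow> b k l * b k' l = 0"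
    and energy: "\<And>k. k < K \<Longrightarrow> (\<Sum>l<q. (b k l)\<^sup>2) \<le> \<sigma>\<^sup>2 * A"
begin

definition mean :: "nat set \<Rightarrow> nat \<Rightarrow> real" where
  "mean X l = (\<Sum>k<K. pm_sign X k * b k l)"

definition law :: "nat set \<Rightarrow> (nat \<Rightarrow> real) measure" where
  "law X = normal_PiM {..<q} (mean X) \<sigma>"

text \<open>Half the log-likelihood ratio of \<open>law X\<close> and \<open>law (flip k X)\<close>; the other cells drop out
  because of orthogonality.\<close>

definition llr :: "nat set \<Rightarrow> nat \<Rightarrow> (nat \<Rightarrow> real) \<Rightarrow> real" where
  "llr X k x = (\<Sum>l<q. pm_sign X k * b k l / \<sigma>\<^sup>2 * x l)"

sublocale law: prob_space "law X" for X
  unfolding law_def by (rule prob_space_normal_PiM) (rule sigma)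

lemma space_law: "space (law X) = extensional {..<q}"
  by (auto simp: law_def space_PiM PiE_def)

lemma measurable_law: "measurable (law X) M = measurable (PiM {..<q} (\<lambda>_. borel)) M"
  unfolding law_def by (rule measurable_normal_PiM)

lemma mean_flip: "k < K \<Longrightarrow> mean (flip k X) l = mean X l - 2 * pm_sign X k * b k l"
proof -
  assume k: "k < K"
  have "mean (flip k X) l = (\<Sum>j<K. pm_sign X j * b j l - (if j = k then 2 * pm_sign X k * b k l else 0))"
    unfolding mean_def by (intro sum.cong refl) (auto simp: pm_sign_flip)
  then show ?thesis using k by (simp add: mean_def sum_subtractf)
qed

lemma b_mean: "k < K \<Longrightarrow> l < q \<Longrightarrow> b k l * mean X l = pm_sign X k * (b k l)\<^sup>2"
proof -
  assume k: "k < K" and l: "l < q"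
  have "b k l * mean X l = (\<Sum>j<K. if j = k then pm_sign X k * (b k l)\<^sup>2 else 0)"
    unfolding mean_def sum_distrib_left using orth[OF k _ _ l]
    by (intro sum.cong refl) (auto simp: power2_eq_square)
  then show ?thesis using k by simp
qed

lemma llr_flip: "llr (flip k X) k x = - llr X k x"
  by (simp add: llr_def pm_sign_flip sum_negf)

lemma llr_measurable[measurable]: "llr X k \<in> borel_measurable (PiM {..<q} (\<lambda>_. borel))"
  unfolding llr_def by measurable

lemma llr_measurable'[measurable]: "llr X k \<in> borel_measurable (law Z)"
  by (simp add: measurable_law)

section \<open>Likelihood ratios of neighbours in the hypercube\<close>

definition dens :: "nat set \<Rightarrow> (nat \<Rightarrow> real) \<Rightarrow> real" where
  "dens X x = (\<Prod>l<q. normal_density (mean X l) \<sigma> (x l))"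

lemma dens_measurable[measurable]: "dens X \<in> borel_measurable (PiM {..<q} (\<lambda>_. lborel))"
  unfolding dens_def by measurable

lemma law_density: "law X = density (PiM {..<q} (\<lambda>_. lborel)) (\<lambda>x. ennreal (dens X x))"
proof -
  have "law X = density (PiM {..<q} (\<lambda>_. lborel)) (\<lambda>x. \<Prod>l<q. ennreal (normal_density (mean X l) \<sigma> (x l)))"
    unfolding law_def using sigma
    by (intro PiM_density) (auto intro!: prob_space_imp_sigma_finite prob_space_normal_density sigma_finite_lborel)
  then show ?thesis by (simp add: dens_def prod_ennreal)
qed

text \<open>Wherever \<open>b k l\<close> is nonzero, orthogonality makes it, up to sign, the whole
  mean at \<open>l\<close>. Flipping therefore negates the mean there, the squares in the two
  exponents cancel, and only a term linear in the data remains.\<close>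

lemma dens_flip:
  assumes k: "k < K"
  shows "dens X x = dens (flip k X) x * exp (2 * llr X k x)"
proof -
  have "normal_density (mean X l) \<sigma> (x l)
      = normal_density (mean (flip k X) l) \<sigma> (x l) * exp (2 * (pm_sign X k * b k l / \<sigma>\<^sup>2 * x l))" if l: "l < q" for l
  proof -
    define s v c where "s = pm_sign X k" and "v = mean X l" and "c = b k l"
    have cv: "c * v = s * c\<^sup>2" unfolding s_def v_def c_def by (rule b_mean[OF k l])
    have "(x l - (v - 2 * s * c))\<^sup>2 = (x l - v)\<^sup>2 + 4 * s * c * x l - 4 * s * (c * v) + 4 * s\<^sup>2 * c\<^sup>2"
      by (simp add: power2_eq_square algebra_simps)
    also have "\<dots> = (x l - v)\<^sup>2 + 4 * s * c * x l"
      unfolding cv by (simp add: power2_eq_square algebra_simps)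
    finally have eq: "(x l - (v - 2 * s * c))\<^sup>2 = (x l - v)\<^sup>2 + 4 * s * c * x l" .
    have "- (x l - v)\<^sup>2 / (2 * \<sigma>\<^sup>2) = - (x l - (v - 2 * s * c))\<^sup>2 / (2 * \<sigma>\<^sup>2) + 2 * (s * c / \<sigma>\<^sup>2 * x l)"
      unfolding eq using sigma by (simp add: field_simps)
    then have "exp (- (x l - v)\<^sup>2 / (2 * \<sigma>\<^sup>2)) = exp (- (x l - (v - 2 * s * c))\<^sup>2 / (2 * \<sigma>\<^sup>2)) * exp (2 * (s * c / \<sigma>\<^sup>2 * x l))"
      by (simp only: exp_add)
    then show ?thesis
      unfolding normal_density_def mean_flip[OF k] by (simp add: s_def v_def c_def)
  qed
  then show ?thesis
    unfolding dens_def llr_def sum_distrib_left by (simp add: exp_sum prod.distrib)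
qed

text \<open>Normalising by the sum of the two densities, instead of by one of them, is what makes
  the likelihood difference bounded.\<close>

lemma tanh_dens:
  assumes "k < K"
  shows "dens X x - dens (flip k X) x = tanh (llr X k x) * (dens X x + dens (flip k X) x)"
proof -
  define W where "W = llr X k x"
  have "0 < exp (2 * W) + 1" by (simp add: add_pos_pos)
  moreover have "tanh W = (exp (2 * W) - 1) / (exp (2 * W) + 1)"
    by (rule tanh_real_exp)
  ultimately have "exp (2 * W) - 1 = tanh W * (exp (2 * W) + 1)" by (simp add: field_simps)
  from arg_cong[OF this, of "\<lambda>t. dens (flip k X) x * t"] show ?thesis
    unfolding dens_flip[OF assms, of X x] W_def[symmetric] by (simp add: algebra_simps)
qed

lemma integral_law:
  assumes "h \<in> borel_measurable (PiM {..<q} (\<lambda>_. borel))"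
  shows "(\<integral>x. h x \<partial>law X) = (\<integral>x. dens X x * h x \<partial>PiM {..<q} (\<lambda>_. lborel))"
    "integrable (law X) h \<longleftrightarrow> integrable (PiM {..<q} (\<lambda>_. lborel)) (\<lambda>x. dens X x * h x)"
proof -
  have h: "h \<in> borel_measurable (PiM {..<q} (\<lambda>_. lborel))"
    using assms by (simp add: measurable_cong_sets[OF sets_PiM_cong[OF refl sets_lborel] refl])
  have d: "0 \<le> dens X x" for x by (auto simp: dens_def intro!: prod_nonneg)
  show "(\<integral>x. h x \<partial>law X) = (\<integral>x. dens X x * h x \<partial>PiM {..<q} (\<lambda>_. lborel))"
    unfolding law_density using h d by (subst integral_density) auto
  show "integrable (law X) h \<longleftrightarrow> integrable (PiM {..<q} (\<lambda>_. lborel)) (\<lambda>x. dens X x * h x)"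
    unfolding law_density using h d by (subst integrable_density) auto
qed

text \<open>With \<open>h\<close> the indicator of a message, the difference of its two
  probabilities becomes a sum of tangent integrals under the two laws, each of which the information
  bound can estimate on its own.\<close>

lemma change_of_sign:
  assumes k: "k < K" and h[measurable]: "h \<in> borel_measurable (PiM {..<q} (\<lambda>_. borel))"
    and bnd: "\<And>x. x \<in> extensional {..<q} \<Longrightarrow> \<bar>h x\<bar> \<le> 1"
  shows "(\<integral>x. h x \<partial>law X) - (\<integral>x. h x \<partial>law (flip k X))
     = (\<integral>x. tanh (llr X k x) * h x \<partial>law X) + (\<integral>x. tanh (llr X k x) * h x \<partial>law (flip k X))"
proof -
  let ?L = "PiM {..<q} (\<lambda>_. lborel)"
  have tm: "(\<lambda>x. tanh (llr X k x) * h x) \<in> borel_measurable (PiM {..<q} (\<lambda>_. borel))"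
    by measurable
  have ih: "integrable (law Z) h" for Z
    by (rule law.integrable_const_bound[of _ 1]) (use bnd h in \<open>auto simp: space_law measurable_law\<close>)
  have it: "integrable (law Z) (\<lambda>x. tanh (llr X k x) * h x)" for Z
  proof (rule law.integrable_const_bound[of _ 1])
    show "AE x in law Z. norm (tanh (llr X k x) * h x) \<le> 1"
    proof (rule AE_I2)
      fix x assume "x \<in> space (law Z)"
      then have "\<bar>h x\<bar> \<le> 1" using bnd by (simp add: space_law)
      then have "\<bar>tanh (llr X k x)\<bar> * \<bar>h x\<bar> \<le> 1 * 1"
        using tanh_real_bounds[of "llr X k x"] by (intro mult_mono) auto
      then show "norm (tanh (llr X k x) * h x) \<le> 1" by (simp add: abs_mult)
    qed
  qed (use tm in \<open>simp add: measurable_law\<close>)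
  have "(\<integral>x. h x \<partial>law X) - (\<integral>x. h x \<partial>law (flip k X)) = (\<integral>x. dens X x * h x - dens (flip k X) x * h x \<partial>?L)"
    unfolding integral_law(1)[OF h] using ih integral_law(2)[OF h] by (subst Bochner_Integration.integral_diff) auto
  also have "\<dots> = (\<integral>x. dens X x * (tanh (llr X k x) * h x) + dens (flip k X) x * (tanh (llr X k x) * h x) \<partial>?L)"
  proof (rule Bochner_Integration.integral_cong[OF refl])
    fix x
    show "dens X x * h x - dens (flip k X) x * h x
      = dens X x * (tanh (llr X k x) * h x) + dens (flip k X) x * (tanh (llr X k x) * h x)"
      using arg_cong[OF tanh_dens[OF k, of X x], of "\<lambda>t. t * h x"] by (simp add: algebra_simps)
  qed
  also have "\<dots> = (\<integral>x. tanh (llr X k x) * h x \<partial>law X) + (\<integral>x. tanh (llr X k x) * h x \<partial>law (flip k X))"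
    unfolding integral_law(1)[OF tm] using it integral_law(2)[OF tm] by (subst Bochner_Integration.integral_add) auto
  finally show ?thesis .
qed

section \<open>Bias of the hyperbolic tangents\<close>

definition bias :: "nat set \<Rightarrow> nat \<Rightarrow> real" where
  "bias X k = (\<integral>x. tanh (llr X k x) \<partial>law X)"

lemma int_tanh: "integrable (law Z) (\<lambda>x. tanh (llr X k x))"
proof (rule law.integrable_const_bound[of _ 1])
  show "AE x in law Z. norm (tanh (llr X k x)) \<le> 1"
    using tanh_real_bounds by (intro AE_I2) (auto simp: abs_le_iff less_imp_le minus_le_iff)
qed measurable

lemma abs_bias: "\<bar>bias X k\<bar> \<le> 1"
proof -
  have "\<bar>bias X k\<bar> \<le> (\<integral>x. \<bar>tanh (llr X k x)\<bar> \<partial>law X)"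
    unfolding bias_def by (rule integral_abs_bound)
  also have "\<dots> \<le> (\<integral>x. 1 \<partial>law X)"
    using tanh_real_bounds by (intro integral_mono integrable_abs int_tanh) (auto simp: abs_le_iff less_imp_le minus_le_iff)
  finally show ?thesis using law.prob_space by simp
qed

text \<open>The test function 1 in \<open>change_of_sign\<close> has the same integral under both
  laws, and \<open>llr\<close> is odd under the flip. The common value is what later lets the bias
  be factored out of a difference of probabilities.\<close>

lemma bias_flip: "k < K \<Longrightarrow> bias (flip k X) k = bias X k"
  using change_of_sign[of k "\<lambda>_. 1" X] law.prob_space
  by (simp add: bias_def llr_flip)

text \<open>\<open>exp (2 * llr X k x)\<close> is the likelihood ratio itself; its mean under
  \<open>law X\<close> is explicit, namely the exponential of four times the signal-to-noise ratio,
  so at most exp (1/2) <= 2. The tangent lies below half of the ratio minus one.\<close>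

lemma bias_le_half:
  assumes k: "k < K"
  shows "bias X k \<le> 1 / 2"
proof -
  interpret N: product_sigma_finite "\<lambda>l. normal_law (mean X l) \<sigma>"
    by (intro product_sigma_finite.intro prob_space_imp_sigma_finite prob_space_normal_density sigma)
  have "(\<integral>\<^sup>+x. ennreal (exp (2 * llr X k x)) \<partial>law X)
     = (\<integral>\<^sup>+x. (\<Prod>l<q. ennreal (exp (2 * pm_sign X k * b k l / \<sigma>\<^sup>2 * x l))) \<partial>law X)"
    by (simp add: llr_def sum_distrib_left exp_sum prod_ennreal mult.assoc)
  also have "\<dots> = (\<Prod>l<q. \<integral>\<^sup>+x. ennreal (exp (2 * pm_sign X k * b k l / \<sigma>\<^sup>2 * x)) \<partial>normal_law (mean X l) \<sigma>)"
    unfolding law_def by (intro N.product_nn_integral_prod) auto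
  also have "\<dots> = (\<Prod>l<q. ennreal (exp (4 * (b k l)\<^sup>2 / \<sigma>\<^sup>2)))"
  proof (intro prod.cong refl)
    fix l assume l: "l \<in> {..<q}"
    have "2 * pm_sign X k * b k l / \<sigma>\<^sup>2 * mean X l = 2 * pm_sign X k * (b k l * mean X l) / \<sigma>\<^sup>2" by simp
    also have "\<dots> = 2 * (pm_sign X k * pm_sign X k) * (b k l)\<^sup>2 / \<sigma>\<^sup>2"
      using b_mean[OF k, of l X] l by simp
    finally have 1: "2 * pm_sign X k * b k l / \<sigma>\<^sup>2 * mean X l = 2 * (b k l)\<^sup>2 / \<sigma>\<^sup>2" by simp
    have 2: "(2 * pm_sign X k * b k l / \<sigma>\<^sup>2)\<^sup>2 * \<sigma>\<^sup>2 / 2 = 2 * (b k l)\<^sup>2 / \<sigma>\<^sup>2"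
      using sigma by (simp add: power_mult_distrib power_divide) (simp add: field_simps power2_eq_square power4_eq_xxxx)
    show "(\<integral>\<^sup>+x. ennreal (exp (2 * pm_sign X k * b k l / \<sigma>\<^sup>2 * x)) \<partial>normal_law (mean X l) \<sigma>) = ennreal (exp (4 * (b k l)\<^sup>2 / \<sigma>\<^sup>2))"
      unfolding nn_integral_exp_normal[OF sigma] 1 2 by simp
  qed
  also have "\<dots> = ennreal (exp (4 * ((\<Sum>l<q. (b k l)\<^sup>2) / \<sigma>\<^sup>2)))"
    by (simp add: prod_ennreal exp_sum[symmetric] sum_distrib_left sum_divide_distrib)
  also have "\<dots> \<le> ennreal (exp (1 / 2))"
  proof -
    have "(\<Sum>l<q. (b k l)\<^sup>2) / \<sigma>\<^sup>2 \<le> \<sigma>\<^sup>2 * A / \<sigma>\<^sup>2"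
      by (intro divide_right_mono energy k) simp
    also have "\<dots> = A" using sigma by simp
    finally have "4 * ((\<Sum>l<q. (b k l)\<^sup>2) / \<sigma>\<^sup>2) \<le> 1 / 2" using A by linarith
    then show ?thesis unfolding exp_le_cancel_iff by (intro ennreal_leI) (simp only: exp_le_cancel_iff)
  qed
  finally have E: "(\<integral>\<^sup>+x. ennreal (exp (2 * llr X k x)) \<partial>law X) \<le> ennreal (exp (1 / 2))" .
  have ie: "integrable (law X) (\<lambda>x. exp (2 * llr X k x))"
  proof (rule integrableI_bounded)
    show "(\<integral>\<^sup>+x. ennreal (norm (exp (2 * llr X k x))) \<partial>law X) < \<infinity>"
      using le_less_trans[OF E ennreal_less_top] by simp
  qed measurable
  have "(\<integral>x. exp (2 * llr X k x) \<partial>law X) \<le> exp (1 / 2)"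
    using E ie by (simp add: nn_integral_eq_integral)
  also have "exp (1 / 2) \<le> (2 :: real)"
    using exp_bound[of "1 / 2"] by (simp add: power2_eq_square)
  finally have E2: "(\<integral>x. exp (2 * llr X k x) \<partial>law X) \<le> 2" .
  have "bias X k \<le> (\<integral>x. (exp (2 * llr X k x) - 1) / 2 \<partial>law X)"
    unfolding bias_def
  proof (rule integral_mono)
    fix x
    define y where "y = exp (2 * llr X k x)"
    have y: "0 < y" by (simp add: y_def)
    have "tanh (llr X k x) = (y - 1) / (y + 1)"
      unfolding y_def by (rule tanh_real_exp)
    also have "\<dots> \<le> (y - 1) / 2"
    proof -
      have "0 \<le> (y - 1)\<^sup>2" by simp
      then show ?thesis using y by (simp add: field_simps power2_eq_square)
    qed
    finally show "tanh (llr X k x) \<le> (exp (2 * llr X k x) - 1) / 2" by (simp add: y_def)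
  qed (use ie int_tanh in auto)
  also have "\<dots> = ((\<integral>x. exp (2 * llr X k x) \<partial>law X) - 1) / 2"
    using ie law.prob_space by simp
  finally show ?thesis using E2 by simp
qed

section \<open>Concentration of the centred scores and the bound for one machine\<close>

definition score :: "nat set \<Rightarrow> nat \<Rightarrow> (nat \<Rightarrow> real) \<Rightarrow> real" where
  "score X k x = tanh (llr X k x) - bias X k"

text \<open>A change of response \<open>l\<close> moves only the tangent of the cell containing it,
  and the tangent is 1-Lipschitz. Hence in the square of the coordinate constant \<open>c l\<close>
  no cross terms survive, and summing over \<open>l\<close> leaves the energy of each cell weighted
  by \<open>(u k)^2\<close>, independently of \<open>K\<close>.\<close>

lemma score_subgaussian:
  "(\<integral>\<^sup>+x. ennreal (exp (\<Sum>k<K. u k * score X k x)) \<partial>law X) \<le> ennreal (exp (A * (\<Sum>k<K. (u k)\<^sup>2)))"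
proof -
  define f where "f x = (\<Sum>k<K. u k * tanh (llr X k x))" for x
  define c where "c l = (\<Sum>k<K. \<bar>u k * b k l\<bar>) / \<sigma>\<^sup>2" for l
  have fm: "f \<in> borel_measurable (PiM {..<q} (\<lambda>_. borel))"
    unfolding f_def by measurable
  have fb: "\<bar>f x\<bar> \<le> (\<Sum>k<K. \<bar>u k\<bar>)" for x
  proof -
    have *: "\<bar>u k * tanh (llr X k x)\<bar> \<le> \<bar>u k\<bar>" for k
      using mult_left_mono[OF abs_tanh_le_1, of "\<bar>u k\<bar>"] by (simp only: abs_mult) simp
    show ?thesis unfolding f_def by (intro order_trans[OF sum_abs] sum_mono *)
  qed
  have fl: "\<bar>f (x(l := t)) - f (x(l := t'))\<bar> \<le> c l * \<bar>t - t'\<bar>" if l: "l \<in> {..<q}" for x l t t'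
  proof -
    have llr: "llr X k (x(l := t)) - llr X k (x(l := t')) = pm_sign X k * b k l / \<sigma>\<^sup>2 * (t - t')" for k
    proof -
      have "llr X k (x(l := t)) - llr X k (x(l := t')) = (\<Sum>i<q. if i = l then pm_sign X k * b k l / \<sigma>\<^sup>2 * (t - t') else 0)"
        unfolding llr_def sum_subtractf[symmetric] by (intro sum.cong refl) (auto simp: right_diff_distrib)
      then show ?thesis using l by simp
    qed
    have "\<bar>f (x(l := t)) - f (x(l := t'))\<bar> = \<bar>\<Sum>k<K. u k * (tanh (llr X k (x(l := t))) - tanh (llr X k (x(l := t'))))\<bar>"
      by (simp add: f_def sum_subtractf[symmetric] right_diff_distrib)
    also have "\<dots> \<le> (\<Sum>k<K. \<bar>u k\<bar> * \<bar>tanh (llr X k (x(l := t))) - tanh (llr X k (x(l := t')))\<bar>)"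
      by (intro order_trans[OF sum_abs] sum_mono) (simp add: abs_mult)
    also have "\<dots> \<le> (\<Sum>k<K. \<bar>u k\<bar> * \<bar>pm_sign X k * b k l / \<sigma>\<^sup>2 * (t - t')\<bar>)"
      unfolding llr[symmetric] by (intro sum_mono mult_left_mono tanh_real_lipschitz) auto
    also have "\<dots> = c l * \<bar>t - t'\<bar>"
      unfolding c_def by (simp add: abs_mult sum_distrib_right sum_divide_distrib mult.assoc)
    finally show ?thesis .
  qed
  have Ef: "(\<integral>x. f x \<partial>law X) = (\<Sum>k<K. u k * bias X k)"
    unfolding f_def bias_def by (subst Bochner_Integration.integral_sum) (auto intro!: integrable_mult_right int_tanh)
  have "(\<integral>\<^sup>+x. ennreal (exp (\<Sum>k<K. u k * score X k x)) \<partial>law X)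
      = (\<integral>\<^sup>+x. ennreal (exp (f x - (\<integral>x. f x \<partial>law X))) \<partial>law X)"
    unfolding Ef by (simp add: f_def score_def right_diff_distrib sum_subtractf)
  also have "\<dots> \<le> ennreal (exp (\<Sum>l<q. (c l)\<^sup>2 * \<sigma>\<^sup>2))"
    unfolding law_def by (rule nn_integral_exp_lipschitz_normal_PiM[OF sigma _ fm fb fl]) auto
  also have "(\<Sum>l<q. (c l)\<^sup>2 * \<sigma>\<^sup>2) \<le> A * (\<Sum>k<K. (u k)\<^sup>2)"
  proof -
    have "(c l)\<^sup>2 * \<sigma>\<^sup>2 = (\<Sum>k<K. (u k)\<^sup>2 * (b k l)\<^sup>2) / \<sigma>\<^sup>2" if l: "l < q" for l
    proof -
      have z: "\<bar>u k * b k l\<bar> * \<bar>u k' * b k' l\<bar> = 0" if "k < K" "k' < K" "k \<noteq> k'" for k k'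
        using orth[OF that l] by auto
      have "(\<Sum>k<K. \<bar>u k * b k l\<bar>)\<^sup>2 = (\<Sum>k<K. \<bar>u k * b k l\<bar>\<^sup>2)"
        by (rule power2_sum_orthogonal) (use z in auto)
      moreover have "(t / \<sigma>\<^sup>2)\<^sup>2 * \<sigma>\<^sup>2 = t\<^sup>2 / \<sigma>\<^sup>2" for t
        using sigma by (simp add: power2_eq_square)
      ultimately show ?thesis unfolding c_def by (simp add: power_mult_distrib)
    qed
    then have "(\<Sum>l<q. (c l)\<^sup>2 * \<sigma>\<^sup>2) = (\<Sum>l<q. \<Sum>k<K. (u k)\<^sup>2 * (b k l)\<^sup>2) / \<sigma>\<^sup>2"
      by (simp add: sum_divide_distrib)
    also have "\<dots> = (\<Sum>k<K. (u k)\<^sup>2 * (\<Sum>l<q. (b k l)\<^sup>2)) / \<sigma>\<^sup>2"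
      by (subst sum.swap) (simp add: sum_distrib_left)
    also have "\<dots> \<le> (\<Sum>k<K. (u k)\<^sup>2 * (\<sigma>\<^sup>2 * A)) / \<sigma>\<^sup>2"
      by (intro divide_right_mono sum_mono mult_left_mono energy) auto
    also have "\<dots> = A * (\<Sum>k<K. (u k)\<^sup>2)"
      using sigma by (simp add: sum_distrib_right[symmetric])
    finally show ?thesis .
  qed
  finally show ?thesis by (simp add: ennreal_leI)
qed

lemma message_information:
  fixes Y :: "(nat \<Rightarrow> real) \<Rightarrow> 'y :: countable"
  assumes Y: "Y \<in> measurable (PiM {..<q} (\<lambda>_. borel)) (count_space UNIV)"
  shows "message_information (law X) Y (score X) {..<K} A 2"
proof -
  have sm: "score X k \<in> borel_measurable (law X)" for k
    unfolding score_def by measurable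
  have sb: "\<bar>score X k x\<bar> \<le> 2" for k x
    using tanh_real_bounds[of "llr X k x"] abs_bias[of X k] by (auto simp: score_def)
  show ?thesis
    by unfold_locales (use Y sm sb score_subgaussian A in \<open>auto simp: measurable_law\<close>)
qed

text \<open>Each pair of neighbours is charged to both of its vertices, and the sum over the
  hypercube merges the two charges. The constant 32 A is 4 from \<open>triangular_le_sq_div\<close>,
  2 from the two vertices and 4 A from \<open>information_bound\<close>.\<close>

lemma sum_triangular_le:
  fixes Y :: "(nat \<Rightarrow> real) \<Rightarrow> 'y :: countable" and w :: "'y \<Rightarrow> real"
  assumes Y: "Y \<in> measurable (PiM {..<q} (\<lambda>_. borel)) (count_space UNIV)"
    and w: "\<And>y. 0 < w y" "\<And>y. w y \<le> 1" "(\<integral>\<^sup>+y. ennreal (w y) \<partial>count_space UNIV) \<le> 1"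
  defines "p \<equiv> \<lambda>X y. measure (law X) {x\<in>space (law X). Y x = y}"
  shows "(\<Sum>X\<in>Pow {..<K}. \<Sum>k<K. \<integral>\<^sup>+y. ennreal (triangular (p X y) (p (flip k X) y)) \<partial>count_space UNIV)
    \<le> ennreal (32 * A) * (\<Sum>X\<in>Pow {..<K}. min (of_nat K) (\<integral>\<^sup>+y. ennreal (p X y * ln (1 / w y)) \<partial>count_space UNIV))"
proof -
  interpret mi: message_information "law X" Y "score X" "{..<K}" A 2 for X
    by (rule message_information[OF Y])
  have p: "p X y = measure (law X) (mi.msg X y)" for X y
    by (simp add: p_def mi.msg_def)
  define J where "J X k y = (mi.e X k y)\<^sup>2 / p X y" for X k y
  have "triangular (p X y) (p (flip k X) y) \<le> 4 * (J X k y + J (flip k X) k y)" if k: "k < K" for X k y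
    unfolding J_def
  proof (rule triangular_le_sq_div)
    have mset: "mi.msg Z y \<in> sets (law Z)" for Z by (rule mi.msg)
    have msgeq: "mi.msg Z y = mi.msg X y" for Z by (simp add: mi.msg_def space_law)
    have im: "(\<lambda>x. indicator (mi.msg X y) x :: real) \<in> borel_measurable (PiM {..<q} (\<lambda>_. borel))"
      using borel_measurable_indicator[OF mset[of X]] by (simp add: measurable_law)
    have 1: "p Z y = (\<integral>x. indicator (mi.msg X y) x \<partial>law Z)" for Z
      using mset[of Z] unfolding p msgeq[of Z] by simp
    have 2: "mi.e Z k y = (\<integral>x. tanh (llr Z k x) * indicator (mi.msg X y) x \<partial>law Z) - bias Z k * p Z y" for Z
    proof -
      have "mi.e Z k y = (\<integral>x. tanh (llr Z k x) * indicator (mi.msg X y) x - bias Z k * indicator (mi.msg X y) x \<partial>law Z)"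
        unfolding mi.e_def msgeq[of Z] score_def by (simp add: left_diff_distrib)
      also have "\<dots> = (\<integral>x. tanh (llr Z k x) * indicator (mi.msg X y) x \<partial>law Z) - (\<integral>x. bias Z k * indicator (mi.msg X y) x \<partial>law Z)"
        using mi.int_ind[OF int_tanh, of Z Z k y] mi.int_msg[of Z y] unfolding msgeq[of Z]
        by (intro Bochner_Integration.integral_diff integrable_mult_right) auto
      finally show ?thesis unfolding 1 by simp
    qed
    have "p X y - p (flip k X) y = (\<integral>x. tanh (llr X k x) * indicator (mi.msg X y) x \<partial>law X)
        + (\<integral>x. tanh (llr X k x) * indicator (mi.msg X y) x \<partial>law (flip k X))"
      unfolding 1 by (rule change_of_sign[OF k im]) (auto simp: indicator_def)
    \<comment> \<open>Written with the score that belongs to the flipped law, the second integral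
      changes sign. Centring both by the common bias moves \<open>bias X k\<close> times the
      difference of probabilities to the left, where it forms the factor
      \<open>1 - bias X k\<close>.\<close>
    also have "(\<integral>x. tanh (llr X k x) * indicator (mi.msg X y) x \<partial>law (flip k X))
       = - (\<integral>x. tanh (llr (flip k X) k x) * indicator (mi.msg X y) x \<partial>law (flip k X))"
      by (simp add: llr_flip)
    finally show "(1 - bias X k) * (p X y - p (flip k X) y) = mi.e X k y - mi.e (flip k X) k y"
      unfolding 2 bias_flip[OF k] by (simp add: algebra_simps)
  qed (use bias_le_half[OF k] mi.e_zero in \<open>auto simp: p\<close>)
  moreover have Jnn: "0 \<le> J X k y" for X k y by (simp add: J_def p)
  ultimately have tri: "ennreal (triangular (p X y) (p (flip k X) y)) \<le> ennreal 4 * (ennreal (J X k y) + ennreal (J (flip k X) k y))"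
    if "k < K" for X k y
    using that by (simp add: ennreal_plus[symmetric] ennreal_mult[symmetric] ennreal_leI del: ennreal_plus flip: ennreal_numeral)
  define Q where "Q X k = (\<integral>\<^sup>+y. ennreal (J X k y) \<partial>count_space UNIV)" for X k
  have "(\<Sum>X\<in>Pow {..<K}. \<Sum>k<K. \<integral>\<^sup>+y. ennreal (triangular (p X y) (p (flip k X) y)) \<partial>count_space UNIV)
     \<le> (\<Sum>X\<in>Pow {..<K}. \<Sum>k<K. ennreal 4 * (Q X k + Q (flip k X) k))"
  proof (intro sum_mono)
    fix X k assume k: "k \<in> {..<K}"
    have "(\<integral>\<^sup>+y. ennreal (triangular (p X y) (p (flip k X) y)) \<partial>count_space UNIV)
      \<le> (\<integral>\<^sup>+y. ennreal 4 * (ennreal (J X k y) + ennreal (J (flip k X) k y)) \<partial>count_space UNIV)"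
      using k by (intro nn_integral_mono tri) auto
    also have "\<dots> = ennreal 4 * (Q X k + Q (flip k X) k)"
      unfolding Q_def by (subst nn_integral_cmult) (auto simp: nn_integral_add)
    finally show "(\<integral>\<^sup>+y. ennreal (triangular (p X y) (p (flip k X) y)) \<partial>count_space UNIV) \<le> ennreal 4 * (Q X k + Q (flip k X) k)" .
  qed
  also have "\<dots> = ennreal 4 * ((\<Sum>X\<in>Pow {..<K}. \<Sum>k<K. Q X k) + (\<Sum>X\<in>Pow {..<K}. \<Sum>k<K. Q (flip k X) k))"
    by (simp add: sum_distrib_left[symmetric] sum.distrib)
  also have "(\<Sum>X\<in>Pow {..<K}. \<Sum>k<K. Q (flip k X) k) = (\<Sum>X\<in>Pow {..<K}. \<Sum>k<K. Q X k)"
  proof -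
    have "(\<Sum>X\<in>Pow {..<K}. \<Sum>k<K. Q (flip k X) k) = (\<Sum>k<K. \<Sum>X\<in>Pow {..<K}. Q (flip k X) k)"
      by (rule sum.swap)
    also have "\<dots> = (\<Sum>k<K. \<Sum>X\<in>Pow {..<K}. Q X k)"
      by (intro sum.cong refl sum_flip[where F="\<lambda>X. Q X _"]) auto
    also have "\<dots> = (\<Sum>X\<in>Pow {..<K}. \<Sum>k<K. Q X k)"
      by (rule sum.swap)
    finally show ?thesis .
  qed
  also have "ennreal 4 * ((\<Sum>X\<in>Pow {..<K}. \<Sum>k<K. Q X k) + (\<Sum>X\<in>Pow {..<K}. \<Sum>k<K. Q X k)) = 8 * (\<Sum>X\<in>Pow {..<K}. \<Sum>k<K. Q X k)"
    by (simp add: mult_2[symmetric] mult.assoc[symmetric])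
  also have "\<dots> \<le> 8 * (\<Sum>X\<in>Pow {..<K}. ennreal (4 * A) * min (of_nat K) (\<integral>\<^sup>+y. ennreal (p X y * ln (1 / w y)) \<partial>count_space UNIV))"
  proof (intro mult_left_mono sum_mono)
    fix X
    have "(\<Sum>k<K. Q X k) = (\<integral>\<^sup>+y. (\<Sum>k<K. ennreal (J X k y)) \<partial>count_space UNIV)"
      unfolding Q_def by (intro nn_integral_sum[symmetric]) auto
    also have "\<dots> \<le> ennreal (4 * A) * min (of_nat K) (\<integral>\<^sup>+y. ennreal (p X y * ln (1 / w y)) \<partial>count_space UNIV)"
      using mi.information_bound[OF w, of X] unfolding J_def p by simp
    finally show "(\<Sum>k<K. Q X k) \<le> \<dots>" .
  qed simp
  also have "\<dots> = ennreal (32 * A) * (\<Sum>X\<in>Pow {..<K}. min (of_nat K) (\<integral>\<^sup>+y. ennreal (p X y * ln (1 / w y)) \<partial>count_space UNIV))"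
  proof -
    have "ennreal (32 * A) = 8 * ennreal (4 * A)" using A by (simp add: ennreal_mult mult.assoc[symmetric])
    then show ?thesis by (simp add: sum_distrib_left[symmetric] mult.assoc)
  qed
  finally show ?thesis .
qed

end

section \<open>Random design\<close>

lemma triangular_le_add: "0 \<le> x \<Longrightarrow> 0 \<le> y \<Longrightarrow> triangular x y \<le> x + y"
proof -
  assume x: "0 \<le> x" and y: "0 \<le> y"
  have "\<bar>x - y\<bar> \<le> \<bar>x + y\<bar>" using x y by linarith
  then have "(x - y)\<^sup>2 \<le> (x + y)\<^sup>2" by (simp only: abs_le_square_iff)
  then show ?thesis using x y
    by (cases "x + y = 0") (auto simp: triangular_def divide_le_eq power2_eq_square)
qed

text \<open>For fixed \<open>u\<close> the left side is linear in \<open>(x, y)\<close>, and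
  \<open>u = (x - y) / (x + y)\<close> gives equality when the sum is positive:
  \<open>triangular\<close> is a supremum of linear functions, hence jointly convex.\<close>

lemma triangular_tangent:
  assumes "0 \<le> x" "0 \<le> y"
  shows "2 * u * (x - y) - u\<^sup>2 * (x + y) \<le> triangular x y"
proof (cases "x + y = 0")
  case True
  with assms have "x = 0" "y = 0" by (simp_all add: add_nonneg_eq_0_iff)
  then show ?thesis by (simp add: triangular_def)
next
  case False
  with assms have s: "0 < x + y" by linarith
  have "0 \<le> ((x - y) - u * (x + y))\<^sup>2" by simp
  also have "\<dots> = (x - y)\<^sup>2 - (2 * u * (x - y) - u\<^sup>2 * (x + y)) * (x + y)"
    by (simp add: power2_eq_square algebra_simps)
  finally show ?thesis using s by (simp add: triangular_def pos_le_divide_eq)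
qed

lemma borel_measurable_triangular[measurable (raw)]:
  assumes [measurable]: "f \<in> borel_measurable M" "g \<in> borel_measurable M"
  shows "(\<lambda>x. triangular (f x) (g x)) \<in> borel_measurable M"
  unfolding triangular_def by measurable

lemma (in prob_space) triangular_expectation_le:
  assumes [measurable]: "f \<in> borel_measurable M" "g \<in> borel_measurable M"
    and f: "\<And>x. 0 \<le> f x" "\<And>x. f x \<le> 1" and g: "\<And>x. 0 \<le> g x" "\<And>x. g x \<le> 1"
  shows "ennreal (triangular (expectation f) (expectation g)) \<le> (\<integral>\<^sup>+x. ennreal (triangular (f x) (g x)) \<partial>M)"
proof -
  \<comment> \<open>The optimal slope for the two expectations, used for all \<open>x\<close> at
    once; this makes the tangent inequality sharp on the left side.\<close>
  define F G u where "F = expectation f" and "G = expectation g" and "u = (F - G) / (F + G)"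
  have i: "integrable M f" "integrable M g"
    by (auto intro!: integrable_const_bound[of _ 1] simp: f g)
  have it: "integrable M (\<lambda>x. triangular (f x) (g x))"
  proof (rule integrable_const_bound[of _ 2])
    show "AE x in M. norm (triangular (f x) (g x)) \<le> 2"
      using triangular_le_add triangular_nonneg f g
      by (intro AE_I2) (smt (verit) real_norm_def)
  qed measurable
  have F: "0 \<le> F" "0 \<le> G" unfolding F_def G_def using f g by (auto intro!: integral_nonneg)
  have "triangular F G = 2 * u * (F - G) - u\<^sup>2 * (F + G)"
    using F by (cases "F + G = 0") (auto simp: triangular_def u_def power2_eq_square)
  also have "\<dots> = (\<integral>x. 2 * u * (f x - g x) - u\<^sup>2 * (f x + g x) \<partial>M)"
    unfolding F_def G_def using i by simp
  also have "\<dots> \<le> (\<integral>x. triangular (f x) (g x) \<partial>M)"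
    using i it f g by (intro integral_mono triangular_tangent) auto
  finally have "ennreal (triangular F G) \<le> ennreal (\<integral>x. triangular (f x) (g x) \<partial>M)"
    by (rule ennreal_leI)
  also have "\<dots> = (\<integral>\<^sup>+x. ennreal (triangular (f x) (g x)) \<partial>M)"
    using it f g by (intro nn_integral_eq_integral[symmetric]) (auto intro!: triangular_nonneg)
  finally show ?thesis unfolding F_def G_def .
qed

lemma borel_measurable_nn_integral_count_space:
  fixes f :: "'a \<Rightarrow> 'b :: countable \<Rightarrow> ennreal"
  assumes "\<And>y. (\<lambda>x. f x y) \<in> borel_measurable M"
  shows "(\<lambda>x. \<integral>\<^sup>+y. f x y \<partial>count_space UNIV) \<in> borel_measurable M"
proof (intro sigma_finite_measure.borel_measurable_nn_integral sigma_finite_measure_count_space_countable)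
  have "(\<lambda>z. f (snd z) (fst z)) \<in> borel_measurable (count_space UNIV \<Otimes>\<^sub>M M)"
    by (rule measurable_pair_measure_countable1) (use assms in auto)
  then have "(\<lambda>(y, x). f x y) \<in> borel_measurable (count_space UNIV \<Otimes>\<^sub>M M)"
    by (simp add: case_prod_beta)
  from measurable_pair_swap[OF this] show "case_prod f \<in> borel_measurable (M \<Otimes>\<^sub>M count_space UNIV)"
    by (simp add: case_prod_beta)
qed auto

text \<open>Messages need not be prefix-free, so all 2^l strings of length l count: weights 2^{-l}
  would have infinite total mass, and base 1/4 leaves a convergent geometric series.\<close>

lemma nn_integral_lists_powr:
  "(\<integral>\<^sup>+y. ennreal ((1 / 4) ^ length y) \<partial>count_space (UNIV :: bool list set)) = 2"
proof -
  have "(\<integral>\<^sup>+y. ennreal ((1 / 4) ^ length y) \<partial>count_space (UNIV :: bool list set))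
      = (\<integral>\<^sup>+l. ennreal ((1 / 4) ^ l) * emeasure (count_space (UNIV :: bool list set)) {x\<in>space (count_space UNIV). length x = l} \<partial>count_space UNIV)"
    by (rule nn_integral_countable_image[where F="\<lambda>l. ennreal ((1 / 4) ^ l)"]) auto
  also have "\<dots> = (\<integral>\<^sup>+l. ennreal ((1 / 2) ^ l) \<partial>count_space UNIV)"
  proof (rule nn_integral_cong)
    fix l :: nat
    have c: "card {x :: bool list. length x = l} = 2 ^ l" and f: "finite {x :: bool list. length x = l}"
      using card_lists_length_eq[of "UNIV :: bool set" l] finite_lists_length_eq[of "UNIV :: bool set" l]
      by (simp_all add: card_UNIV_bool)
    have "ennreal ((1 / 4) ^ l) * ennreal (2 ^ l) = ennreal ((1 / 2) ^ l)"
      by (simp add: ennreal_mult[symmetric] power_mult_distrib[symmetric] del: ennreal_power)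
    then show "ennreal ((1 / 4) ^ l) * emeasure (count_space (UNIV :: bool list set)) {x\<in>space (count_space UNIV). length x = l} = ennreal ((1 / 2) ^ l)"
      using c f by (simp add: emeasure_count_space ennreal_of_nat_eq_real_of_nat)
  qed
  also have "\<dots> = (\<Sum>l. ennreal ((1 / 2) ^ l))" by (rule nn_integral_count_space_nat)
  also have "\<dots> = ennreal (\<Sum>l. (1 / 2) ^ l)"
    by (intro suminf_ennreal2) (auto intro!: summable_geometric)
  also have "\<dots> = 2" by (simp add: suminf_geometric)
  finally show ?thesis .
qed

text \<open>The code that spends \<open>2 / n\<close> nats on the empty string and \<open>O(log n)\<close> per bit on all others;
  it is what makes budgets far below one bit count linearly.\<close>

definition string_weight :: "real \<Rightarrow> bool list \<Rightarrow> real" where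
  "string_weight n y = (1 / n) * (1 / 4) ^ length y + (if y = [] then 1 - 2 / n else 0)"

lemma string_weight_pos: "2 \<le> n \<Longrightarrow> 0 < string_weight n y"
  by (auto simp: string_weight_def intro!: add_pos_nonneg)

lemma nn_integral_string_weight: "2 \<le> n \<Longrightarrow> (\<integral>\<^sup>+y. ennreal (string_weight n y) \<partial>count_space UNIV) \<le> 1"
proof -
  assume n: "2 \<le> n"
  have "(\<integral>\<^sup>+y. ennreal (string_weight n y) \<partial>count_space UNIV)
     = (\<integral>\<^sup>+y. ennreal (1 / n) * ennreal ((1 / 4) ^ length y) + ennreal (1 - 2 / n) * indicator {[]} y \<partial>count_space (UNIV :: bool list set))"
    using n by (intro nn_integral_cong) (auto simp: string_weight_def ennreal_mult[symmetric] ennreal_plus[symmetric] simp del: ennreal_plus)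
  also have "\<dots> = ennreal (1 / n) * 2 + ennreal (1 - 2 / n)"
    by (simp add: nn_integral_add nn_integral_cmult nn_integral_lists_powr nn_integral_cmult_indicator)
  also have "\<dots> = ennreal (2 / n) + ennreal (1 - 2 / n)"
    using n by (simp add: ennreal_mult''[symmetric] flip: ennreal_numeral)
  also have "\<dots> = 1" using n by (simp add: ennreal_plus[symmetric] del: ennreal_plus)
  finally show ?thesis by simp
qed

lemma string_weight_le_1: "2 \<le> n \<Longrightarrow> string_weight n y \<le> 1"
proof -
  assume n: "2 \<le> n"
  have "(1 / n) * (1 / 4) ^ length y \<le> (1 / n) * 1"
    using n by (intro mult_left_mono power_le_one) auto
  moreover have "1 / n \<le> 1" using n by simp
  ultimately have "(1 / n) * (1 / 4) ^ length y \<le> 1" by linarith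
  moreover have "string_weight n [] \<le> 1" using n by (simp add: string_weight_def field_simps)
  ultimately show ?thesis by (cases "y = []") (simp_all add: string_weight_def)
qed

lemma ln_string_weight_le:
  assumes n: "2 \<le> n"
  shows "ln (1 / string_weight n y) \<le> 2 / n + 3 * ln n * real (length y)"
proof (cases "y = []")
  case True
  have "ln (1 / string_weight n y) = - ln (1 - 1 / n)"
    using True n by (simp add: string_weight_def ln_div algebra_simps)
  also have "1 - 1 / n = (n - 1) / n" using n by (simp add: field_simps)
  also have "- ln ((n - 1) / n) = ln (n / (n - 1))" using n by (simp add: ln_div)
  also have "\<dots> \<le> n / (n - 1) - 1" using n by (intro ln_le_minus_one) auto
  also have "\<dots> \<le> 2 / n" using n by (simp add: field_simps)
  finally show ?thesis using True by simp
next
  case False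
  then have l: "1 \<le> length y" by (cases y) auto
  have "ln (1 / string_weight n y) = ln n + real (length y) * ln 4"
    using False n by (simp add: string_weight_def ln_div ln_mult ln_realpow power_divide)
  also have "ln 4 = 2 * ln (2::real)" using ln_realpow[of 2 2] by simp
  also have "real (length y) * (2 * ln (2::real)) \<le> real (length y) * (2 * ln n)"
    using n by (intro mult_left_mono) auto
  also have "ln n + real (length y) * (2 * ln n) \<le> 3 * ln n * real (length y)"
  proof -
    \<comment> \<open>A nonempty string has at least one bit, so the fixed cost \<open>ln n\<close>
      of not being empty can be charged to its length.\<close>
    have "ln n * 1 \<le> ln n * real (length y)" using n l by (intro mult_left_mono) auto
    then show ?thesis by (simp add: algebra_simps)
  qed
  also have "\<dots> \<le> 2 / n + 3 * ln n * real (length y)" using n by simp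
  finally show ?thesis by simp
qed

section \<open>Conditioning on the design\<close>

abbreviation data_space :: "nat \<Rightarrow> (nat \<Rightarrow> real \<times> real) measure" where
  "data_space q \<equiv> PiM {..<q} (\<lambda>_. borel \<Otimes>\<^sub>M borel)"

text \<open>Fubini with the design outside, where the inner law is Gaussian with a mean that is
  fixed by the design. The second claim makes conditional message probabilities measurable functions
  of the design.\<close>

lemma nn_integral_PiM_obs_law:
  assumes [measurable]: "f \<in> borel_measurable borel" and \<sigma>: "0 < \<sigma>"
    and F: "F \<in> borel_measurable (data_space q)"
  shows "(\<integral>\<^sup>+x. F x \<partial>PiM {..<q} (\<lambda>_. obs_law \<sigma> f))
      = (\<integral>\<^sup>+t. \<integral>\<^sup>+x. F (\<lambda>l\<in>{..<q}. (t l, x l)) \<partial>normal_PiM {..<q} (\<lambda>l. f (t l)) \<sigma> \<partial>PiM {..<q} (\<lambda>_. unif))" (is ?A)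
    and "(\<lambda>t. \<integral>\<^sup>+x. F (\<lambda>l\<in>{..<q}. (t l, x l)) \<partial>normal_PiM {..<q} (\<lambda>l. f (t l)) \<sigma>)
      \<in> borel_measurable (PiM {..<q} (\<lambda>_. unif))" (is ?B)
proof -
  let ?N = "PiM {..<q} (\<lambda>_. normal_law 0 1)" and ?U = "PiM {..<q} (\<lambda>_. unif)"
  let ?X = "\<lambda>(t, z). \<lambda>l\<in>{..<q}. (t l, f (t l) + \<sigma> * z l)"
  have sfN: "sigma_finite_measure ?N"
    by (intro prob_space_imp_sigma_finite prob_space_PiM prob_space_normal_density) simp
  have X: "?X \<in> measurable (?U \<Otimes>\<^sub>M ?N) (data_space q)"
    unfolding case_prod_beta by (rule measurable_restrict) measurable
  have FX: "(\<lambda>x. F (?X x)) \<in> borel_measurable (?U \<Otimes>\<^sub>M ?N)"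
    by (rule measurable_compose[OF X F])
  have inner: "(\<integral>\<^sup>+z. F (?X (t, z)) \<partial>?N) = (\<integral>\<^sup>+x. F (\<lambda>l\<in>{..<q}. (t l, x l)) \<partial>normal_PiM {..<q} (\<lambda>l. f (t l)) \<sigma>)" for t
  proof -
    have m: "(\<lambda>x. \<lambda>l\<in>{..<q}. (t l, x l)) \<in> measurable (PiM {..<q} (\<lambda>_. borel)) (data_space q)"
      by (rule measurable_restrict) measurable
    have z: "(\<lambda>z. \<lambda>l\<in>{..<q}. f (t l) + \<sigma> * z l) \<in> measurable ?N (PiM {..<q} (\<lambda>_. borel))"
      by (rule measurable_restrict) measurable
    have "(\<integral>\<^sup>+x. F (\<lambda>l\<in>{..<q}. (t l, x l)) \<partial>normal_PiM {..<q} (\<lambda>l. f (t l)) \<sigma>)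
       = (\<integral>\<^sup>+z. F (\<lambda>l\<in>{..<q}. (t l, (\<lambda>l\<in>{..<q}. f (t l) + \<sigma> * z l) l)) \<partial>?N)"
      unfolding distr_affine_PiM[OF \<sigma> finite_lessThan, symmetric]
      by (rule nn_integral_distr[OF z]) (use measurable_compose[OF m F] in simp)
    also have "\<dots> = (\<integral>\<^sup>+z. F (?X (t, z)) \<partial>?N)"
      by (intro nn_integral_cong) (simp cong: restrict_cong)
    finally show ?thesis ..
  qed
  show ?A
    unfolding PiM_obs_law[OF assms(1) finite_lessThan]
    by (subst nn_integral_distr[OF X])
       (use F sigma_finite_measure.nn_integral_fst[OF sfN FX] inner in auto)
  show ?B
    unfolding inner[symmetric] using sigma_finite_measure.borel_measurable_nn_integral_fst[OF sfN FX] .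
qed

text \<open>\<open>r\<close> bounds the probability of a cell, so \<open>q * r\<close> bounds its
  expected number of design points among \<open>q\<close>; a design is \<open>good\<close> if no
  cell exceeds four times this bound. Each point carries squared signal at most
  \<open>a^2 * M\<close>, so \<open>snr\<close> is the energy condition of
  \<open>sign_design\<close> in the worst good case.\<close>

locale random_design =
  fixes \<sigma> a M r A :: real and q K :: nat and \<psi> :: "nat \<Rightarrow> real \<Rightarrow> real" and cell :: "nat \<Rightarrow> real set"
  assumes sigma: "0 < \<sigma>" and A: "0 < A" "A \<le> 1 / 8"
    and psi[measurable]: "\<And>k. k < K \<Longrightarrow> \<psi> k \<in> borel_measurable borel"
    and cell[measurable]: "\<And>k. k < K \<Longrightarrow> cell k \<in> sets borel"
    and disj: "\<And>k k' t. k < K \<Longrightarrow> k' < K \<Longrightarrow> k \<noteq> k' \<Longrightarrow> t \<in> cell k \<Longrightarrow> t \<notin> cell k'"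
    and supp: "\<And>k t. k < K \<Longrightarrow> t \<notin> cell k \<Longrightarrow> \<psi> k t = 0"
    and bnd: "\<And>k t. k < K \<Longrightarrow> (\<psi> k t)\<^sup>2 \<le> M"
    and size: "\<And>k. k < K \<Longrightarrow> emeasure unif (cell k) \<le> ennreal r"
    and r: "0 \<le> r" and M: "0 \<le> M"
    and snr: "a\<^sup>2 * M * (4 * real q * r) \<le> \<sigma>\<^sup>2 * A"
begin

definition fn :: "nat set \<Rightarrow> real \<Rightarrow> real" where
  "fn X t = (\<Sum>k<K. pm_sign X k * (a * \<psi> k t))"

lemma fn_measurable[measurable]: "fn X \<in> borel_measurable borel"
  unfolding fn_def by measurable

definition machine_law :: "nat set \<Rightarrow> (nat \<Rightarrow> real \<times> real) measure" where
  "machine_law X = PiM {..<q} (\<lambda>_. obs_law \<sigma> (fn X))"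

lemma prob_space_machine_law: "prob_space (machine_law X)"
  unfolding machine_law_def by (intro prob_space_PiM prob_space_obs_law) simp

lemma measurable_machine_law: "measurable (machine_law X) N = measurable (data_space q) N"
  unfolding machine_law_def by (intro measurable_cong_sets sets_PiM_cong refl) (simp add: obs_law_def)

lemma space_machine_law: "space (machine_law X) = extensional {..<q}"
  by (auto simp: machine_law_def space_PiM PiE_def obs_law_def space_pair_measure)

definition good :: "(nat \<Rightarrow> real) \<Rightarrow> bool" where
  "good t \<longleftrightarrow> (\<forall>k<K. (\<Sum>l<q. indicator (cell k) (t l)) \<le> 4 * real q * r)"

abbreviation designs :: "(nat \<Rightarrow> real) measure" where
  "designs \<equiv> PiM {..<q} (\<lambda>_. unif)"

lemma prob_space_designs: "prob_space designs"
  by (intro prob_space_PiM prob_space_unif)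

lemma good_measurable[measurable]: "Measurable.pred designs good"
  unfolding good_def by measurable

lemma sign_design:
  assumes "good t"
  shows "sign_design \<sigma> A q K (\<lambda>k l. a * \<psi> k (t l))"
proof
  fix k k' l assume "k < K" "k' < K" "k \<noteq> k'"
  then show "a * \<psi> k (t l) * (a * \<psi> k' (t l)) = 0"
    using disj[of k k' "t l"] supp[of k "t l"] supp[of k' "t l"] by auto
next
  fix k assume k: "k < K"
  have "(\<Sum>l<q. (a * \<psi> k (t l))\<^sup>2) \<le> (\<Sum>l<q. a\<^sup>2 * M * indicator (cell k) (t l))"
    using bnd[OF k] supp[OF k]
    by (intro sum_mono) (auto simp: indicator_def power_mult_distrib intro!: mult_left_mono)
  also have "\<dots> = a\<^sup>2 * M * (\<Sum>l<q. indicator (cell k) (t l))" by (simp add: sum_distrib_left)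
  also have "\<dots> \<le> a\<^sup>2 * M * (4 * real q * r)"
    using assms k M by (intro mult_left_mono) (auto simp: good_def)
  also have "\<dots> \<le> \<sigma>\<^sup>2 * A" by (rule snr)
  finally show "(\<Sum>l<q. (a * \<psi> k (t l))\<^sup>2) \<le> \<sigma>\<^sup>2 * A" .
qed (use sigma A in auto)

text \<open>Chernoff's bound with parameter 1 for each cell, then a union bound. Since e - 1 <= 2,
  the exponential moment of the count is at most \<open>exp (2 * q * r)\<close>, and the threshold
  \<open>4 * q * r\<close> leaves \<open>exp (- 2 * q * r)\<close>.\<close>

lemma emeasure_bad_le: "emeasure designs {t\<in>space designs. \<not> good t} \<le> ennreal (real K * exp (- 2 * real q * r))"
proof -
  interpret U: product_sigma_finite "\<lambda>_. unif"
    by (intro product_sigma_finite.intro prob_space_imp_sigma_finite prob_space_unif)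
  interpret U1: prob_space unif by (rule prob_space_unif)
  let ?B = "\<lambda>k. {t\<in>space designs. 1 \<le> ennreal (exp (- 4 * real q * r)) * ennreal (exp (\<Sum>l<q. indicator (cell k) (t l)))}"
  have B: "emeasure designs (?B k) \<le> ennreal (exp (- 2 * real q * r))" if k: "k < K" for k
  proof -
    note [measurable] = cell[OF k]
    define c where "c = measure unif (cell k)"
    have c: "0 \<le> c" "c \<le> r"
      using size[OF k] r by (auto simp: c_def U1.emeasure_eq_measure)
    have e: "ennreal (exp 1) = 1 + ennreal (exp 1 - 1)"
      by (simp add: ennreal_plus[symmetric] del: ennreal_plus flip: ennreal_1)
    have one: "(\<integral>\<^sup>+t. ennreal (exp (indicator (cell k) t)) \<partial>unif) = ennreal (1 + (exp 1 - 1) * c)"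
    proof -
      have "(\<integral>\<^sup>+t. ennreal (exp (indicator (cell k) t)) \<partial>unif) = (\<integral>\<^sup>+t. 1 + ennreal (exp 1 - 1) * indicator (cell k) t \<partial>unif)"
        by (intro nn_integral_cong) (auto simp: indicator_def e)
      also have "\<dots> = 1 + ennreal (exp 1 - 1) * emeasure unif (cell k)"
        using U1.emeasure_space_1 by (subst nn_integral_add) (auto simp: nn_integral_cmult_indicator)
      also have "\<dots> = ennreal (1 + (exp 1 - 1) * c)"
        using c by (simp add: U1.emeasure_eq_measure c_def[symmetric] ennreal_mult[symmetric])
      finally show ?thesis .
    qed
    have cr: "1 + (exp 1 - 1) * c \<le> exp (2 * r)"
    proof -
      have "(exp 1 - 1) * c \<le> 2 * r"
        using exp_le c by (intro mult_mono) auto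
      then show ?thesis using exp_ge_add_one_self[of "2 * r"] by linarith
    qed
    have "emeasure designs (?B k)
        \<le> ennreal (exp (- 4 * real q * r)) * (\<integral>\<^sup>+t. ennreal (exp (\<Sum>l<q. indicator (cell k) (t l))) * indicator (space designs) t \<partial>designs)"
      by (rule nn_integral_Markov_inequality) measurable
    also have "(\<integral>\<^sup>+t. ennreal (exp (\<Sum>l<q. indicator (cell k) (t l))) * indicator (space designs) t \<partial>designs)
       = (\<integral>\<^sup>+t. (\<Prod>l<q. ennreal (exp (indicator (cell k) (t l)))) \<partial>designs)"
      by (intro nn_integral_cong) (simp add: exp_sum prod_ennreal)
    also have "\<dots> = (\<Prod>l<q. \<integral>\<^sup>+t. ennreal (exp (indicator (cell k) t)) \<partial>unif)"
      by (intro U.product_nn_integral_prod) auto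
    also have "\<dots> = ennreal ((1 + (exp 1 - 1) * c) ^ q)"
      unfolding one using c by (simp add: ennreal_power del: ennreal_plus)
    also have "\<dots> \<le> ennreal (exp (2 * r) ^ q)"
      using c by (intro ennreal_leI power_mono cr) auto
    also have "exp (2 * r) ^ q = exp (2 * real q * r)"
      by (simp add: exp_of_nat_mult[symmetric] mult_ac)
    also have "ennreal (exp (- 4 * real q * r)) * ennreal (exp (2 * real q * r)) = ennreal (exp (- 2 * real q * r))"
      by (simp add: ennreal_mult[symmetric] exp_add[symmetric])
    finally show ?thesis by (simp add: mult_left_mono)
  qed
  have Bm: "?B k \<in> sets designs" if "k < K" for k
    using cell[OF that] by measurable
  have "{t\<in>space designs. \<not> good t} \<subseteq> (\<Union>k<K. ?B k)"
  proof
    fix t assume "t \<in> {t\<in>space designs. \<not> good t}"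
    then obtain k where k: "k < K" "4 * real q * r < (\<Sum>l<q. indicator (cell k) (t l))" and t: "t \<in> space designs"
      by (auto simp: good_def not_le)
    have "1 \<le> exp (- 4 * real q * r) * exp (\<Sum>l<q. indicator (cell k) (t l))"
      using k by (simp add: exp_add[symmetric])
    then have "ennreal 1 \<le> ennreal (exp (- 4 * real q * r) * exp (\<Sum>l<q. indicator (cell k) (t l)))"
      by (rule ennreal_leI)
    then show "t \<in> (\<Union>k<K. ?B k)" using k t by (auto simp: ennreal_mult)
  qed
  then have "emeasure designs {t\<in>space designs. \<not> good t} \<le> emeasure designs (\<Union>k<K. ?B k)"
    using Bm by (intro emeasure_mono) auto
  also have "\<dots> \<le> (\<Sum>k<K. emeasure designs (?B k))"
    using Bm by (intro emeasure_subadditive_finite) auto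
  also have "\<dots> \<le> (\<Sum>k<K. ennreal (exp (- 2 * real q * r)))" using B by (intro sum_mono) auto
  also have "\<dots> = ennreal (real K * exp (- 2 * real q * r))"
    by (simp add: ennreal_mult ennreal_of_nat_eq_real_of_nat)
  finally show ?thesis .
qed

definition cond_law :: "(nat \<Rightarrow> real) \<Rightarrow> nat set \<Rightarrow> (nat \<Rightarrow> real) measure" where
  "cond_law t X = normal_PiM {..<q} (\<lambda>l. fn X (t l)) \<sigma>"

definition embed :: "(nat \<Rightarrow> real) \<Rightarrow> (nat \<Rightarrow> real) \<Rightarrow> nat \<Rightarrow> real \<times> real" where
  "embed t x = (\<lambda>l\<in>{..<q}. (t l, x l))"

lemma embed_measurable: "embed t \<in> measurable (PiM {..<q} (\<lambda>_. borel)) (data_space q)"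
  unfolding embed_def by (rule measurable_restrict) measurable

lemma space_cond_law: "space (cond_law t X) = extensional {..<q}"
  by (auto simp: cond_law_def space_PiM PiE_def)

lemma prob_space_cond_law: "prob_space (cond_law t X)"
  unfolding cond_law_def by (rule prob_space_normal_PiM) (rule sigma)

text \<open>The message law is a mixture over designs. Joint convexity passes to the conditional
  laws; good designs are covered by \<open>sum_triangular_le\<close>, bad ones by the trivial bound
  2 per pair, and their probability supplies one of the two factors \<open>K\<close> in the
  exponential term.\<close>

lemma machine_bound:
  fixes Y :: "(nat \<Rightarrow> real \<times> real) \<Rightarrow> bool list" and n B :: real
  assumes Y: "Y \<in> measurable (data_space q) (count_space UNIV)"
    and n: "2 \<le> n" and B: "0 \<le> B"
    and len: "\<And>X. X \<subseteq> {..<K} \<Longrightarrow> (\<integral>\<^sup>+x. ennreal (real (length (Y x))) \<partial>machine_law X) \<le> ennreal B"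
  defines "P \<equiv> \<lambda>X y. measure (machine_law X) {x\<in>space (machine_law X). Y x = y}"
  shows "(\<Sum>X\<in>Pow {..<K}. \<Sum>k<K. \<integral>\<^sup>+y. ennreal (triangular (P X y) (P (flip k X) y)) \<partial>count_space UNIV)
    \<le> ennreal (2 ^ K * (2 * (real K)\<^sup>2 * exp (- 2 * real q * r) + 32 * A * min (real K) (2 / n + 3 * ln n * B)))"
proof -
  define p where "p X t y = measure (cond_law t X) {x\<in>space (cond_law t X). Y (embed t x) = y}" for X t y
  interpret U: prob_space designs by (rule prob_space_designs)
  interpret C: prob_space "cond_law t X" for t X by (rule prob_space_cond_law)
  interpret R: prob_space "machine_law X" for X by (rule prob_space_machine_law)
  have YR: "Y \<in> measurable (machine_law X) (count_space UNIV)" for X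
    using Y by (simp add: measurable_machine_law)
  have Yt: "(\<lambda>x. Y (embed t x)) \<in> measurable (PiM {..<q} (\<lambda>_. borel)) (count_space UNIV)" for t
    by (rule measurable_compose[OF embed_measurable Y])
  have YC: "(\<lambda>x. Y (embed t x)) \<in> measurable (cond_law t X) (count_space UNIV)" for t X
    using Yt unfolding cond_law_def by (simp add: measurable_normal_PiM)
  have Ey: "{x\<in>space (data_space q). Y x = y} \<in> sets (data_space q)" for y
    by (rule sets_message[OF Y])
  have EyR: "{x\<in>space (machine_law X). Y x = y} \<in> sets (machine_law X)" for y X
    by (rule sets_message[OF YR])
  have EyC: "{x\<in>space (cond_law t X). Y (embed t x) = y} \<in> sets (cond_law t X)" for y t X
    by (rule sets_message[OF YC])
  have sd: "space (data_space q) = extensional {..<q}" by (auto simp: space_PiM PiE_def space_pair_measure)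
  have pn: "(\<integral>\<^sup>+x. indicator {x\<in>space (data_space q). Y x = y} (embed t x) \<partial>cond_law t X) = ennreal (p X t y)" for t X y
  proof -
    have "(\<integral>\<^sup>+x. indicator {x\<in>space (data_space q). Y x = y} (embed t x) \<partial>cond_law t X)
       = (\<integral>\<^sup>+x. indicator {x\<in>space (cond_law t X). Y (embed t x) = y} x \<partial>cond_law t X)"
      by (intro nn_integral_cong) (auto simp: indicator_def sd embed_def space_cond_law)
    then show ?thesis using EyC[of t X y] by (simp add: p_def C.emeasure_eq_measure)
  qed
  have PE: "ennreal (P X y) = (\<integral>\<^sup>+t. ennreal (p X t y) \<partial>designs)"
    and pm: "(\<lambda>t. ennreal (p X t y)) \<in> borel_measurable designs" for X y
  proof -
    let ?F = "indicator {x\<in>space (data_space q). Y x = y} :: _ \<Rightarrow> ennreal"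
    have F: "?F \<in> borel_measurable (data_space q)" using Ey by simp
    note D = nn_integral_PiM_obs_law[OF fn_measurable sigma F, of X, folded embed_def cond_law_def machine_law_def]
    have "ennreal (P X y) = (\<integral>\<^sup>+x. indicator {x\<in>space (machine_law X). Y x = y} x \<partial>machine_law X)"
      using EyR[of X y] by (simp add: P_def R.emeasure_eq_measure)
    also have "\<dots> = (\<integral>\<^sup>+x. ?F x \<partial>machine_law X)"
      by (intro nn_integral_cong) (auto simp: indicator_def sd space_machine_law)
    finally show "ennreal (P X y) = (\<integral>\<^sup>+t. ennreal (p X t y) \<partial>designs)"
      unfolding D(1) pn .
    show "(\<lambda>t. ennreal (p X t y)) \<in> borel_measurable designs"
      using D(2) unfolding pn .
  qed
  have p01: "0 \<le> p X t y" "p X t y \<le> 1" for X t y by (auto simp: p_def)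
  have pmr[measurable]: "(\<lambda>t. p X t y) \<in> borel_measurable designs" for X y
    using borel_measurable_enn2real[OF pm[of X y]] p01 by simp
  have Pexp: "P X y = U.expectation (\<lambda>t. p X t y)" for X y
  proof -
    have i: "integrable designs (\<lambda>t. p X t y)"
      by (rule U.integrable_const_bound[of _ 1]) (use p01 in auto)
    have "ennreal (P X y) = ennreal (U.expectation (\<lambda>t. p X t y))"
      unfolding PE using i p01 by (intro nn_integral_eq_integral) auto
    then show ?thesis using p01 by (subst (asm) ennreal_inj) (auto simp: P_def intro!: integral_nonneg)
  qed
  define T where "T X k t = (\<integral>\<^sup>+y. ennreal (triangular (p X t y) (p (flip k X) t y)) \<partial>count_space UNIV)" for X k t
  define w where "w = string_weight n"
  define H where "H X t = (\<integral>\<^sup>+y. ennreal (p X t y * ln (1 / w y)) \<partial>count_space UNIV)" for X t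
  have lnw: "0 \<le> ln (1 / w y)" for y
    unfolding w_def using string_weight_pos[OF n] string_weight_le_1[OF n] by (intro ln_ge_zero) simp
  have Tm[measurable]: "(\<lambda>t. T X k t) \<in> borel_measurable designs" for X k
    unfolding T_def by (rule borel_measurable_nn_integral_count_space) measurable
  have Hm[measurable]: "(\<lambda>t. H X t) \<in> borel_measurable designs" for X
    unfolding H_def by (rule borel_measurable_nn_integral_count_space) measurable
  have ETH: "(\<integral>\<^sup>+t. H X t \<partial>designs) \<le> ennreal (2 / n + 3 * ln n * B)" if X: "X \<subseteq> {..<K}" for X
  proof -
    have "(\<integral>\<^sup>+t. H X t \<partial>designs) = (\<integral>\<^sup>+y. \<integral>\<^sup>+t. ennreal (p X t y * ln (1 / w y)) \<partial>designs \<partial>count_space UNIV)"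
      unfolding H_def by (intro nn_integral_count_space_nn_integral) auto
    also have "\<dots> = (\<integral>\<^sup>+y. ennreal (ln (1 / w y)) * ennreal (P X y) \<partial>count_space UNIV)"
    proof (rule nn_integral_cong)
      fix y
      have "(\<integral>\<^sup>+t. ennreal (p X t y * ln (1 / w y)) \<partial>designs) = (\<integral>\<^sup>+t. ennreal (ln (1 / w y)) * ennreal (p X t y) \<partial>designs)"
        using lnw[of y] p01 by (intro nn_integral_cong) (simp add: ennreal_mult mult.commute)
      then show "(\<integral>\<^sup>+t. ennreal (p X t y * ln (1 / w y)) \<partial>designs) = ennreal (ln (1 / w y)) * ennreal (P X y)"
        unfolding PE by (simp add: nn_integral_cmult)
    qed
    also have "\<dots> \<le> (\<integral>\<^sup>+y. (ennreal (2 / n) + ennreal (3 * ln n) * ennreal (real (length y))) * ennreal (P X y) \<partial>count_space UNIV)"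
    proof (intro nn_integral_mono mult_right_mono)
      fix y
      have "ennreal (ln (1 / w y)) \<le> ennreal (2 / n + 3 * ln n * real (length y))"
        unfolding w_def by (intro ennreal_leI ln_string_weight_le n)
      then show "ennreal (ln (1 / w y)) \<le> ennreal (2 / n) + ennreal (3 * ln n) * ennreal (real (length y))"
        using n by (simp add: ennreal_mult)
    qed simp
    also have "\<dots> = (\<integral>\<^sup>+x. ennreal (2 / n) + ennreal (3 * ln n) * ennreal (real (length (Y x))) \<partial>machine_law X)"
      unfolding P_def R.emeasure_eq_measure[symmetric]
      by (rule nn_integral_countable_image[OF YR, where F="\<lambda>y. ennreal (2 / n) + ennreal (3 * ln n) * ennreal (real (length y))", symmetric]) simp
    also have "\<dots> = ennreal (2 / n) + ennreal (3 * ln n) * (\<integral>\<^sup>+x. ennreal (real (length (Y x))) \<partial>machine_law X)"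
    proof -
      have "(\<lambda>x. ennreal (real (length (Y x)))) \<in> borel_measurable (machine_law X)"
        by (rule measurable_compose[OF YR]) simp
      then show ?thesis by (simp add: nn_integral_add nn_integral_cmult R.emeasure_space_1)
    qed
    also have "\<dots> \<le> ennreal (2 / n) + ennreal (3 * ln n) * ennreal B"
      by (intro add_left_mono mult_left_mono len X) simp
    also have "\<dots> = ennreal (2 / n + 3 * ln n * B)" using n B by (simp add: ennreal_mult)
    finally show ?thesis .
  qed
  \<comment> \<open>For designs without an energy bound: the discrimination is at most the sum of
    the masses of two probability laws.\<close>
  have Tbad: "T X k t \<le> 2" for X k t
  proof -
    have one: "(\<integral>\<^sup>+y. ennreal (p Z t y) \<partial>count_space UNIV) = 1" for Z
      unfolding p_def by (rule C.nn_integral_prob_message[OF YC])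
    have "T X k t \<le> (\<integral>\<^sup>+y. ennreal (p X t y) + ennreal (p (flip k X) t y) \<partial>count_space UNIV)"
      unfolding T_def
    proof (rule nn_integral_mono)
      fix y
      have "ennreal (triangular (p X t y) (p (flip k X) t y)) \<le> ennreal (p X t y + p (flip k X) t y)"
        using p01 by (intro ennreal_leI triangular_le_add) auto
      then show "ennreal (triangular (p X t y) (p (flip k X) t y)) \<le> ennreal (p X t y) + ennreal (p (flip k X) t y)"
        using p01 by simp
    qed
    also have "\<dots> = 2" by (simp add: nn_integral_add one)
    finally show ?thesis .
  qed
  have Tgood: "(\<Sum>X\<in>Pow {..<K}. \<Sum>k<K. T X k t) \<le> ennreal (32 * A) * (\<Sum>X\<in>Pow {..<K}. min (of_nat K) (H X t))" if g: "good t" for t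
  proof -
    interpret sd: sign_design \<sigma> A q K "\<lambda>k l. a * \<psi> k (t l)" by (rule sign_design[OF g])
    have law: "sd.law X = cond_law t X" for X
      by (simp add: sd.law_def cond_law_def sd.mean_def[abs_def] fn_def)
    show ?thesis
      using sd.sum_triangular_le[OF Yt[of t], of w] string_weight_pos[OF n] string_weight_le_1[OF n] nn_integral_string_weight[OF n]
      unfolding law T_def H_def p_def w_def by simp
  qed
  have "(\<Sum>X\<in>Pow {..<K}. \<Sum>k<K. \<integral>\<^sup>+y. ennreal (triangular (P X y) (P (flip k X) y)) \<partial>count_space UNIV)
      \<le> (\<Sum>X\<in>Pow {..<K}. \<Sum>k<K. \<integral>\<^sup>+t. T X k t \<partial>designs)"
  proof (intro sum_mono)
    fix X k
    have "(\<integral>\<^sup>+y. ennreal (triangular (P X y) (P (flip k X) y)) \<partial>count_space UNIV)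
       \<le> (\<integral>\<^sup>+y. \<integral>\<^sup>+t. ennreal (triangular (p X t y) (p (flip k X) t y)) \<partial>designs \<partial>count_space UNIV)"
      unfolding Pexp using p01 by (intro nn_integral_mono U.triangular_expectation_le) auto
    also have "\<dots> = (\<integral>\<^sup>+t. T X k t \<partial>designs)"
      unfolding T_def by (intro nn_integral_count_space_nn_integral[symmetric]) auto
    finally show "(\<integral>\<^sup>+y. ennreal (triangular (P X y) (P (flip k X) y)) \<partial>count_space UNIV) \<le> (\<integral>\<^sup>+t. T X k t \<partial>designs)" .
  qed
  also have "\<dots> = (\<integral>\<^sup>+t. (\<Sum>X\<in>Pow {..<K}. \<Sum>k<K. T X k t) \<partial>designs)"
    by (simp add: nn_integral_sum)
  also have "\<dots> \<le> (\<integral>\<^sup>+t. ennreal (2 ^ K * (2 * real K)) * indicator {t\<in>space designs. \<not> good t} t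
       + ennreal (32 * A) * (\<Sum>X\<in>Pow {..<K}. min (of_nat K) (H X t)) \<partial>designs)"
  proof (rule nn_integral_mono)
    fix t assume t: "t \<in> space designs"
    show "(\<Sum>X\<in>Pow {..<K}. \<Sum>k<K. T X k t) \<le> ennreal (2 ^ K * (2 * real K)) * indicator {t\<in>space designs. \<not> good t} t
       + ennreal (32 * A) * (\<Sum>X\<in>Pow {..<K}. min (of_nat K) (H X t))"
    proof (cases "good t")
      case True
      then show ?thesis using Tgood[OF True] by simp
    next
      case False
      have "(\<Sum>X\<in>Pow {..<K}. \<Sum>k<K. T X k t) \<le> (\<Sum>X\<in>Pow {..<K}. \<Sum>k<K. 2)"
        by (intro sum_mono Tbad)
      also have "\<dots> = ennreal (2 ^ K * (2 * real K))"
        by (simp add: card_Pow ennreal_mult ennreal_of_nat_eq_real_of_nat ennreal_power mult_ac)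
      finally show ?thesis using False t by (simp add: add_increasing2)
    qed
  qed
  also have "\<dots> = ennreal (2 ^ K * (2 * real K)) * emeasure designs {t\<in>space designs. \<not> good t}
      + ennreal (32 * A) * (\<Sum>X\<in>Pow {..<K}. \<integral>\<^sup>+t. min (of_nat K) (H X t) \<partial>designs)"
    by (subst nn_integral_add) (auto simp: nn_integral_cmult nn_integral_cmult_indicator nn_integral_sum)
  also have "\<dots> \<le> ennreal (2 ^ K * (2 * real K)) * ennreal (real K * exp (- 2 * real q * r))
      + ennreal (32 * A) * (\<Sum>X\<in>Pow {..<K}. ennreal (min (real K) (2 / n + 3 * ln n * B)))"
  proof (intro add_mono mult_left_mono emeasure_bad_le sum_mono)
    \<comment> \<open>The budget limits the length only on average over designs, so
      \<open>H X t\<close> may exceed it for some \<open>t\<close>. Averaging is legitimate because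
      the mean of the minimum is at most the minimum of the means.\<close>
    fix X assume X: "X \<in> Pow {..<K}"
    have "(\<integral>\<^sup>+t. min (of_nat K) (H X t) \<partial>designs) \<le> (\<integral>\<^sup>+t. of_nat K \<partial>designs)"
      by (intro nn_integral_mono) simp
    then have 1: "(\<integral>\<^sup>+t. min (of_nat K) (H X t) \<partial>designs) \<le> ennreal (real K)"
      by (simp add: U.emeasure_space_1 ennreal_of_nat_eq_real_of_nat)
    have "(\<integral>\<^sup>+t. min (of_nat K) (H X t) \<partial>designs) \<le> (\<integral>\<^sup>+t. H X t \<partial>designs)"
      by (intro nn_integral_mono) simp
    also have "\<dots> \<le> ennreal (2 / n + 3 * ln n * B)" using X by (intro ETH) auto
    finally have 2: "(\<integral>\<^sup>+t. min (of_nat K) (H X t) \<partial>designs) \<le> ennreal (2 / n + 3 * ln n * B)" .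
    show "(\<integral>\<^sup>+t. min (of_nat K) (H X t) \<partial>designs) \<le> ennreal (min (real K) (2 / n + 3 * ln n * B))"
      using 1 2 by (cases "real K \<le> 2 / n + 3 * ln n * B") (auto simp: min_def)
  qed auto
  also have "\<dots> = ennreal (2 ^ K * (2 * real K) * (real K * exp (- 2 * real q * r)) + 32 * A * (2 ^ K * min (real K) (2 / n + 3 * ln n * B)))"
  proof -
    have m0: "0 \<le> min (real K) (2 / n + 3 * ln n * B)" using n B by simp
    have e2: "ennreal (2 ^ K) = 2 ^ K" by (simp add: ennreal_power[symmetric])
    have "(\<Sum>X\<in>Pow {..<K}. ennreal (min (real K) (2 / n + 3 * ln n * B))) = ennreal (2 ^ K * min (real K) (2 / n + 3 * ln n * B))"
      unfolding ennreal_mult[OF zero_le_power[OF zero_le_numeral] m0] e2 by (simp add: card_Pow)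
    then show ?thesis
      using A m0 by (simp only: ennreal_mult[symmetric] ennreal_plus[symmetric]) (subst ennreal_plus, auto simp: ennreal_mult)
  qed
  also have "2 ^ K * (2 * real K) * (real K * exp (- 2 * real q * r)) + 32 * A * (2 ^ K * min (real K) (2 / n + 3 * ln n * B))
    = 2 ^ K * (2 * (real K)\<^sup>2 * exp (- 2 * real q * r) + 32 * A * min (real K) (2 / n + 3 * ln n * B))"
    by (simp add: power2_eq_square algebra_simps)
  finally show ?thesis .
qed

end

section \<open>Several machines\<close>

text \<open>One minus a product of factors in [0, 1] is at most the sum of their defects;
  \<open>t i\<close> dominates the defect of \<open>\<rho> i\<close>, and the form without
  subtraction suits \<open>ennreal\<close>.\<close>

lemma one_le_prod_add_sum:
  fixes \<rho> t :: "'i \<Rightarrow> ennreal"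
  assumes "finite I" "\<And>i. i \<in> I \<Longrightarrow> \<rho> i \<le> 1" "\<And>i. i \<in> I \<Longrightarrow> 1 \<le> \<rho> i + t i"
  shows "1 \<le> (\<Prod>i\<in>I. \<rho> i) + (\<Sum>i\<in>I. t i)"
  using assms
proof (induction I rule: finite_induct)
  case (insert j I)
  have "1 \<le> \<rho> j * 1 + t j" using insert.prems by simp
  also have "\<dots> \<le> \<rho> j * ((\<Prod>i\<in>I. \<rho> i) + (\<Sum>i\<in>I. t i)) + t j"
    using insert by (intro add_right_mono mult_left_mono) auto
  also have "\<dots> \<le> (\<rho> j * (\<Prod>i\<in>I. \<rho> i) + 1 * (\<Sum>i\<in>I. t i)) + t j"
    unfolding distrib_left using insert.prems by (intro add_right_mono add_left_mono mult_right_mono) auto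
  also have "\<dots> = (\<Prod>i\<in>insert j I. \<rho> i) + (\<Sum>i\<in>insert j I. t i)"
    using insert.hyps by (simp add: ac_simps)
  finally show ?case .
qed simp

lemma sqrt_prod: "finite I \<Longrightarrow> sqrt (\<Prod>i\<in>I. f i) = (\<Prod>i\<in>I. sqrt (f i))"
  by (induction rule: finite_induct) (auto simp: real_sqrt_mult)

text \<open>Le Cam's two point bound for independent messages: the Hellinger affinity factorises over
  the machines, and its defect on each machine is at most half of the triangular discrimination.\<close>

lemma two_point_bound:
  fixes R R' :: "nat \<Rightarrow> 'a measure" and Y :: "nat \<Rightarrow> 'a \<Rightarrow> bool list" and G G' :: "(nat \<Rightarrow> bool list) \<Rightarrow> ennreal"
  assumes R: "\<And>i. prob_space (R i)" and R': "\<And>i. prob_space (R' i)"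
    and Y: "\<And>i. i < m \<Longrightarrow> Y i \<in> measurable (R i) (count_space UNIV)"
    and Y': "\<And>i. i < m \<Longrightarrow> Y i \<in> measurable (R' i) (count_space UNIV)"
    and G: "\<And>y. c \<le> G y + G' y"
  defines "p \<equiv> \<lambda>i y. measure (R i) {x\<in>space (R i). Y i x = y}"
    and "p' \<equiv> \<lambda>i y. measure (R' i) {x\<in>space (R' i). Y i x = y}"
  shows "c \<le> 2 * ((\<integral>\<^sup>+x. G (messages m Y x) \<partial>PiM {..<m} R) + (\<integral>\<^sup>+x. G' (messages m Y x) \<partial>PiM {..<m} R'))
    + c * (\<Sum>i<m. \<integral>\<^sup>+y. ennreal (triangular (p i y) (p' i y)) \<partial>count_space UNIV)"
proof -
  interpret R: prob_space "R i" for i by (rule R)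
  interpret R': prob_space "R' i" for i by (rule R')
  interpret PR: product_sigma_finite R by (simp add: product_sigma_finite_def R.sigma_finite_measure_axioms)
  interpret PR': product_sigma_finite R' by (simp add: product_sigma_finite_def R'.sigma_finite_measure_axioms)
  interpret D: prob_space "PiM {..<m} R" by (rule prob_space_PiM) (rule R)
  let ?D = "PiM {..<m} R" and ?D' = "PiM {..<m} R'"
  let ?C = "PiE {..<m} (\<lambda>_. UNIV) :: (nat \<Rightarrow> bool list) set"
  define J where "J = messages m Y"
  have C: "countable ?C" by (intro countable_PiE) auto
  \<comment> \<open>A string with \<open>p i y = 0\<close> gets ratio 0, so the part of the second
    law singular to the first is lost. This is why the change of measure \<open>ch\<close> below is
    an inequality, in the direction that is needed.\<close>
  define ratio where "ratio i y = p' i y / p i y" for i y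
  have p0: "0 \<le> p i y" "0 \<le> p' i y" "0 \<le> ratio i y" for i y
    by (auto simp: p_def p'_def ratio_def)
  have one: "(\<integral>\<^sup>+y. ennreal (p i y) \<partial>count_space UNIV) = 1" if "i < m" for i
    unfolding p_def by (rule R.nn_integral_prob_message[OF Y[OF that]])
  have one': "(\<integral>\<^sup>+y. ennreal (p' i y) \<partial>count_space UNIV) = 1" if "i < m" for i
    unfolding p'_def by (rule R'.nn_integral_prob_message[OF Y'[OF that]])
  have YA: "\<forall>i<m. Y i \<in> measurable (R i) (count_space UNIV)" "\<forall>i<m. Y i \<in> measurable (R' i) (count_space UNIV)"
    using Y Y' by blast+
  have Jp: "emeasure ?D {x\<in>space ?D. J x = y} = ennreal (\<Prod>i<m. p i (y i))" if "y \<in> ?C" for y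
    unfolding J_def p_def by (rule emeasure_messages[OF R YA(1) that])
  have Jp': "emeasure ?D' {x\<in>space ?D'. J x = y} = ennreal (\<Prod>i<m. p' i (y i))" if "y \<in> ?C" for y
    unfolding J_def p'_def by (rule emeasure_messages[OF R' YA(2) that])
  have JM: "J \<in> measurable ?D (count_space ?C)"
    unfolding J_def by (rule measurable_messages(1)[OF YA(1)])
  have JM': "J \<in> measurable ?D' (count_space ?C)"
    unfolding J_def by (rule measurable_messages(1)[OF YA(2)])
  define rt where "rt y = (\<Prod>i<m. ratio i (y i))" for y :: "nat \<Rightarrow> bool list"
  have rt0: "0 \<le> rt y" for y unfolding rt_def using p0 by (intro prod_nonneg) auto
  have meas: "(\<lambda>x. H (J x)) \<in> borel_measurable ?D" for H :: "_ \<Rightarrow> ennreal"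
    by (rule measurable_compose[OF JM]) simp
  have ch: "(\<integral>\<^sup>+x. H (J x) * ennreal (rt (J x)) \<partial>?D) \<le> (\<integral>\<^sup>+x. H (J x) \<partial>?D')" for H
  proof -
    have "(\<integral>\<^sup>+x. H (J x) * ennreal (rt (J x)) \<partial>?D)
       = (\<integral>\<^sup>+y. H y * ennreal (rt y) * emeasure ?D {x\<in>space ?D. J x = y} \<partial>count_space ?C)"
      by (rule nn_integral_countable_image[OF JM C, where F="\<lambda>y. H y * ennreal (rt y)"])
    also have "\<dots> \<le> (\<integral>\<^sup>+y. H y * emeasure ?D' {x\<in>space ?D'. J x = y} \<partial>count_space ?C)"
    proof (rule nn_integral_mono)
      fix y assume "y \<in> space (count_space ?C)"
      then have y: "y \<in> ?C" by simp
      have "rt y * (\<Prod>i<m. p i (y i)) \<le> (\<Prod>i<m. p' i (y i))"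
        unfolding rt_def prod.distrib[symmetric] using p0
        by (intro prod_mono) (auto simp: ratio_def)
      then have "ennreal (rt y) * emeasure ?D {x\<in>space ?D. J x = y} \<le> emeasure ?D' {x\<in>space ?D'. J x = y}"
        unfolding Jp[OF y] Jp'[OF y] using rt0 by (simp add: ennreal_mult'[symmetric] ennreal_leI)
      then show "H y * ennreal (rt y) * emeasure ?D {x\<in>space ?D. J x = y} \<le> H y * emeasure ?D' {x\<in>space ?D'. J x = y}"
        unfolding mult.assoc by (intro mult_left_mono) auto
    qed
    also have "\<dots> = (\<integral>\<^sup>+x. H (J x) \<partial>?D')"
      by (rule nn_integral_countable_image[OF JM' C, symmetric])
    finally show ?thesis .
  qed
  \<comment> \<open>The overlap of the two joint message laws, that is, the sum of the pointwise
    minima of their probabilities. It bounds the error of every decision from below, while the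
    Hellinger affinity is what factorises.\<close>
  define \<mu> where "\<mu> = (\<integral>\<^sup>+x. ennreal (min 1 (rt (J x))) \<partial>?D)"
  have "c * \<mu> = (\<integral>\<^sup>+x. c * ennreal (min 1 (rt (J x))) \<partial>?D)"
    unfolding \<mu>_def using meas[of "\<lambda>y. ennreal (min 1 (rt y))"] by (intro nn_integral_cmult[symmetric])
  also have "\<dots> \<le> (\<integral>\<^sup>+x. G (J x) + G' (J x) * ennreal (rt (J x)) \<partial>?D)"
  proof (rule nn_integral_mono)
    fix x
    let ?u = "ennreal (min 1 (rt (J x)))"
    have "c * ?u \<le> (G (J x) + G' (J x)) * ?u" by (intro mult_right_mono G) simp
    also have "\<dots> = G (J x) * ?u + G' (J x) * ?u" by (rule distrib_right)
    also have "\<dots> \<le> G (J x) * 1 + G' (J x) * ennreal (rt (J x))"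
      by (intro add_mono mult_left_mono ennreal_leI) (auto simp flip: ennreal_1 intro!: ennreal_leI)
    finally show "c * ?u \<le> G (J x) + G' (J x) * ennreal (rt (J x))" by simp
  qed
  also have "\<dots> = (\<integral>\<^sup>+x. G (J x) \<partial>?D) + (\<integral>\<^sup>+x. G' (J x) * ennreal (rt (J x)) \<partial>?D)"
    by (rule nn_integral_add) (use meas[of G] meas[of "\<lambda>y. G' y * ennreal (rt y)"] in auto)
  also have "\<dots> \<le> (\<integral>\<^sup>+x. G (J x) \<partial>?D) + (\<integral>\<^sup>+x. G' (J x) \<partial>?D')"
    by (intro add_left_mono ch)
  finally have 1: "c * \<mu> \<le> (\<integral>\<^sup>+x. G (J x) \<partial>?D) + (\<integral>\<^sup>+x. G' (J x) \<partial>?D')" .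

  define \<rho> where "\<rho> i = (\<integral>\<^sup>+x. ennreal (sqrt (ratio i (Y i x))) \<partial>R i)" for i
  define T where "T i = (\<integral>\<^sup>+y. ennreal (triangular (p i y) (p' i y)) \<partial>count_space UNIV)" for i
  have \<rho>: "\<rho> i = (\<integral>\<^sup>+y. ennreal (sqrt (p i y * p' i y)) \<partial>count_space UNIV)" if i: "i < m" for i
  proof -
    have "\<rho> i = (\<integral>\<^sup>+y. ennreal (sqrt (ratio i y)) * emeasure (R i) {x\<in>space (R i). Y i x = y} \<partial>count_space UNIV)"
      unfolding \<rho>_def by (rule nn_integral_countable_image[OF Y[OF i]]) simp
    also have "\<dots> = (\<integral>\<^sup>+y. ennreal (sqrt (p i y * p' i y)) \<partial>count_space UNIV)"
    proof (rule nn_integral_cong)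
      fix y
      have "sqrt (ratio i y) * p i y = sqrt (p i y * p' i y)"
        using p0(1)[of i y] by (simp add: ratio_def real_sqrt_divide real_sqrt_mult) (metis nonzero_mult_div_cancel_right real_div_sqrt real_sqrt_eq_zero_cancel_iff times_divide_eq_left times_divide_eq_right mult.commute divide_eq_0_iff mult_eq_0_iff)
      then show "ennreal (sqrt (ratio i y)) * emeasure (R i) {x\<in>space (R i). Y i x = y} = ennreal (sqrt (p i y * p' i y))"
        using p0 by (simp add: R.emeasure_eq_measure ennreal_mult[symmetric] p_def)
    qed
    finally show ?thesis .
  qed
  have halve: "ennreal (x / 2) = ennreal (1 / 2) * ennreal x" for x
    by (subst ennreal_mult'[symmetric]) simp_all
  have half: "(\<integral>\<^sup>+y. ennreal ((p i y + p' i y) / 2) \<partial>count_space UNIV) = 1" if i: "i < m" for i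
  proof -
    have "(\<integral>\<^sup>+y. ennreal ((p i y + p' i y) / 2) \<partial>count_space UNIV)
       = (\<integral>\<^sup>+y. ennreal (1 / 2) * (ennreal (p i y) + ennreal (p' i y)) \<partial>count_space UNIV)"
    proof (rule nn_integral_cong)
      fix y
      show "ennreal ((p i y + p' i y) / 2) = ennreal (1 / 2) * (ennreal (p i y) + ennreal (p' i y))"
        unfolding halve[of "p i y + p' i y"] using p0(1,2)[of i y] by simp
    qed
    also have "\<dots> = ennreal (1 / 2) * 2"
      by (simp add: nn_integral_cmult nn_integral_add one[OF i] one'[OF i])
    also have "\<dots> = 1" using halve[of 2] by simp
    finally show ?thesis .
  qed
  have \<rho>1: "\<rho> i \<le> 1" if i: "i < m" for i
  proof -
    have "\<rho> i \<le> (\<integral>\<^sup>+y. ennreal ((p i y + p' i y) / 2) \<partial>count_space UNIV)"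
      unfolding \<rho>[OF i] using p0 by (intro nn_integral_mono ennreal_leI arith_geo_mean_sqrt) auto
    then show ?thesis unfolding half[OF i] .
  qed
  have \<rho>T: "1 \<le> \<rho> i + ennreal (1 / 2) * T i" if i: "i < m" for i
  proof -
    have "1 = (\<integral>\<^sup>+y. ennreal ((p i y + p' i y) / 2) \<partial>count_space UNIV)"
      by (simp add: half[OF i])
    also have "\<dots> \<le> (\<integral>\<^sup>+y. ennreal (sqrt (p i y * p' i y)) + ennreal (1 / 2) * ennreal (triangular (p i y) (p' i y)) \<partial>count_space UNIV)"
    proof (rule nn_integral_mono)
      fix y
      define u v where "u = p i y" and "v = p' i y"
      have uv: "0 \<le> u" "0 \<le> v" using p0 by (auto simp: u_def v_def)
      have sq: "u - v = (sqrt u - sqrt v) * (sqrt u + sqrt v)"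
        using uv by (simp add: algebra_simps)
      have "u + v - 2 * sqrt (u * v) = (sqrt u - sqrt v)\<^sup>2"
        using uv by (simp add: power2_diff real_sqrt_mult)
      also have "\<dots> \<le> triangular u v"
      proof (cases "u + v = 0")
        case True
        then have "u = 0" "v = 0" using uv by (simp_all add: add_nonneg_eq_0_iff)
        then show ?thesis by (simp add: triangular_def)
      next
        case False
        then have s: "0 < u + v" using uv by linarith
        have "u + v \<le> (sqrt u + sqrt v)\<^sup>2" using uv by (simp add: power2_sum)
        then have "(sqrt u - sqrt v)\<^sup>2 * (u + v) \<le> (sqrt u - sqrt v)\<^sup>2 * (sqrt u + sqrt v)\<^sup>2"
          by (intro mult_left_mono) auto
        also have "\<dots> = (u - v)\<^sup>2" by (simp only: sq power_mult_distrib)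
        finally show ?thesis using s by (simp add: triangular_def pos_le_divide_eq)
      qed
      finally have "(u + v) / 2 \<le> sqrt (u * v) + 1 / 2 * triangular u v" by simp
      then have "ennreal ((u + v) / 2) \<le> ennreal (sqrt (u * v) + 1 / 2 * triangular u v)" by (rule ennreal_leI)
      also have "\<dots> = ennreal (sqrt (u * v)) + ennreal (1 / 2 * triangular u v)"
        using uv triangular_nonneg by (intro ennreal_plus) auto
      also have "ennreal (1 / 2 * triangular u v) = ennreal (1 / 2) * ennreal (triangular u v)"
        by (intro ennreal_mult') simp
      finally show "ennreal ((p i y + p' i y) / 2) \<le> ennreal (sqrt (p i y * p' i y)) + ennreal (1 / 2) * ennreal (triangular (p i y) (p' i y))"
        unfolding u_def v_def .
    qed
    also have "\<dots> = \<rho> i + ennreal (1 / 2) * T i"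
      unfolding \<rho>[OF i] T_def by (simp add: nn_integral_add nn_integral_cmult)
    finally show ?thesis .
  qed
  have mY: "(\<lambda>x. ennreal (h (Y i x))) \<in> borel_measurable (R i)" if "i < m" for h i
    by (rule measurable_compose[OF Y[OF that]]) simp
  have P\<rho>: "(\<Prod>i<m. \<rho> i) = (\<integral>\<^sup>+x. ennreal (sqrt (rt (J x))) \<partial>?D)"
  proof -
    have "(\<Prod>i<m. \<rho> i) = (\<integral>\<^sup>+x. (\<Prod>i<m. ennreal (sqrt (ratio i (Y i (x i))))) \<partial>?D)"
      unfolding \<rho>_def by (intro PR.product_nn_integral_prod[symmetric]) (auto intro!: mY)
    also have "\<dots> = (\<integral>\<^sup>+x. ennreal (sqrt (rt (J x))) \<partial>?D)"
      using p0 by (intro nn_integral_cong) (simp add: prod_ennreal rt_def J_def messages_def sqrt_prod)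
    finally show ?thesis .
  qed
  have Ert: "(\<integral>\<^sup>+x. ennreal (rt (J x)) \<partial>?D) \<le> 1"
    using ch[of "\<lambda>_. 1"] prob_space.emeasure_space_1[OF prob_space_PiM[OF R'], of "{..<m}"] by simp
  have "(\<Prod>i<m. \<rho> i) \<le> (\<integral>\<^sup>+x. ennreal (min 1 (rt (J x))) + ennreal (1 / 4) * (1 + ennreal (rt (J x))) \<partial>?D)"
    unfolding P\<rho>
  proof (rule nn_integral_mono)
    fix x
    define u where "u = sqrt (rt (J x))"
    have u: "0 \<le> u" "rt (J x) = u\<^sup>2" using rt0 by (auto simp: u_def)
    \<comment> \<open>Compares affinity with overlap linearly, in place of Cauchy-Schwarz. The
      correction \<open>(1 + u^2) / 4\<close> integrates to at most 1/2, small enough to be absorbed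
      after doubling.\<close>
    have "u \<le> min 1 (u\<^sup>2) + 1 / 4 * (1 + u\<^sup>2)"
    proof -
      have "0 \<le> (u / 2 - 1)\<^sup>2" "0 \<le> (u - 1 / 2)\<^sup>2" by simp_all
      then have "u \<le> 1 + u\<^sup>2 / 4" "u \<le> u\<^sup>2 + 1 / 4" by (simp_all add: power2_diff power_divide)
      moreover have "u \<le> min 1 t + 1 / 4 * (1 + t)" if "u \<le> 1 + t / 4" "u \<le> t + 1 / 4" "0 \<le> t" for t
        using that by (cases "1 \<le> t") (simp_all add: min_def add_divide_distrib)
      ultimately show ?thesis by simp
    qed
    then have "ennreal u \<le> ennreal (min 1 (u\<^sup>2) + 1 / 4 * (1 + u\<^sup>2))" by (rule ennreal_leI)
    also have "\<dots> = ennreal (min 1 (u\<^sup>2)) + ennreal (1 / 4) * (1 + ennreal (u\<^sup>2))"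
    proof -
      have "ennreal (1 / 4 * (1 + u\<^sup>2)) = ennreal (1 / 4) * ennreal (1 + u\<^sup>2)"
        by (rule ennreal_mult') simp
      then show ?thesis by (subst ennreal_plus) auto
    qed
    finally show "ennreal (sqrt (rt (J x))) \<le> ennreal (min 1 (rt (J x))) + ennreal (1 / 4) * (1 + ennreal (rt (J x)))"
      using u(1) by (simp add: u(2))
  qed
  also have "\<dots> = \<mu> + ennreal (1 / 4) * (1 + (\<integral>\<^sup>+x. ennreal (rt (J x)) \<partial>?D))"
    unfolding \<mu>_def using meas[of "\<lambda>y. ennreal (rt y)"] meas[of "\<lambda>y. ennreal (min 1 (rt y))"]
    by (simp add: nn_integral_add nn_integral_cmult D.emeasure_space_1)
  also have "\<dots> \<le> \<mu> + ennreal (1 / 4) * (1 + 1)"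
    by (intro add_left_mono mult_left_mono Ert) simp
  also have "\<dots> = \<mu> + ennreal (1 / 2)"
  proof -
    have "ennreal (1 / 4) * (1 + 1) = ennreal (1 / 4) * ennreal 2" by simp
    also have "\<dots> = ennreal (1 / 2)" by (subst ennreal_mult'[symmetric]) simp_all
    finally show ?thesis by simp
  qed
  finally have 2: "(\<Prod>i<m. \<rho> i) \<le> \<mu> + ennreal (1 / 2)" .
  have h2: "2 * ennreal (1 / 2) = 1"
    using halve[of 2] by (simp add: mult.commute)
  have "1 \<le> (\<Prod>i<m. \<rho> i) + (\<Sum>i<m. ennreal (1 / 2) * T i)"
    by (rule one_le_prod_add_sum) (use \<rho>1 \<rho>T in auto)
  also have "\<dots> \<le> (\<mu> + ennreal (1 / 2)) + (\<Sum>i<m. ennreal (1 / 2) * T i)"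
    by (intro add_right_mono 2)
  \<comment> \<open>Doubling turns the correction 1/2 into 1, which cancels against half of the left
    side.\<close>
  finally have "2 * 1 \<le> 2 * ((\<mu> + ennreal (1 / 2)) + (\<Sum>i<m. ennreal (1 / 2) * T i))"
    by (rule mult_left_mono) simp
  also have "\<dots> = 1 + (2 * \<mu> + (\<Sum>i<m. T i))"
    by (simp only: distrib_left sum_distrib_left mult.assoc[symmetric] h2 mult_1_left) (simp only: ac_simps)
  finally have "1 + 1 \<le> 1 + (2 * \<mu> + (\<Sum>i<m. T i))" by simp
  then have 3: "1 \<le> 2 * \<mu> + (\<Sum>i<m. T i)"
    unfolding ennreal_add_left_cancel_le by simp
  have "c * 1 \<le> c * (2 * \<mu> + (\<Sum>i<m. T i))" by (intro mult_left_mono 3) simp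
  also have "\<dots> = 2 * (c * \<mu>) + c * (\<Sum>i<m. T i)" by (simp add: distrib_left ac_simps)
  also have "\<dots> \<le> 2 * ((\<integral>\<^sup>+x. G (J x) \<partial>?D) + (\<integral>\<^sup>+x. G' (J x) \<partial>?D')) + c * (\<Sum>i<m. T i)"
    by (intro add_right_mono mult_left_mono 1) simp
  finally show ?thesis unfolding T_def J_def by simp
qed

section \<open>Assouad's summation over the hypercube\<close>

context random_design
begin

lemma data_law_eq: "data_law m q \<sigma> (fn X) = PiM {..<m} (\<lambda>_. machine_law X)"
  by (simp add: data_law_def machine_law_def)

text \<open>Restricting the loss to a cell makes it depend on the sign of that cell alone, so that a
  lower bound for the total loss splits into two-point problems.\<close>

definition cell_loss :: "(real \<Rightarrow> real) \<Rightarrow> nat \<Rightarrow> real \<Rightarrow> ennreal" where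
  "cell_loss h k s = (\<integral>\<^sup>+x. ennreal ((h x - s * (a * \<psi> k x))\<^sup>2) * indicator (cell k \<inter> {0..1}) x \<partial>lborel)"

lemma sum_cell_loss_le:
  assumes [measurable]: "h \<in> borel_measurable borel"
  shows "(\<Sum>k<K. cell_loss h k (pm_sign X k)) \<le> sq_dist01 h (fn X)"
proof -
  have "(\<Sum>k<K. cell_loss h k (pm_sign X k))
      = (\<integral>\<^sup>+x. (\<Sum>k<K. ennreal ((h x - pm_sign X k * (a * \<psi> k x))\<^sup>2) * indicator (cell k \<inter> {0..1}) x) \<partial>lborel)"
    unfolding cell_loss_def by (intro nn_integral_sum[symmetric]) measurable
  also have "\<dots> \<le> sq_dist01 h (fn X)"
    unfolding sq_dist01_def
  proof (rule nn_integral_mono)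
    fix x :: real
    show "(\<Sum>k<K. ennreal ((h x - pm_sign X k * (a * \<psi> k x))\<^sup>2) * indicator (cell k \<inter> {0..1}) x)
        \<le> ennreal ((h x - fn X x)\<^sup>2) * indicator {0..1} x"
    proof (cases "\<exists>k<K. x \<in> cell k")
      case True
      then obtain k where k: "k < K" "x \<in> cell k" by blast
      have other: "x \<notin> cell j" if "j < K" "j \<noteq> k" for j using disj[of k j x] k that by blast
      have "fn X x = (\<Sum>j<K. if j = k then pm_sign X k * (a * \<psi> k x) else 0)"
        unfolding fn_def using supp other by (intro sum.cong refl) auto
      then have f: "fn X x = pm_sign X k * (a * \<psi> k x)" using k by simp
      have "(\<Sum>j<K. ennreal ((h x - pm_sign X j * (a * \<psi> j x))\<^sup>2) * indicator (cell j \<inter> {0..1}) x)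
        = (\<Sum>j<K. if j = k then ennreal ((h x - fn X x)\<^sup>2) * indicator {0..1} x else 0)"
        using other k f by (intro sum.cong refl) (auto simp: indicator_def)
      then show ?thesis using k by simp
    next
      case False
      then have "(\<Sum>k<K. ennreal ((h x - pm_sign X k * (a * \<psi> k x))\<^sup>2) * indicator (cell k \<inter> {0..1}) x) = 0"
        by (intro sum.neutral) auto
      then show ?thesis by simp
    qed
  qed
  finally show ?thesis .
qed

text \<open>The parallelogram identity: no function can be close to both signs on a cell.
  \<open>norm\<close> says that the perturbation has its full energy inside the unit
  interval.\<close>

lemma cell_loss_add:
  assumes [measurable]: "h \<in> borel_measurable borel" and k: "k < K"
    and norm: "1 \<le> (\<integral>\<^sup>+x. ennreal ((\<psi> k x)\<^sup>2) * indicator {0..1} x \<partial>lborel)"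
    and s: "s\<^sup>2 = 1"
  shows "ennreal (2 * a\<^sup>2) \<le> cell_loss h k s + cell_loss h k (- s)"
proof -
  note [measurable] = psi[OF k] cell[OF k]
  have "ennreal (2 * a\<^sup>2) * 1 \<le> ennreal (2 * a\<^sup>2) * (\<integral>\<^sup>+x. ennreal ((\<psi> k x)\<^sup>2) * indicator {0..1} x \<partial>lborel)"
    by (intro mult_left_mono norm) simp
  also have "\<dots> = (\<integral>\<^sup>+x. ennreal (2 * a\<^sup>2) * (ennreal ((\<psi> k x)\<^sup>2) * indicator {0..1} x) \<partial>lborel)"
    by (intro nn_integral_cmult[symmetric]) measurable
  also have "\<dots> \<le> (\<integral>\<^sup>+x. ennreal ((h x - s * (a * \<psi> k x))\<^sup>2) * indicator (cell k \<inter> {0..1}) x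
      + ennreal ((h x - (- s) * (a * \<psi> k x))\<^sup>2) * indicator (cell k \<inter> {0..1}) x \<partial>lborel)"
  proof (rule nn_integral_mono)
    fix x
    define v where "v = s * (a * \<psi> k x)"
    have v2: "v\<^sup>2 = a\<^sup>2 * (\<psi> k x)\<^sup>2" by (simp add: v_def power_mult_distrib s)
    have "2 * v\<^sup>2 \<le> (h x - v)\<^sup>2 + (h x + v)\<^sup>2" by (simp add: power2_diff power2_sum)
    then have "ennreal (2 * v\<^sup>2) \<le> ennreal ((h x - v)\<^sup>2 + (h x + v)\<^sup>2)" by (rule ennreal_leI)
    then have le: "ennreal (2 * a\<^sup>2) * ennreal ((\<psi> k x)\<^sup>2) \<le> ennreal ((h x - v)\<^sup>2) + ennreal ((h x + v)\<^sup>2)"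
      unfolding v2 by (simp add: ennreal_mult mult.assoc)
    show "ennreal (2 * a\<^sup>2) * (ennreal ((\<psi> k x)\<^sup>2) * indicator {0..1} x)
       \<le> ennreal ((h x - s * (a * \<psi> k x))\<^sup>2) * indicator (cell k \<inter> {0..1}) x
      + ennreal ((h x - (- s) * (a * \<psi> k x))\<^sup>2) * indicator (cell k \<inter> {0..1}) x"
      using le supp[OF k, of x] by (auto simp: indicator_def v_def)
  qed
  also have "\<dots> = cell_loss h k s + cell_loss h k (- s)"
    unfolding cell_loss_def by (intro nn_integral_add) measurable
  finally show ?thesis by simp
qed

text \<open>By \<open>info\<close> the discriminations, summed over machines, average at most 1/2
  over all vertices and cells, so half of the separation \<open>2 * a^2\<close> survives in
  \<open>two_point_bound\<close>. Its factor 2 and the two equal sums over a vertex and its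
  neighbour produce the final division by 4.\<close>

lemma risk_bound:
  fixes Y :: "nat \<Rightarrow> (nat \<Rightarrow> real \<times> real) \<Rightarrow> bool list" and g :: "(nat \<Rightarrow> bool list) \<Rightarrow> real \<Rightarrow> real"
  assumes Y: "\<And>i. i < m \<Longrightarrow> Y i \<in> measurable (data_space q) (count_space UNIV)"
    and g: "\<And>y. g y \<in> borel_measurable borel"
    and norm: "\<And>k. k < K \<Longrightarrow> 1 \<le> (\<integral>\<^sup>+x. ennreal ((\<psi> k x)\<^sup>2) * indicator {0..1} x \<partial>lborel)"
    and n: "2 \<le> n" and B: "\<And>i. i < m \<Longrightarrow> 0 \<le> B i"
    and len: "\<And>X i. X \<subseteq> {..<K} \<Longrightarrow> i < m \<Longrightarrow>
       (\<integral>\<^sup>+x. ennreal (real (length (Y i (x i)))) \<partial>data_law m q \<sigma> (fn X)) \<le> ennreal (B i)"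
    and risk: "\<And>X. X \<subseteq> {..<K} \<Longrightarrow>
       (\<integral>\<^sup>+x. sq_dist01 (g (messages m Y x)) (fn X) \<partial>data_law m q \<sigma> (fn X)) \<le> S"
    and info: "(\<Sum>i<m. 2 * (real K)\<^sup>2 * exp (- 2 * real q * r) + 32 * A * min (real K) (2 / n + 3 * ln n * B i)) \<le> real K / 2"
  shows "ennreal (a\<^sup>2 * real K / 4) \<le> S"
proof -
  interpret R: prob_space "machine_law X" for X by (rule prob_space_machine_law)
  interpret PR: product_prob_space "\<lambda>_::nat. machine_law X" "{..<m}" for X ..
  have YR: "Y i \<in> measurable (machine_law X) (count_space UNIV)" if "i < m" for i X
    using Y[OF that] by (simp add: measurable_machine_law)
  have len1: "(\<integral>\<^sup>+x. ennreal (real (length (Y i x))) \<partial>machine_law X) \<le> ennreal (B i)"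
    if X: "X \<subseteq> {..<K}" and i: "i < m" for X i
  proof -
    have "(\<integral>\<^sup>+x. ennreal (real (length (Y i x))) \<partial>machine_law X)
       = (\<integral>\<^sup>+x. ennreal (real (length (Y i x))) \<partial>distr (PiM {..<m} (\<lambda>_. machine_law X)) (machine_law X) (\<lambda>x. x i))"
      using i by (subst PR.PiM_component) auto
    also have "\<dots> = (\<integral>\<^sup>+x. ennreal (real (length (Y i (x i)))) \<partial>PiM {..<m} (\<lambda>_. machine_law X))"
    proof -
      have "(\<lambda>x. ennreal (real (length (Y i x)))) \<in> borel_measurable (machine_law X)"
        by (rule measurable_compose[OF YR[OF i]]) simp
      then show ?thesis
        using i by (intro nn_integral_distr) (auto simp: measurable_component_singleton)
    qed
    also have "\<dots> \<le> ennreal (B i)" using len[OF X i] by (simp add: data_law_eq)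
    finally show ?thesis .
  qed
  define P where "P i X y = measure (machine_law X) {x\<in>space (machine_law X). Y i x = y}" for i X y
  define T where "T i X k = (\<integral>\<^sup>+y. ennreal (triangular (P i X y) (P i (flip k X) y)) \<partial>count_space UNIV)" for i X k
  define bd where "bd i = 2 * (real K)\<^sup>2 * exp (- 2 * real q * r) + 32 * A * min (real K) (2 / n + 3 * ln n * B i)" for i
  have bd0: "0 \<le> bd i" if "i < m" for i
    unfolding bd_def using A n B[OF that] by (intro add_nonneg_nonneg mult_nonneg_nonneg) auto
  have T: "(\<Sum>X\<in>Pow {..<K}. \<Sum>k<K. T i X k) \<le> ennreal (2 ^ K * bd i)" if i: "i < m" for i
    unfolding T_def P_def bd_def by (rule machine_bound[OF Y[OF i] n B[OF i] len1[OF _ i]])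
  define G where "G k X y = cell_loss (g y) k (pm_sign X k)" for k X y
  define L where "L k X = (\<integral>\<^sup>+x. G k X (messages m Y x) \<partial>PiM {..<m} (\<lambda>_. machine_law X))" for k X
  have pair: "ennreal (2 * a\<^sup>2) \<le> 2 * (L k X + L k (flip k X)) + ennreal (2 * a\<^sup>2) * (\<Sum>i<m. T i X k)" if k: "k < K" for k X
    unfolding L_def T_def P_def
  proof (rule two_point_bound)
    show "ennreal (2 * a\<^sup>2) \<le> G k X y + G k (flip k X) y" for y
      using cell_loss_add[OF g k norm[OF k], of "pm_sign X k"] by (simp add: G_def pm_sign_flip)
  qed (use YR R.prob_space_axioms in auto)
  have LS: "(\<Sum>k<K. L k X) \<le> S" if X: "X \<subseteq> {..<K}" for X
  proof -
    have GM: "(\<lambda>x. G k X (messages m Y x)) \<in> borel_measurable (PiM {..<m} (\<lambda>_. machine_law X))" for k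
      using YR by (intro measurable_compose[OF measurable_messages(1)]) auto
    have "(\<Sum>k<K. L k X) = (\<integral>\<^sup>+x. (\<Sum>k<K. G k X (messages m Y x)) \<partial>PiM {..<m} (\<lambda>_. machine_law X))"
      unfolding L_def using GM by (intro nn_integral_sum[symmetric]) auto
    also have "\<dots> \<le> (\<integral>\<^sup>+x. sq_dist01 (g (messages m Y x)) (fn X) \<partial>PiM {..<m} (\<lambda>_. machine_law X))"
      unfolding G_def by (intro nn_integral_mono sum_cell_loss_le g)
    also have "\<dots> \<le> S" using risk[OF X] by (simp add: data_law_eq)
    finally show ?thesis .
  qed
  have N: "ennreal (2 ^ K) = 2 ^ K" by (simp add: ennreal_power[symmetric])
  have SL: "(\<Sum>X\<in>Pow {..<K}. \<Sum>k<K. L k X) \<le> ennreal (2 ^ K) * S"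
  proof -
    have "(\<Sum>X\<in>Pow {..<K}. \<Sum>k<K. L k X) \<le> (\<Sum>X\<in>Pow {..<K}. S)" by (intro sum_mono LS) auto
    then show ?thesis by (simp add: card_Pow N)
  qed
  have SF: "(\<Sum>X\<in>Pow {..<K}. \<Sum>k<K. L k (flip k X)) = (\<Sum>X\<in>Pow {..<K}. \<Sum>k<K. L k X)"
  proof -
    have "(\<Sum>X\<in>Pow {..<K}. \<Sum>k<K. L k (flip k X)) = (\<Sum>k<K. \<Sum>X\<in>Pow {..<K}. L k (flip k X))"
      by (rule sum.swap)
    also have "\<dots> = (\<Sum>k<K. \<Sum>X\<in>Pow {..<K}. L k X)"
      by (intro sum.cong refl sum_flip) auto
    also have "\<dots> = (\<Sum>X\<in>Pow {..<K}. \<Sum>k<K. L k X)" by (rule sum.swap)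
    finally show ?thesis .
  qed
  have ST: "(\<Sum>X\<in>Pow {..<K}. \<Sum>k<K. \<Sum>i<m. T i X k) \<le> ennreal (2 ^ K * (real K / 2))"
  proof -
    have "(\<Sum>X\<in>Pow {..<K}. \<Sum>k<K. \<Sum>i<m. T i X k) = (\<Sum>X\<in>Pow {..<K}. \<Sum>i<m. \<Sum>k<K. T i X k)"
      by (intro sum.cong refl sum.swap)
    also have "\<dots> = (\<Sum>i<m. \<Sum>X\<in>Pow {..<K}. \<Sum>k<K. T i X k)" by (rule sum.swap)
    also have "\<dots> \<le> (\<Sum>i<m. ennreal (2 ^ K * bd i))" by (intro sum_mono T) auto
    also have "\<dots> = ennreal (2 ^ K * (\<Sum>i<m. bd i))"
      using bd0 by (subst sum_ennreal) (auto simp: sum_distrib_left)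
    also have "\<dots> \<le> ennreal (2 ^ K * (real K / 2))"
      using info by (intro ennreal_leI mult_left_mono) (auto simp: bd_def)
    finally show ?thesis .
  qed
  have "ennreal (2 * a\<^sup>2 * real K * 2 ^ K) = (\<Sum>X\<in>Pow {..<K}. \<Sum>k<K. ennreal (2 * a\<^sup>2))"
    by (simp add: card_Pow ennreal_mult N ennreal_of_nat_eq_real_of_nat ac_simps)
  also have "\<dots> \<le> (\<Sum>X\<in>Pow {..<K}. \<Sum>k<K. 2 * (L k X + L k (flip k X)) + ennreal (2 * a\<^sup>2) * (\<Sum>i<m. T i X k))"
    by (intro sum_mono pair) auto
  also have "\<dots> = 2 * ((\<Sum>X\<in>Pow {..<K}. \<Sum>k<K. L k X) + (\<Sum>X\<in>Pow {..<K}. \<Sum>k<K. L k (flip k X)))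
      + ennreal (2 * a\<^sup>2) * (\<Sum>X\<in>Pow {..<K}. \<Sum>k<K. \<Sum>i<m. T i X k)"
    by (simp only: sum.distrib[symmetric] sum_distrib_left)
  also have "\<dots> \<le> 2 * (ennreal (2 ^ K) * S + ennreal (2 ^ K) * S) + ennreal (2 * a\<^sup>2) * ennreal (2 ^ K * (real K / 2))"
    unfolding SF by (intro add_mono mult_left_mono SL ST) auto
  also have "ennreal (2 * a\<^sup>2) * ennreal (2 ^ K * (real K / 2)) = ennreal (a\<^sup>2 * real K * 2 ^ K)"
    by (simp add: ennreal_mult[symmetric] mult_ac)
  finally have fin: "ennreal (2 * a\<^sup>2 * real K * 2 ^ K) \<le> 2 * (ennreal (2 ^ K) * S + ennreal (2 ^ K) * S) + ennreal (a\<^sup>2 * real K * 2 ^ K)" .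
  show ?thesis
  proof (cases S)
    case (real s)
    have "2 * (ennreal (2 ^ K) * S + ennreal (2 ^ K) * S) = 4 * (ennreal (2 ^ K) * S)"
      by (simp add: mult_2[symmetric] mult.assoc[symmetric])
    also have "\<dots> = ennreal (4 * (2 ^ K * s))" using real by (simp add: ennreal_mult)
    finally have "ennreal (2 * a\<^sup>2 * real K * 2 ^ K) \<le> ennreal (4 * (2 ^ K * s) + a\<^sup>2 * real K * 2 ^ K)"
      using fin real by (simp only: ennreal_plus) simp
    then have "2 * a\<^sup>2 * real K * 2 ^ K \<le> 4 * (2 ^ K * s) + a\<^sup>2 * real K * 2 ^ K"
      using real by (subst (asm) ennreal_le_iff) auto
    then have "2 ^ K * (a\<^sup>2 * real K) \<le> 2 ^ K * (4 * s)" by (simp add: algebra_simps)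
    then have "a\<^sup>2 * real K \<le> 4 * s" by (simp only: mult_le_cancel_left_pos zero_less_power zero_less_numeral)
    then show ?thesis using real by (simp add: ennreal_leI)
  qed simp
qed

end

section \<open>Wavelets\<close>

lemma L2_01_measurable: "f \<in> L2_01 \<Longrightarrow> f \<in> borel_measurable borel"
  by (simp add: L2_01_def)

text \<open>The Bochner integral of a non-integrable function is 0, so a nonzero norm certifies
  integrability. For the edge wavelets, about which only measurability and support are given, square
  integrability is extracted from orthonormality in this way.\<close>

lemma L2_01_I:
  assumes [measurable]: "f \<in> borel_measurable borel" and "inner01 f f \<noteq> 0"
  shows "f \<in> L2_01"
  using assms not_integrable_integral_eq[of lborel "\<lambda>x. indicator {0..1} x *\<^sub>R (f x * f x)"]
  by (auto simp: L2_01_def inner01_def set_integrable_def set_lebesgue_integral_def power2_eq_square)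

lemma L2_01_mult:
  assumes "f \<in> L2_01" "g \<in> L2_01"
  shows "set_integrable lborel {0..1} (\<lambda>x. f x * g x)"
proof -
  note [measurable] = assms[THEN L2_01_measurable]
  have i: "set_integrable lborel {0..1} (\<lambda>x. (f x)\<^sup>2 + (g x)\<^sup>2)"
    using assms by (intro set_integral_add) (auto simp: L2_01_def)
  show ?thesis
  proof (rule set_integrable_bound[OF i])
    show "set_borel_measurable lborel {0..1} (\<lambda>x. f x * g x)"
      unfolding set_borel_measurable_def by measurable
    have "\<bar>f x * g x\<bar> \<le> (f x)\<^sup>2 + (g x)\<^sup>2" for x
    proof -
      have "2 * (\<bar>f x\<bar> * \<bar>g x\<bar>) \<le> (f x)\<^sup>2 + (g x)\<^sup>2"
        using zero_le_power2[of "\<bar>f x\<bar> - \<bar>g x\<bar>"] by (simp add: power2_diff)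
      moreover have "0 \<le> \<bar>f x\<bar> * \<bar>g x\<bar>" by simp
      ultimately show ?thesis unfolding abs_mult by linarith
    qed
    then show "AE x in lborel. x \<in> {0..1} \<longrightarrow> norm (f x * g x) \<le> norm ((f x)\<^sup>2 + (g x)\<^sup>2)"
      by (auto intro!: AE_I2)
  qed
qed

lemma L2_01_scale: "f \<in> L2_01 \<Longrightarrow> (\<lambda>x. c * f x) \<in> L2_01"
  by (auto simp: L2_01_def power_mult_distrib)

lemma L2_01_add:
  assumes "f \<in> L2_01" "g \<in> L2_01"
  shows "(\<lambda>x. f x + g x) \<in> L2_01"
proof -
  note [measurable] = assms[THEN L2_01_measurable]
  have "set_integrable lborel {0..1} (\<lambda>x. (f x)\<^sup>2 + (2 * (f x * g x) + (g x)\<^sup>2))"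
    using assms L2_01_mult[OF assms] by (intro set_integral_add set_integrable_mult_right) (auto simp: L2_01_def)
  then show ?thesis by (simp add: L2_01_def power2_sum algebra_simps)
qed

lemma L2_01_sum: "finite I \<Longrightarrow> (\<And>k. k \<in> I \<Longrightarrow> f k \<in> L2_01) \<Longrightarrow> (\<lambda>x. \<Sum>k\<in>I. f k x) \<in> L2_01"
proof (induction I rule: finite_induct)
  case empty
  show ?case by (simp add: L2_01_def set_integrable_def)
next
  case (insert k I)
  then show ?case using L2_01_add[of "f k" "\<lambda>x. \<Sum>k\<in>I. f k x"] by simp
qed

lemma inner01_sum_left:
  assumes "finite I" "\<And>k. k \<in> I \<Longrightarrow> f k \<in> L2_01" "g \<in> L2_01"
  shows "inner01 (\<lambda>x. \<Sum>k\<in>I. c k * f k x) g = (\<Sum>k\<in>I. c k * inner01 (f k) g)"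
proof -
  have "inner01 (\<lambda>x. \<Sum>k\<in>I. c k * f k x) g = (\<integral>x. (\<Sum>k\<in>I. c k * (indicator {0..1} x *\<^sub>R (f k x * g x))) \<partial>lborel)"
    unfolding inner01_def set_lebesgue_integral_def
    by (intro Bochner_Integration.integral_cong refl) (simp add: sum_distrib_right sum_distrib_left ac_simps)
  also have "\<dots> = (\<Sum>k\<in>I. c k * inner01 (f k) g)"
    unfolding inner01_def set_lebesgue_integral_def
    using L2_01_mult[OF assms(2,3)]
    by (subst Bochner_Integration.integral_sum) (auto simp: set_integrable_def)
  finally show ?thesis .
qed

text \<open>The mother wavelet is supported on an interval of length \<open>2 * N - 1\<close>, so
  translates spaced by \<open>2 * N\<close> have disjoint supports. Starting at \<open>2 * N\<close>
  avoids the functions at the left edge.\<close>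

definition wavelet_index :: "nat \<Rightarrow> nat \<Rightarrow> nat" where
  "wavelet_index N k = 2 * N * (k + 1)"

definition wavelet_cell :: "nat \<Rightarrow> nat \<Rightarrow> nat \<Rightarrow> real set" where
  "wavelet_cell N j k = {(real (wavelet_index N k) + 1 - real N) / 2 ^ j .. (real (wavelet_index N k) + real N) / 2 ^ j}"

text \<open>With \<open>2 ^ j div (4 * N)\<close> of them the indices stay within the first half of
  the level, hence clear of the \<open>N\<close> functions at the right edge, and still a fixed
  fraction of the level is used.\<close>

lemma wavelet_index_bounds:
  assumes "1 \<le> N" "4 * N \<le> 2 ^ j" "k < 2 ^ j div (4 * N)"
  shows "N \<le> wavelet_index N k" "wavelet_index N k < 2 ^ j - N" "wavelet_index N k < 2 ^ j"
proof -
  show "N \<le> wavelet_index N k" using assms by (simp add: wavelet_index_def)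
  have "2 * wavelet_index N k = 4 * N * (k + 1)" by (simp add: wavelet_index_def)
  also have "\<dots> \<le> 4 * N * (2 ^ j div (4 * N))"
    using assms(3) by (intro mult_le_mono2) simp
  also have "\<dots> \<le> 2 ^ j" by simp
  finally have 1: "2 * wavelet_index N k \<le> 2 ^ j" .
  then show "wavelet_index N k < 2 ^ j - N" using assms by linarith
  then show "wavelet_index N k < 2 ^ j" by linarith
qed

lemma wavelet_index_inj: "1 \<le> N \<Longrightarrow> wavelet_index N k = wavelet_index N k' \<longleftrightarrow> k = k'"
  by (simp add: wavelet_index_def)

lemma wavelet_cell_disjoint:
  assumes "1 \<le> N" "k \<noteq> k'" "t \<in> wavelet_cell N j k"
  shows "t \<notin> wavelet_cell N j k'"
proof
  assume "t \<in> wavelet_cell N j k'"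
  with assms(3) have *: "real (wavelet_index N k) + 1 - real N \<le> t * 2 ^ j" "t * 2 ^ j \<le> real (wavelet_index N k) + real N"
    "real (wavelet_index N k') + 1 - real N \<le> t * 2 ^ j" "t * 2 ^ j \<le> real (wavelet_index N k') + real N"
    by (auto simp: wavelet_cell_def divide_le_eq le_divide_eq)
  have gap: "real (wavelet_index N u) + 2 * real N \<le> real (wavelet_index N v)" if "u < v" for u v
  proof -
    have "2 * N * ((u + 1) + 1) \<le> 2 * N * (v + 1)"
      using that by (intro mult_le_mono2) simp
    then have "2 * N * (u + 1) + 2 * N \<le> 2 * N * (v + 1)"
      by (simp only: distrib_left mult_1_right)
    then have "real (2 * N * (u + 1) + 2 * N) \<le> real (2 * N * (v + 1))" by (rule of_nat_mono)
    then show ?thesis by (simp add: wavelet_index_def)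
  qed
  from assms(2) have "k < k' \<or> k' < k" by auto
  then show False using gap[of k k'] gap[of k' k] * by auto
qed

lemma emeasure_wavelet_cell: "1 \<le> N \<Longrightarrow> emeasure unif (wavelet_cell N j k) \<le> ennreal (2 * real N / 2 ^ j)"
proof -
  assume N: "1 \<le> N"
  have "emeasure unif (wavelet_cell N j k) = emeasure lborel ({0<..<1} \<inter> wavelet_cell N j k)"
    by (subst emeasure_uniform_measure) (auto simp: wavelet_cell_def divide_ennreal_def)
  also have "\<dots> \<le> emeasure lborel (wavelet_cell N j k)"
    by (intro emeasure_mono) (auto simp: wavelet_cell_def)
  also have "\<dots> = ennreal ((2 * real N - 1) / 2 ^ j)"
    using N unfolding wavelet_cell_def
    by (subst emeasure_lborel_Icc) (auto simp: divide_right_mono diff_divide_distrib[symmetric])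
  also have "\<dots> \<le> ennreal (2 * real N / 2 ^ j)"
    by (intro ennreal_leI divide_right_mono) auto
  finally show ?thesis .
qed

lemma daubechies_wavelet:
  assumes "daubechies_pair N \<phi> \<psi>"
  shows "\<psi> \<in> borel_measurable borel" "\<exists>C\<ge>1. \<forall>x. (\<psi> x)\<^sup>2 \<le> C" "\<And>x. x \<notin> {1 - real N..real N} \<Longrightarrow> \<psi> x = 0"
proof -
  from assms obtain h :: "int \<Rightarrow> real" where
    N: "1 \<le> N" and m[measurable]: "\<phi> \<in> borel_measurable borel" and b: "bounded (range \<phi>)"
    and s: "\<And>x. x \<notin> {1 - real N..real N} \<Longrightarrow> \<phi> x = 0"
    and psi: "\<And>x. \<psi> x = sqrt 2 * (\<Sum>l = 1 - int N..int N. (- 1) powi l * h (1 - l) * \<phi> (2 * x - of_int l))"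
    unfolding daubechies_pair_def by blast
  show "\<psi> \<in> borel_measurable borel"
    unfolding psi[abs_def] by measurable
  from b obtain c where c: "\<And>x. \<bar>\<phi> x\<bar> \<le> c" by (auto simp: bounded_iff)
  define D where "D = sqrt 2 * (\<Sum>l = 1 - int N..int N. \<bar>(- 1) powi l * h (1 - l)\<bar> * c)"
  have D: "\<bar>\<psi> x\<bar> \<le> D" for x
    unfolding psi D_def abs_mult[of "sqrt 2"] using c
    by (intro mult_mono order_trans[OF sum_abs] sum_mono) (auto simp: abs_mult intro!: mult_left_mono)
  show "\<exists>C\<ge>1. \<forall>x. (\<psi> x)\<^sup>2 \<le> C"
  proof (intro exI[of _ "max 1 (D\<^sup>2)"] conjI allI)
    fix x
    have "\<bar>\<psi> x\<bar>\<^sup>2 \<le> D\<^sup>2" using D[of x] by (intro power_mono) auto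
    then show "(\<psi> x)\<^sup>2 \<le> max 1 (D\<^sup>2)" by simp
  qed simp
  fix x assume x: "x \<notin> {1 - real N..real N}"
  have "\<phi> (2 * x - of_int l) = 0" if l: "l \<in> {1 - int N..int N}" for l
  proof (rule s)
    have "1 - real N \<le> of_int l" "of_int l \<le> real N"
      using l of_int_le_iff[of "1 - int N" l, where 'a=real] of_int_le_iff[of l "int N", where 'a=real] by simp_all
    then show "2 * x - of_int l \<notin> {1 - real N..real N}" using x by auto
  qed
  then show "\<psi> x = 0" unfolding psi by simp
qed

text \<open>The chosen wavelets are interior ones, so they are dilated translates of one bounded
  function; therefore \<open>C\<close> depends neither on the level nor on the position.\<close>

lemma cdv_basis_cells:
  assumes "cdv_basis N j0 \<Phi> \<Psi>"
  obtains C where "1 \<le> C" "1 \<le> N"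
    "\<And>j k. 4 * N \<le> 2 ^ j \<Longrightarrow> k < 2 ^ j div (4 * N) \<Longrightarrow> \<Psi> j (wavelet_index N k) \<in> borel_measurable borel"
    "\<And>j k x. 4 * N \<le> 2 ^ j \<Longrightarrow> k < 2 ^ j div (4 * N) \<Longrightarrow> x \<notin> wavelet_cell N j k \<Longrightarrow> \<Psi> j (wavelet_index N k) x = 0"
    "\<And>j k x. 4 * N \<le> 2 ^ j \<Longrightarrow> k < 2 ^ j div (4 * N) \<Longrightarrow> (\<Psi> j (wavelet_index N k) x)\<^sup>2 \<le> C * 2 ^ j"
proof -
  from assms obtain \<phi> \<psi> \<psi>L \<psi>R where dp: "daubechies_pair N \<phi> \<psi>" and Psi: "\<Psi> = cdv_family N \<psi>L \<psi> \<psi>R"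
    unfolding cdv_basis_def by blast
  have N: "1 \<le> N" using dp unfolding daubechies_pair_def by blast
  note d = daubechies_wavelet[OF dp]
  from d(2) obtain C where C: "1 \<le> C" "\<And>x. (\<psi> x)\<^sup>2 \<le> C" by blast
  have eq: "\<Psi> j (wavelet_index N k) x = sqrt (2 ^ j) * \<psi> (2 ^ j * x - real (wavelet_index N k))"
    if "4 * N \<le> 2 ^ j" "k < 2 ^ j div (4 * N)" for j k x
    using wavelet_index_bounds[OF N that] by (simp add: Psi cdv_family_def)
  show thesis
  proof (rule that[OF C(1) N])
    fix j k assume jk: "4 * N \<le> 2 ^ j" "k < 2 ^ j div (4 * N)"
    note [measurable] = d(1)
    show "\<Psi> j (wavelet_index N k) \<in> borel_measurable borel"
      unfolding eq[OF jk, abs_def] by measurable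
  next
    fix j k x assume jk: "4 * N \<le> 2 ^ j" "k < 2 ^ j div (4 * N)" and x: "x \<notin> wavelet_cell N j k"
    have "2 ^ j * x - real (wavelet_index N k) \<notin> {1 - real N..real N}"
      using x by (auto simp: wavelet_cell_def divide_le_eq le_divide_eq algebra_simps)
    then show "\<Psi> j (wavelet_index N k) x = 0" unfolding eq[OF jk] by (simp add: d(3))
  next
    fix j k x assume jk: "4 * N \<le> 2 ^ j" "k < 2 ^ j div (4 * N)"
    show "(\<Psi> j (wavelet_index N k) x)\<^sup>2 \<le> C * 2 ^ j"
      unfolding eq[OF jk] using C(2) by (simp add: power_mult_distrib mult.commute)
  qed
qed

lemma cdv_basis_L2:
  assumes "cdv_basis N j0 \<Phi> \<Psi>" "k < 2 ^ j" "j0 \<le> j"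
  shows "\<Psi> j k \<in> L2_01" "\<Phi> j k \<in> L2_01"
proof -
  from assms(1) obtain \<phi> \<psi> \<phi>L \<phi>R \<psi>L \<psi>R where dp: "daubechies_pair N \<phi> \<psi>"
    and eL: "edge_scaling N \<phi> \<phi>L" and eR: "edge_scaling N (\<lambda>x. \<phi> (1 - x)) \<phi>R"
    and wL: "edge_wavelet N \<psi>L" and wR: "edge_wavelet N \<psi>R"
    and Phi: "\<Phi> = cdv_family N \<phi>L \<phi> \<phi>R" and Psi: "\<Psi> = cdv_family N \<psi>L \<psi> \<psi>R"
    unfolding cdv_basis_def by blast
  have [measurable]: "\<phi> \<in> borel_measurable borel" using dp unfolding daubechies_pair_def by blast
  have [measurable]: "\<psi> \<in> borel_measurable borel" by (rule daubechies_wavelet[OF dp])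
  have scal: "e r \<in> borel_measurable borel"
    if es: "edge_scaling N \<eta> e" and [measurable]: "\<eta> \<in> borel_measurable borel" and r: "r < N" for \<eta> e r
  proof -
    from es obtain a :: "nat \<Rightarrow> nat \<Rightarrow> real" where a: "\<And>x. e r x =
        (if 0 \<le> x then (\<Sum>p<N. a r p * (\<Sum>n = p..2 * N - 2. real (n choose p) * \<eta> (x + real n - real N + 1))) else 0)"
      using r unfolding edge_scaling_def by blast
    show ?thesis unfolding a[abs_def] by measurable
  qed
  have fam: "cdv_family N eL w eR j k \<in> borel_measurable borel"
    if L: "\<And>r. r < N \<Longrightarrow> eL r \<in> borel_measurable borel" and R: "\<And>r. r < N \<Longrightarrow> eR r \<in> borel_measurable borel"
      and [measurable]: "w \<in> borel_measurable borel" for eL eR w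
  proof -
    consider "k < N" | "N \<le> k" "k < 2 ^ j - N" | "N \<le> k" "2 ^ j - N \<le> k" by linarith
    then show ?thesis
    proof cases
      case 1
      note [measurable] = L[OF 1]
      show ?thesis unfolding cdv_family_def[abs_def] using 1 by simp
    next
      case 2
      then show ?thesis unfolding cdv_family_def[abs_def] by simp
    next
      case 3
      have "2 ^ j - Suc k < N" using 3 assms(2) by linarith
      note [measurable] = R[OF this]
      show ?thesis unfolding cdv_family_def[abs_def] using 3 by simp
    qed
  qed
  have "\<Psi> j k \<in> borel_measurable borel"
    unfolding Psi using wL wR by (intro fam) (auto simp: edge_wavelet_def)
  moreover have "inner01 (\<Psi> j k) (\<Psi> j k) = 1"
    using assms unfolding cdv_basis_def by simp
  ultimately show "\<Psi> j k \<in> L2_01" by (intro L2_01_I) auto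
  have "\<Phi> j k \<in> borel_measurable borel"
    unfolding Phi by (intro fam scal[OF eL] scal[OF eR]) auto
  moreover have "inner01 (\<Phi> j k) (\<Phi> j k) = 1"
    using assms unfolding cdv_basis_def by simp
  ultimately show "\<Phi> j k \<in> L2_01" by (intro L2_01_I) auto
qed

lemma inner01_commute: "inner01 f g = inner01 g f"
  by (simp add: inner01_def mult.commute)

text \<open>By orthonormality all coefficients vanish except \<open>K\<close> of level
  \<open>j\<close>, each with square \<open>a^2\<close>. The supremum in the norm thus reduces to
  one term, the same for all sign patterns.\<close>

lemma sign_combination_in_besov_ball:
  assumes cdv: "cdv_basis N j0 \<Phi> \<Psi>" and N: "1 \<le> N" and j: "j0 \<le> j" "4 * N \<le> 2 ^ j"
    and K: "K \<le> 2 ^ j div (4 * N)"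
    and small: "2 powr (2 * real j * s) * (real K * a\<^sup>2) < L\<^sup>2"
  shows "(\<lambda>x. \<Sum>k<K. pm_sign X k * (a * \<Psi> j (wavelet_index N k) x)) \<in> besov_ball j0 \<Phi> \<Psi> s L"
proof -
  define f where "f x = (\<Sum>k<K. (pm_sign X k * a) * \<Psi> j (wavelet_index N k) x)" for x
  have idx: "wavelet_index N k < 2 ^ j" if "k < K" for k
    using wavelet_index_bounds[OF N j(2)] that K by auto
  have psi: "\<Psi> j (wavelet_index N k) \<in> L2_01" if "k < K" for k
    by (rule cdv_basis_L2[OF cdv idx[OF that] j(1)])
  have fL2: "f \<in> L2_01"
    unfolding f_def[abs_def] using psi by (intro L2_01_sum L2_01_scale) auto
  have inner: "inner01 f g = (\<Sum>k<K. (pm_sign X k * a) * inner01 (\<Psi> j (wavelet_index N k)) g)" if "g \<in> L2_01" for g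
    unfolding f_def[abs_def] using psi that by (intro inner01_sum_left) auto
  have orth1: "inner01 (\<Psi> i k) (\<Psi> j' l) = of_bool (i = j' \<and> k = l)" if "j0 \<le> i" "j0 \<le> j'" "k < 2 ^ i" "l < 2 ^ j'" for i j' k l
    using cdv that unfolding cdv_basis_def by blast
  have orth2: "inner01 (\<Phi> j0 k) (\<Psi> j' l) = 0" if "j0 \<le> j'" "k < 2 ^ j0" "l < 2 ^ j'" for j' k l
    using cdv that unfolding cdv_basis_def by blast
  have Phi0: "inner01 f (\<Phi> j0 k) = 0" if k: "k < 2 ^ j0" for k
    using cdv_basis_L2(2)[OF cdv k order_refl] orth2[OF j(1) k idx]
    by (subst inner) (auto simp: inner01_commute[of _ "\<Phi> j0 k"])
  have Psi_other: "inner01 f (\<Psi> i l) = 0" if "j0 \<le> i" "l < 2 ^ i" "i \<noteq> j" for i l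
    using cdv_basis_L2(1)[OF cdv that(2,1)] orth1[OF j(1) that(1) idx that(2)] that(3)
    by (subst inner) auto
  have Psi_same: "inner01 f (\<Psi> j l) = (\<Sum>k<K. (pm_sign X k * a) * of_bool (wavelet_index N k = l))" if l: "l < 2 ^ j" for l
    using cdv_basis_L2(1)[OF cdv l j(1)] orth1[OF j(1) j(1) idx l]
    by (subst inner) auto
  have sq: "(inner01 f (\<Psi> j l))\<^sup>2 = (\<Sum>k<K. a\<^sup>2 * of_bool (wavelet_index N k = l))" if l: "l < 2 ^ j" for l
  proof -
    have "(inner01 f (\<Psi> j l))\<^sup>2 = (\<Sum>k<K. ((pm_sign X k * a) * of_bool (wavelet_index N k = l))\<^sup>2)"
      unfolding Psi_same[OF l]
      by (rule power2_sum_orthogonal) (auto simp: wavelet_index_inj[OF N])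
    then show ?thesis by (simp add: power_mult_distrib of_bool_def if_distrib[of "\<lambda>a. a ^ _"] cong: if_cong)
  qed
  have total: "(\<Sum>l<2 ^ j. (inner01 f (\<Psi> j l))\<^sup>2) = real K * a\<^sup>2"
  proof -
    have "(\<Sum>l<2 ^ j. (inner01 f (\<Psi> j l))\<^sup>2) = (\<Sum>l<2 ^ j. \<Sum>k<K. a\<^sup>2 * of_bool (wavelet_index N k = l))"
      by (intro sum.cong refl sq) auto
    also have "\<dots> = (\<Sum>k<K. \<Sum>l<2 ^ j. a\<^sup>2 * of_bool (wavelet_index N k = l))" by (rule sum.swap)
    also have "\<dots> = (\<Sum>k<K. a\<^sup>2)"
    proof (intro sum.cong refl)
      fix k assume "k \<in> {..<K}"
      then have k: "wavelet_index N k < 2 ^ j" using idx by simp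
      have "(\<Sum>l<2 ^ j. a\<^sup>2 * of_bool (wavelet_index N k = l)) = (\<Sum>l<2 ^ j. if l = wavelet_index N k then a\<^sup>2 else 0)"
        by (intro sum.cong refl) auto
      then show "(\<Sum>l<2 ^ j. a\<^sup>2 * of_bool (wavelet_index N k = l)) = a\<^sup>2" using k by simp
    qed
    finally show ?thesis by simp
  qed
  have "besov_norm_sq j0 \<Phi> \<Psi> s f \<le> ennreal (2 powr (2 * real j * s) * (real K * a\<^sup>2))"
    unfolding besov_norm_sq_def
  proof (intro sup_least SUP_least)
    show "ennreal (2 powr (2 * real j0 * s) * (\<Sum>k<2 ^ j0. (inner01 f (\<Phi> j0 k))\<^sup>2)) \<le> ennreal (2 powr (2 * real j * s) * (real K * a\<^sup>2))"
      by (simp add: Phi0)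
  next
    fix i assume i: "i \<in> {j0..}"
    show "ennreal (2 powr (2 * real i * s) * (\<Sum>k<2 ^ i. (inner01 f (\<Psi> i k))\<^sup>2)) \<le> ennreal (2 powr (2 * real j * s) * (real K * a\<^sup>2))"
    proof (cases "i = j")
      case True
      then show ?thesis using total by simp
    next
      case False
      then show ?thesis using Psi_other i by simp
    qed
  qed
  also have "\<dots> < ennreal (L\<^sup>2)"
  proof (rule ennreal_lessI[OF _ small])
    have "0 \<le> 2 powr (2 * real j * s) * (real K * a\<^sup>2)" by simp
    then show "0 < L\<^sup>2" using small by (rule le_less_trans)
  qed
  finally have "f \<in> besov_ball j0 \<Phi> \<Psi> s L" using fL2 by (simp add: besov_ball_def)
  then show ?thesis unfolding f_def[abs_def] by (simp add: mult.assoc)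
qed

lemma nn_integral_wavelet_sq:
  assumes cdv: "cdv_basis N j0 \<Phi> \<Psi>" and "k < 2 ^ j" "j0 \<le> j"
  shows "1 \<le> (\<integral>\<^sup>+x. ennreal ((\<Psi> j k x)\<^sup>2) * indicator {0..1} x \<partial>lborel)"
proof -
  have i: "integrable lborel (\<lambda>x. indicator {0..1} x *\<^sub>R (\<Psi> j k x)\<^sup>2)"
    using cdv_basis_L2(1)[OF assms] by (simp add: L2_01_def set_integrable_def)
  have one: "inner01 (\<Psi> j k) (\<Psi> j k) = 1"
    using assms unfolding cdv_basis_def by simp
  have "(\<integral>\<^sup>+x. ennreal ((\<Psi> j k x)\<^sup>2) * indicator {0..1} x \<partial>lborel)
     = (\<integral>\<^sup>+x. ennreal (indicator {0..1} x *\<^sub>R (\<Psi> j k x)\<^sup>2) \<partial>lborel)"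
    by (intro nn_integral_cong) (auto simp: indicator_def)
  also have "\<dots> = ennreal (\<integral>x. indicator {0..1} x *\<^sub>R (\<Psi> j k x)\<^sup>2 \<partial>lborel)"
    using i by (intro nn_integral_eq_integral) auto
  also have "\<dots> = 1"
    using one by (simp add: inner01_def set_lebesgue_integral_def power2_eq_square)
  finally show ?thesis by simp
qed

section \<open>The lower bound\<close>

text \<open>The lower bound \<open>1 / n\<close> holds because both the logarithm and the sum are at
  most \<open>m\<close>; it keeps the resolution level polynomial in \<open>n\<close>. The last two
  bounds are the two sides of the minimum: the first limits the signal-to-noise ratio of a machine,
  the second the total information.\<close>

lemma solves_deltaD:
  assumes "solves_delta s n m B \<delta>" and n: "2 \<le> n" and m: "log 2 (real n) \<le> real m" and B: "\<forall>i<m. 0 < B i"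
  defines "\<Sigma> \<equiv> \<Sum>i<m. min (log 2 (real n) * \<delta> powr (1 / (1 + 2 * s)) * B i) 1"
  shows "0 < \<delta>" "1 / real n \<le> \<delta>" "0 < \<Sigma>"
    "\<delta> * real n \<le> real m" "\<delta> * real n * \<Sigma> \<le> real m"
proof -
  have lg: "1 \<le> log 2 (real n)" using n by (simp add: le_log_iff)
  then have m0: "0 < m" using m by (cases m) auto
  show d: "0 < \<delta>" using assms(1) by (simp add: solves_delta_def)
  have eq: "\<delta> = min (real m / (real n * log 2 (real n))) (real m / (real n * \<Sigma>))"
    using assms(1) by (simp add: solves_delta_def \<Sigma>_def)
  show S0: "0 < \<Sigma>"
    unfolding \<Sigma>_def using m0 B lg d by (intro sum_pos) auto
  have Sm: "\<Sigma> \<le> real m"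
  proof -
    have "\<Sigma> \<le> (\<Sum>i<m. 1)" unfolding \<Sigma>_def by (intro sum_mono) simp
    then show ?thesis by simp
  qed
  have n0: "0 < real n" using n by simp
  have "1 / real n \<le> real m / (real n * log 2 (real n))" using n0 lg m by (simp add: field_simps)
  moreover have "1 / real n \<le> real m / (real n * \<Sigma>)" using n0 S0 Sm by (simp add: field_simps)
  ultimately show "1 / real n \<le> \<delta>" by (subst eq) simp
  have "\<delta> \<le> real m / (real n * log 2 (real n))" by (subst eq) simp
  then have "\<delta> * (real n * log 2 (real n)) \<le> real m" using n0 lg by (simp add: pos_le_divide_eq)
  moreover have "\<delta> * (real n * 1) \<le> \<delta> * (real n * log 2 (real n))" using n0 lg d by (intro mult_left_mono) auto
  ultimately show "\<delta> * real n \<le> real m" by simp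
  have "\<delta> \<le> real m / (real n * \<Sigma>)" by (subst eq) simp
  then show "\<delta> * real n * \<Sigma> \<le> real m" using n0 S0 by (simp add: pos_le_divide_eq mult.assoc)
qed

lemma powr_power2: "0 < L \<Longrightarrow> (L\<^sup>2) powr \<theta> = L powr (2 * \<theta>)" for L :: real
proof -
  assume L: "0 < L"
  have "L powr (2 * \<theta>) = (L powr 2) powr \<theta>" by (simp only: powr_powr)
  also have "L powr 2 = L\<^sup>2" using L by simp
  finally show ?thesis by simp
qed

text \<open>The argument for a fixed \<open>n\<close> with explicit constants. \<open>L\<close>
  enters the conditions on the constants only through its lower bound \<open>L0\<close> in
  \<open>D\<close>, which gives uniformity in \<open>L\<close>; \<open>tail\<close> says that
  atypical designs are negligible.\<close>

lemma minimax_lower_bound: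
  fixes s \<sigma> L0 L \<delta> C D \<epsilon> :: real and N j0 n m j :: nat and B :: "nat \<Rightarrow> real"
  defines "\<theta> \<equiv> 1 / (1 + 2 * s)"
  assumes pos: "0 < s" "0 < \<sigma>" "0 < L0" "L0 \<le> L" and cdv: "cdv_basis N j0 \<Phi> \<Psi>"
    and C: "1 \<le> C" and N: "1 \<le> N"
    and meas: "\<And>j k. 4 * N \<le> 2 ^ j \<Longrightarrow> k < 2 ^ j div (4 * N) \<Longrightarrow> \<Psi> j (wavelet_index N k) \<in> borel_measurable borel"
    and supp: "\<And>j k x. 4 * N \<le> 2 ^ j \<Longrightarrow> k < 2 ^ j div (4 * N) \<Longrightarrow> x \<notin> wavelet_cell N j k \<Longrightarrow> \<Psi> j (wavelet_index N k) x = 0"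
    and bnd: "\<And>j k x. 4 * N \<le> 2 ^ j \<Longrightarrow> k < 2 ^ j div (4 * N) \<Longrightarrow> (\<Psi> j (wavelet_index N k) x)\<^sup>2 \<le> C * 2 ^ j"
    and D: "1 \<le> D" "48 * real N \<le> D * L0 powr (2 * \<theta>)"
    and eps: "0 < \<epsilon>" "\<epsilon> \<le> 1 / 2" "\<epsilon> * (4096 * real N * C * D) \<le> \<sigma>\<^sup>2"
    and n: "2 \<le> n" "m dvd n" "log 2 (real n) \<le> real m" and B: "\<forall>i<m. 0 < B i"
    and delta: "solves_delta s n m B \<delta>" "\<delta> \<le> 1"
    and j: "j0 \<le> j" "4 * N \<le> 2 ^ j" "2 ^ j \<le> (L\<^sup>2 / \<delta>) powr \<theta>" "(L\<^sup>2 / \<delta>) powr \<theta> < 2 ^ (j + 1)"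
    and tail: "8 * real m * real (2 ^ j div (4 * N)) * exp (- 2 * real (n div m) * (2 * real N / 2 ^ j)) \<le> 1"
  shows "ennreal (\<epsilon> / (64 * real N) * L powr (2 * \<theta>) * \<delta> powr (1 - \<theta>))
     \<le> dist_minimax_risk m (n div m) \<sigma> B (besov_ball j0 \<Phi> \<Psi> s L)"
proof -
  define K q where "K = 2 ^ j div (4 * N)" and "q = n div m"
  \<comment> \<open>\<open>A\<close> is chosen to make the condition \<open>snr\<close> of
    \<open>random_design\<close> an equality: the factor \<open>2 ^ j\<close> of the sup bound
    cancels against the size of a cell.\<close>
  define a A where "a = sqrt (\<epsilon> * \<delta>)" and "A = 8 * real N * C * real q * \<epsilon> * \<delta> / \<sigma>\<^sup>2"
  define \<Sigma> where "\<Sigma> = (\<Sum>i<m. min (log 2 (real n) * \<delta> powr \<theta> * B i) 1)"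
  define x where "x = (L\<^sup>2 / \<delta>) powr \<theta>"
  note sd = solves_deltaD[OF delta(1) n(1,3) B, folded \<theta>_def, folded \<Sigma>_def]
  have L: "0 < L" using pos by linarith
  have th: "0 < \<theta>" "\<theta> < 1" using pos by (auto simp: \<theta>_def)
  have lg: "1 \<le> log 2 (real n)" using n by (simp add: le_log_iff)
  then have m0: "0 < m" using n(3) by (cases m) auto
  have qm: "real q * real m = real n" unfolding q_def using n(2) by (simp flip: of_nat_mult)
  have q0: "0 < real q" using qm m0 n(1) by (metis mult_eq_0_iff of_nat_0_less_iff of_nat_eq_0_iff zero_less_iff_neq_zero not_numeral_le_zero)
  have qd: "real q * \<delta> \<le> 1"
  proof -
    have "real q * \<delta> * real m \<le> 1 * real m" using sd(4) qm by (simp add: mult_ac)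
    then show ?thesis using m0 by (simp only: mult_le_cancel_right_pos of_nat_0_less_iff)
  qed
  have qdS: "real q * \<delta> * \<Sigma> \<le> 1"
  proof -
    have "real q * \<delta> * \<Sigma> * real m = \<delta> * (real q * real m) * \<Sigma>" by simp
    also have "\<dots> \<le> 1 * real m" using sd(5) by (simp add: qm)
    finally show ?thesis using m0 by (simp only: mult_le_cancel_right_pos of_nat_0_less_iff)
  qed
  have NC: "1 \<le> real N * C" using mult_mono[of 1 "real N" 1 C] N C by simp
  have NCD: "\<epsilon> * (real N * C * D) \<le> \<sigma>\<^sup>2 / 4096" using eps(3) by (simp add: mult_ac)
  have eNC: "\<epsilon> * (real N * C) \<le> \<sigma>\<^sup>2 / 4096"
  proof -
    have "\<epsilon> * (real N * C * 1) \<le> \<epsilon> * (real N * C * D)"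
      using eps(1) NC D(1) by (intro mult_left_mono) auto
    then show ?thesis using NCD by simp
  qed
  have s2: "0 < \<sigma>\<^sup>2" using pos by simp
  have eNC0: "0 \<le> \<epsilon> * (real N * C)" using eps(1) NC by simp
  have A0: "0 < A" unfolding A_def using N C q0 eps sd(1) s2 by (intro divide_pos_pos mult_pos_pos) auto
  have As: "A * \<sigma>\<^sup>2 = 8 * (\<epsilon> * (real N * C)) * (real q * \<delta>)" unfolding A_def using s2 by simp
  have A8: "A \<le> 1 / 8"
  proof -
    have "A * \<sigma>\<^sup>2 \<le> 8 * (\<sigma>\<^sup>2 / 4096) * 1"
      unfolding As using eNC qd q0 sd(1) eps NC by (intro mult_mono) auto
    also have "\<dots> \<le> 1 / 8 * \<sigma>\<^sup>2" by simp
    finally show ?thesis using s2 by (simp only: mult_le_cancel_right_pos)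
  qed
  have a2: "a\<^sup>2 = \<epsilon> * \<delta>" unfolding a_def using eps sd(1) by simp
  have K1: "1 \<le> K" unfolding K_def using j(2) N by (simp add: Suc_le_eq div_greater_zero_iff)
  have Kx: "x \<le> 16 * real N * real K"
  proof -
    have "2 ^ j < 4 * N * (K + 1)" unfolding K_def using N
      by (metis Suc_eq_plus1 dividend_less_times_div mult.commute mult_Suc_right add.commute mult_pos_pos zero_less_numeral Suc_le_eq One_nat_def)
    also have "\<dots> \<le> 4 * N * (K + K)" using K1 by (intro mult_le_mono2) simp
    also have "4 * N * (K + K) = 8 * N * K" by (simp add: algebra_simps)
    finally have "2 ^ j \<le> 8 * N * K" by (rule less_imp_le)
    then have "real (2 ^ j) \<le> real (8 * N * K)" by (rule of_nat_mono)
    then show ?thesis using j(4) by (simp add: x_def)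
  qed
  have xd: "x * \<delta> powr \<theta> = L powr (2 * \<theta>)"
    unfolding x_def using L sd(1) by (simp add: powr_divide powr_power2)
  interpret rd: random_design \<sigma> a "C * 2 ^ j" "2 * real N / 2 ^ j" A q K "\<lambda>k. \<Psi> j (wavelet_index N k)" "wavelet_cell N j"
  proof
    show "a\<^sup>2 * (C * 2 ^ j) * (4 * real q * (2 * real N / 2 ^ j)) \<le> \<sigma>\<^sup>2 * A"
      unfolding a2 A_def using s2 by (simp add: mult_ac)
    show "wavelet_cell N j k \<in> sets borel" for k by (simp add: wavelet_cell_def)
    show "t \<notin> wavelet_cell N j k'" if "k \<noteq> k'" "t \<in> wavelet_cell N j k" for k k' t
      by (rule wavelet_cell_disjoint[OF N that])
    show "emeasure unif (wavelet_cell N j k) \<le> ennreal (2 * real N / 2 ^ j)" for k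
      by (rule emeasure_wavelet_cell[OF N])
  qed (use pos A0 A8 meas supp bnd j(2) C in \<open>auto simp: K_def\<close>)
  \<comment> \<open>Since \<open>2 ^ j\<close> is at most \<open>x\<close> and
    \<open>x powr (1 + 2 * s)\<close> is \<open>L^2 / \<delta>\<close>, the squared norm is at most
    \<open>\<epsilon> * L^2\<close>; \<open>\<epsilon> < 1\<close> puts the functions strictly
    inside the ball.\<close>
  have small: "2 powr (2 * real j * s) * (real K * a\<^sup>2) < L\<^sup>2"
  proof -
    have Kj: "real K \<le> 2 ^ j"
      unfolding K_def by (metis div_le_dividend of_nat_le_iff of_nat_numeral of_nat_power)
    have "2 powr (2 * real j * s) * (real K * a\<^sup>2) \<le> 2 powr (2 * real j * s) * (2 ^ j * a\<^sup>2)"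
      by (intro mult_left_mono mult_right_mono Kj) auto
    also have "\<dots> = (2 ^ j) powr (1 + 2 * s) * a\<^sup>2"
      by (simp add: powr_add powr_powr powr_realpow[symmetric] mult_ac)
    also have "\<dots> \<le> x powr (1 + 2 * s) * a\<^sup>2"
      using j(3) pos by (intro mult_right_mono powr_mono2) (auto simp: x_def)
    also have "x powr (1 + 2 * s) = L\<^sup>2 / \<delta>"
      unfolding x_def using pos sd(1) L by (simp add: powr_powr \<theta>_def)
    also have "L\<^sup>2 / \<delta> * a\<^sup>2 = \<epsilon> * L\<^sup>2" unfolding a2 using sd(1) by simp
    also have "\<dots> < L\<^sup>2" using eps L by simp
    finally show ?thesis .
  qed
  have ball: "rd.fn X \<in> besov_ball j0 \<Phi> \<Psi> s L" for X
    unfolding rd.fn_def[abs_def]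
    by (rule sign_combination_in_besov_ball[OF cdv N j(1,2) _ small]) (simp add: K_def)
  have info: "(\<Sum>i<m. 2 * (real K)\<^sup>2 * exp (- 2 * real q * (2 * real N / 2 ^ j)) + 32 * A * min (real K) (2 / real n + 3 * ln (real n) * B i)) \<le> real K / 2"
  proof -
    \<comment> \<open>\<open>K\<close> is at least \<open>x / (16 * N)\<close>, and
      \<open>x * \<delta> powr \<theta>\<close> is \<open>L powr (2 * \<theta>)\<close>. The
      constant \<open>D\<close> raises \<open>K * \<delta> powr \<theta>\<close> above 3, the factor
      in front of \<open>ln n * B i\<close> in the description length.\<close>
    have KD: "3 \<le> real K * D * \<delta> powr \<theta>"
    proof -
      have "48 * real N \<le> D * L0 powr (2 * \<theta>)" by (rule D(2))
      also have "\<dots> \<le> D * L powr (2 * \<theta>)"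
        using pos D th by (intro mult_left_mono powr_mono2) auto
      also have "\<dots> = D * (x * \<delta> powr \<theta>)" by (simp only: xd)
      also have "\<dots> \<le> D * (16 * real N * real K * \<delta> powr \<theta>)"
        using D by (intro mult_left_mono mult_right_mono Kx) auto
      finally have "16 * real N * 3 \<le> 16 * real N * (real K * D * \<delta> powr \<theta>)" by (simp add: mult_ac)
      moreover have "0 < 16 * real N" using N by simp
      ultimately show ?thesis using mult_le_cancel_left_pos by blast
    qed
    have lnlog: "ln (real n) \<le> log 2 (real n)"
      using n(1) ln_le_minus_one[of "2::real"] by (simp add: log_def pos_le_divide_eq mult_left_le)
    \<comment> \<open>Both regimes of the truncation in the equation for \<delta>_n: below 1,
      \<open>KD\<close> converts bits into cells; above 1, the number \<open>K\<close> of cells is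
      the bound and \<open>D >= 1\<close> suffices.\<close>
    have each: "min (real K) (2 / real n + 3 * ln (real n) * B i) \<le> 2 / real n + real K * D * min (log 2 (real n) * \<delta> powr \<theta> * B i) 1" if i: "i < m" for i
    proof (cases "log 2 (real n) * \<delta> powr \<theta> * B i \<le> 1")
      case True
      have "3 * ln (real n) * B i \<le> (real K * D * \<delta> powr \<theta>) * log 2 (real n) * B i"
        using KD lnlog B i n(1) by (intro mult_right_mono mult_mono) (auto simp: less_imp_le)
      also have "\<dots> = real K * D * min (log 2 (real n) * \<delta> powr \<theta> * B i) 1" using True by (simp add: mult_ac)
      finally show ?thesis by linarith
    next
      case False
      have "real K * 1 \<le> real K * D" using D by (intro mult_left_mono) auto
      moreover have "0 \<le> 2 / real n" by simp
      moreover have "real K * D * min (log 2 (real n) * \<delta> powr \<theta> * B i) 1 = real K * D" using False by simp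
      ultimately show ?thesis by linarith
    qed
    have "(\<Sum>i<m. 2 * (real K)\<^sup>2 * exp (- 2 * real q * (2 * real N / 2 ^ j)) + 32 * A * min (real K) (2 / real n + 3 * ln (real n) * B i))
      \<le> (\<Sum>i<m. 2 * (real K)\<^sup>2 * exp (- 2 * real q * (2 * real N / 2 ^ j)) + 32 * A * (2 / real n + real K * D * min (log 2 (real n) * \<delta> powr \<theta> * B i) 1))"
      using each A0 by (intro sum_mono add_left_mono mult_left_mono) auto
    also have "\<dots> = real m * (2 * (real K)\<^sup>2 * exp (- 2 * real q * (2 * real N / 2 ^ j))) + 32 * A * (real m * (2 / real n) + real K * D * \<Sigma>)"
      by (simp only: sum.distrib sum_distrib_left[symmetric] sum_constant card_lessThan \<Sigma>_def) (simp only: ac_simps)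
    also have "real m * (2 * (real K)\<^sup>2 * exp (- 2 * real q * (2 * real N / 2 ^ j))) \<le> real K / 4"
    proof -
      have "real K / 4 * (8 * real m * real K * exp (- 2 * real q * (2 * real N / 2 ^ j))) \<le> real K / 4 * 1"
        using tail unfolding K_def[symmetric] q_def[symmetric] by (intro mult_left_mono) auto
      then show ?thesis by (simp add: power2_eq_square mult_ac)
    qed
    \<comment> \<open>This fixes 4096 in the condition on \<open>\<epsilon>\<close>. The costs
      \<open>2 / n\<close> of the machines sum to \<open>2 / q\<close>, which cancels the factor
      \<open>q\<close> in \<open>A\<close> and leaves 512/4096 = 1/8; the budget part gives 256/4096
      = 1/16 of \<open>K\<close>. As \<open>K >= 1\<close>, both fit into
      \<open>K / 4\<close>.\<close>
    also have "32 * A * (real m * (2 / real n) + real K * D * \<Sigma>) \<le> real K / 4"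
    proof -
      have n0: "0 < real n" using n(1) by simp
      have "\<sigma>\<^sup>2 * (32 * A * (real m * (2 / real n))) = 64 * (A * \<sigma>\<^sup>2) * real m / real n" by simp
      also have "\<dots> = 512 * (\<epsilon> * (real N * C)) * \<delta>"
        unfolding As using qm n0 by (simp add: field_simps)
      also have "\<dots> \<le> 512 * (\<sigma>\<^sup>2 / 4096) * 1"
        using eNC delta(2) sd(1) s2 eNC0 by (intro mult_mono) auto
      also have "\<dots> = \<sigma>\<^sup>2 * (1 / 8)" by simp
      finally have 1: "32 * A * (real m * (2 / real n)) \<le> 1 / 8"
        using s2 by (simp only: mult_le_cancel_left_pos)
      have "\<sigma>\<^sup>2 * (32 * A * (real K * D * \<Sigma>)) = 32 * (A * \<sigma>\<^sup>2) * (real K * D * \<Sigma>)" by simp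
      also have "\<dots> = 256 * (\<epsilon> * (real N * C * D)) * real K * (real q * \<delta> * \<Sigma>)"
        unfolding As by simp
      also have "\<dots> \<le> 256 * (\<sigma>\<^sup>2 / 4096) * real K * 1"
        using NCD qdS s2 q0 sd(1,3) by (intro mult_mono mult_right_mono mult_left_mono) auto
      also have "\<dots> = \<sigma>\<^sup>2 * (real K / 16)" by simp
      finally have 2: "32 * A * (real K * D * \<Sigma>) \<le> real K / 16"
        using s2 by (simp only: mult_le_cancel_left_pos)
      have "1 \<le> real K" using K1 by simp
      then show ?thesis unfolding distrib_left using 1 2 by linarith
    qed
    finally show ?thesis by simp
  qed
  show ?thesis
    unfolding dist_minimax_risk_def
  proof (rule INF_greatest)
    fix fhat assume "fhat \<in> dist_estimators m (n div m) \<sigma> B (besov_ball j0 \<Phi> \<Psi> s L)"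
    then obtain Y :: "nat \<Rightarrow> (nat \<Rightarrow> real \<times> real) \<Rightarrow> bool list" and g :: "(nat \<Rightarrow> bool list) \<Rightarrow> real \<Rightarrow> real"
      where Y: "\<forall>i<m. Y i \<in> measurable (data_space q) (count_space UNIV)"
      and len: "\<forall>f\<in>besov_ball j0 \<Phi> \<Psi> s L. \<forall>i<m.
         (\<integral>\<^sup>+x. ennreal (real (length (Y i (x i)))) \<partial>data_law m q \<sigma> f) \<le> ennreal (B i)"
      and g: "\<forall>y. g y \<in> L2_01" and fhat: "fhat = (\<lambda>x. g (\<lambda>i\<in>{..<m}. Y i (x i)))"
      unfolding dist_estimators_def q_def by blast
    define S where "S = (SUP f\<in>besov_ball j0 \<Phi> \<Psi> s L. \<integral>\<^sup>+x. sq_dist01 (fhat x) f \<partial>data_law m q \<sigma> f)"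
    have "ennreal (a\<^sup>2 * real K / 4) \<le> S"
    proof (rule rd.risk_bound[where m = m and Y = Y and g = g and n = "real n" and B = B])
      show "g y \<in> borel_measurable borel" for y using g by (intro L2_01_measurable) simp
      show "(\<integral>\<^sup>+x. ennreal (real (length (Y i (x i)))) \<partial>data_law m q \<sigma> (rd.fn X)) \<le> ennreal (B i)" if "i < m" for X i
        using len ball that by blast
      show "1 \<le> (\<integral>\<^sup>+x. ennreal ((\<Psi> j (wavelet_index N k) x)\<^sup>2) * indicator {0..1} x \<partial>lborel)" if "k < K" for k
        using wavelet_index_bounds(3)[OF N j(2)] that j(1)
        by (intro nn_integral_wavelet_sq[OF cdv]) (auto simp: K_def)
      show "(\<integral>\<^sup>+x. sq_dist01 (g (messages m Y x)) (rd.fn X) \<partial>data_law m q \<sigma> (rd.fn X)) \<le> S" for X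
        unfolding S_def fhat messages_def by (rule SUP_upper[OF ball])
    qed (use n B Y info in \<open>auto simp: less_imp_le\<close>)
    moreover have "\<epsilon> / (64 * real N) * L powr (2 * \<theta>) * \<delta> powr (1 - \<theta>) \<le> a\<^sup>2 * real K / 4"
    proof -
      have "\<epsilon> / (64 * real N) * L powr (2 * \<theta>) * \<delta> powr (1 - \<theta>) = \<epsilon> / (64 * real N) * (x * (\<delta> powr \<theta> * \<delta> powr (1 - \<theta>)))"
        unfolding xd[symmetric] by simp
      also have "\<delta> powr \<theta> * \<delta> powr (1 - \<theta>) = \<delta>" using sd(1) by (simp add: powr_add[symmetric])
      also have "\<epsilon> / (64 * real N) * (x * \<delta>) \<le> \<epsilon> / (64 * real N) * (16 * real N * real K * \<delta>)"
        using eps sd(1) by (intro mult_left_mono mult_right_mono Kx) auto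
      also have "\<dots> = a\<^sup>2 * real K / 4" unfolding a2 using N by simp
      finally show ?thesis .
    qed
    ultimately have "ennreal (\<epsilon> / (64 * real N) * L powr (2 * \<theta>) * \<delta> powr (1 - \<theta>)) \<le> S"
      using ennreal_leI order_trans by blast
    then show "ennreal (\<epsilon> / (64 * real N) * L powr (2 * \<theta>) * \<delta> powr (1 - \<theta>))
      \<le> (SUP f\<in>besov_ball j0 \<Phi> \<Psi> s L. \<integral>\<^sup>+x. sq_dist01 (fhat x) f \<partial>data_law m (n div m) \<sigma> f)"
      by (simp add: S_def q_def)
  qed
qed

lemma ex_power2_interval:
  assumes "1 \<le> (x::real)"
  obtains j :: nat where "2 ^ j \<le> x" "x < 2 ^ (j + 1)"
proof -
  define j where "j = nat \<lfloor>log 2 x\<rfloor>"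
  have lx: "0 \<le> log 2 x" using assms by simp
  have j: "real j \<le> log 2 x" "log 2 x < real (j + 1)" unfolding j_def using lx by (simp_all add: of_nat_floor) linarith
  have "2 powr real j \<le> x" using j(1) assms by (simp add: le_log_iff)
  moreover have "x < 2 powr real (j + 1)" using j(2) assms by (simp add: log_less_iff)
  ultimately show thesis using that[of j] by (simp only: powr_realpow[of 2] zero_less_numeral)
qed

text \<open>The constant may depend on \<open>s\<close>, \<open>\<sigma>\<close>, \<open>L0\<close>
  and the basis, but is chosen before \<open>L\<close>, the budgets and the sequence
  \<open>m\<close>; only the threshold in \<open>n\<close> depends on these. The set
  \<open>S\<close> allows for sample sizes restricted by divisibility.\<close>

theorem theorem2p1:
  fixes s \<sigma> L0 :: real and N j0 :: nat and \<Phi> \<Psi> :: "nat \<Rightarrow> nat \<Rightarrow> real \<Rightarrow> real"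
  assumes "0 < s" and "0 < \<sigma>" and "0 < L0" and "s < real N" and "cdv_basis N j0 \<Phi> \<Psi>"
  shows "\<exists>c>0. \<forall>L\<ge>L0. \<forall>(S :: nat set) (m :: nat \<Rightarrow> nat) (B :: nat \<Rightarrow> nat \<Rightarrow> real) (\<delta> :: nat \<Rightarrow> real).
    (\<forall>n\<in>S. 2 \<le> n \<and> m n dvd n \<and> log 2 (real n) \<le> real (m n) \<and>
            (\<forall>i<m n. 0 < B n i) \<and> solves_delta s n (m n) (B n) (\<delta> n)) \<longrightarrow>
    (\<lambda>n. real (m n)) \<in> O[inf at_top (principal S)](\<lambda>n. real n powr (2 * s / (1 + 2 * s)) / (ln (real n))\<^sup>2) \<longrightarrow>
    (\<forall>\<^sub>F n in inf at_top (principal S).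
       ennreal (c * L powr (2 / (1 + 2 * s)) * \<delta> n powr (2 * s / (1 + 2 * s)))
         \<le> dist_minimax_risk (m n) (n div m n) \<sigma> (B n) (besov_ball j0 \<Phi> \<Psi> s L))"
proof -
  define \<theta> where "\<theta> = 1 / (1 + 2 * s)"
  have th: "0 < \<theta>" "\<theta> < 1" using assms(1) by (auto simp: \<theta>_def)
  have th1: "2 * s / (1 + 2 * s) = 1 - \<theta>" "2 / (1 + 2 * s) = 2 * \<theta>"
    using assms(1) by (simp_all add: \<theta>_def field_simps)
  obtain C where C: "1 \<le> C" and N: "1 \<le> N"
    and cells: "\<And>j k. 4 * N \<le> 2 ^ j \<Longrightarrow> k < 2 ^ j div (4 * N) \<Longrightarrow> \<Psi> j (wavelet_index N k) \<in> borel_measurable borel"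
    "\<And>j k x. 4 * N \<le> 2 ^ j \<Longrightarrow> k < 2 ^ j div (4 * N) \<Longrightarrow> x \<notin> wavelet_cell N j k \<Longrightarrow> \<Psi> j (wavelet_index N k) x = 0"
    "\<And>j k x. 4 * N \<le> 2 ^ j \<Longrightarrow> k < 2 ^ j div (4 * N) \<Longrightarrow> (\<Psi> j (wavelet_index N k) x)\<^sup>2 \<le> C * 2 ^ j"
    using cdv_basis_cells[OF assms(5)] by blast
  define D where "D = max 1 (48 * real N / L0 powr (2 * \<theta>))"
  define \<epsilon> where "\<epsilon> = min (1 / 2) (\<sigma>\<^sup>2 / (4096 * real N * C * D))"
  have D: "1 \<le> D" "48 * real N \<le> D * L0 powr (2 * \<theta>)"
  proof -
    have "48 * real N / L0 powr (2 * \<theta>) \<le> D" by (simp add: D_def)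
    then show "48 * real N \<le> D * L0 powr (2 * \<theta>)" using assms(3) by (simp add: pos_divide_le_eq)
  qed (simp add: D_def)
  have NCD: "0 < 4096 * real N * C * D" using N C D by simp
  have eps: "0 < \<epsilon>" "\<epsilon> \<le> 1 / 2" "\<epsilon> * (4096 * real N * C * D) \<le> \<sigma>\<^sup>2"
  proof -
    show "0 < \<epsilon>" using NCD assms(2) by (simp add: \<epsilon>_def)
    have "\<epsilon> \<le> \<sigma>\<^sup>2 / (4096 * real N * C * D)" by (simp add: \<epsilon>_def)
    then show "\<epsilon> * (4096 * real N * C * D) \<le> \<sigma>\<^sup>2" using NCD by (simp only: pos_le_divide_eq)
  qed (simp add: \<epsilon>_def)
  show ?thesis
  proof (intro exI[of _ "\<epsilon> / (64 * real N)"] conjI allI impI)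
    show "0 < \<epsilon> / (64 * real N)" using eps N by simp
  next
    fix L :: real and S :: "nat set" and m :: "nat \<Rightarrow> nat" and B :: "nat \<Rightarrow> nat \<Rightarrow> real" and \<delta> :: "nat \<Rightarrow> real"
    assume L: "L0 \<le> L"
      and hyp: "\<forall>n\<in>S. 2 \<le> n \<and> m n dvd n \<and> log 2 (real n) \<le> real (m n) \<and>
            (\<forall>i<m n. 0 < B n i) \<and> solves_delta s n (m n) (B n) (\<delta> n)"
      and bigo: "(\<lambda>n. real (m n)) \<in> O[inf at_top (principal S)](\<lambda>n. real n powr (2 * s / (1 + 2 * s)) / (ln (real n))\<^sup>2)"
    have L0: "0 < L" using L assms(3) by linarith
    from landau_o.bigE[OF bigo] obtain c0 where c0: "0 < c0"
      and O: "\<forall>\<^sub>F n in inf at_top (principal S). norm (real (m n)) \<le> c0 * norm (real n powr (2 * s / (1 + 2 * s)) / (ln (real n))\<^sup>2)"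
      by blast
    \<comment> \<open>\<open>x >= X0\<close> forces the level to satisfy
      \<open>2 ^ j > max (2 ^ j0) (4 * N)\<close>, because \<open>x < 2 ^ (j + 1)\<close>;
      \<open>d0\<close> is the value of \<delta>_n below which this happens.\<close>
    define X0 where "X0 = 2 * max (2 ^ j0) (4 * real N)"
    define d0 where "d0 = L\<^sup>2 / X0 powr (1 / \<theta>)"
    have X0: "1 \<le> X0" unfolding X0_def using N by simp
    have d0: "0 < d0" unfolding d0_def using L0 X0 by simp
    \<comment> \<open>The growth condition on \<open>m\<close> together with
      \<open>\<delta> n * n <= m n\<close> will give
      \<open>\<delta> n <= c0 * n powr (- \<theta>)\<close>, so \<delta>_n tends to 0 and the level
      passes every fixed bound.\<close>
    have lim: "((\<lambda>n. c0 * real n powr (- \<theta>)) \<longlongrightarrow> c0 * 0) sequentially"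
      using th by (intro tendsto_mult_left tendsto_neg_powr filterlim_real_sequentially) auto
    have e1: "\<forall>\<^sub>F n in sequentially. c0 * real n powr (- \<theta>) < min 1 d0"
      using order_tendstoD(2)[OF lim, of "min 1 d0"] d0 by simp
    have e2: "\<forall>\<^sub>F n in sequentially. max 1 (c0 * L powr (2 * \<theta>) / real N) \<le> ln (real n)"
      using filterlim_compose[OF ln_at_top filterlim_real_sequentially]
      unfolding filterlim_at_top by blast
    have e3: "\<forall>\<^sub>F n in sequentially. 8 * L powr (2 * \<theta>) \<le> real n"
      using filterlim_real_sequentially unfolding filterlim_at_top by blast
    have e4: "\<forall>\<^sub>F n in inf at_top (principal S). n \<in> S"
      by (simp add: eventually_inf_principal)
    have lift: "\<forall>\<^sub>F n in inf at_top (principal S). P n" if "\<forall>\<^sub>F n in sequentially. P n" for P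
      using that by (auto simp: eventually_inf_principal elim: eventually_mono)
    show "\<forall>\<^sub>F n in inf at_top (principal S).
       ennreal (\<epsilon> / (64 * real N) * L powr (2 / (1 + 2 * s)) * \<delta> n powr (2 * s / (1 + 2 * s)))
         \<le> dist_minimax_risk (m n) (n div m n) \<sigma> (B n) (besov_ball j0 \<Phi> \<Psi> s L)"
      using O lift[OF e1] lift[OF e2] lift[OF e3] e4
    proof eventually_elim
      case (elim n)
      note h = hyp[rule_format, OF elim(5)]
      have n2: "2 \<le> n" and md: "m n dvd n" and ml: "log 2 (real n) \<le> real (m n)"
        and Bp: "\<forall>i<m n. 0 < B n i" and sol: "solves_delta s n (m n) (B n) (\<delta> n)"
        using h by auto
      note sd = solves_deltaD[OF sol n2 ml Bp]
      have n0: "0 < real n" using n2 by simp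
      define l where "l = ln (real n)"
      have l1: "1 \<le> l" "c0 * L powr (2 * \<theta>) / real N \<le> l" using elim(3) by (auto simp: l_def)
      have mb: "real (m n) \<le> c0 * (real n powr (1 - \<theta>) / l\<^sup>2)"
        using elim(1) by (simp add: th1 l_def)
      have "1 \<le> log 2 (real n)" using n2 by (simp add: le_log_iff)
      then have m0: "0 < m n" using ml by (cases "m n") auto
      have mn: "m n \<le> n" using md n2 by (intro dvd_imp_le) auto
      have dle: "\<delta> n \<le> c0 * real n powr (- \<theta>)"
      proof -
        have "real (m n) \<le> c0 * (real n powr (1 - \<theta>) / 1)"
          using l1 c0 by (intro order_trans[OF mb] mult_left_mono divide_left_mono) (auto simp: one_le_power)
        also have "real n powr (1 - \<theta>) = real n * real n powr (- \<theta>)"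
          using n0 powr_add[of "real n" 1 "- \<theta>"] by simp
        finally have "\<delta> n * real n \<le> (c0 * real n powr (- \<theta>)) * real n" using sd(4) by (simp add: mult_ac)
        then show ?thesis using n0 by (simp only: mult_le_cancel_right_pos)
      qed
      then have d1: "\<delta> n \<le> 1" "\<delta> n \<le> d0" using elim(2) by auto
      define x where "x = (L\<^sup>2 / \<delta> n) powr \<theta>"
      have xX: "X0 \<le> x"
      proof -
        have "X0 powr (1 / \<theta>) \<le> L\<^sup>2 / \<delta> n"
          using d1(2) sd(1) X0 unfolding d0_def by (simp add: field_simps)
        then have "(X0 powr (1 / \<theta>)) powr \<theta> \<le> x"
          unfolding x_def using th by (intro powr_mono2) auto
        then show ?thesis using X0 th by (simp add: powr_powr)
      qed
      then have "1 \<le> x" using X0 by linarith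
      then obtain j where j: "2 ^ j \<le> x" "x < 2 ^ (j + 1)" using ex_power2_interval by blast
      have jj: "max (2 ^ j0) (4 * real N) < 2 ^ j"
      proof -
        have X: "2 * 2 ^ j0 \<le> X0" "2 * (4 * real N) \<le> X0" by (simp_all add: X0_def)
        have j2: "x < 2 * 2 ^ j" using j(2) by simp
        have "2 * 2 ^ j0 < 2 * (2::real) ^ j" "2 * (4 * real N) < 2 * (2::real) ^ j"
          by (rule le_less_trans[OF order_trans[OF X(1) xX] j2], rule le_less_trans[OF order_trans[OF X(2) xX] j2])
        then show ?thesis by (simp only: mult_less_cancel_left_pos zero_less_numeral max_less_iff_conj)
      qed
      have j0: "j0 \<le> j"
      proof -
        have "(2::real) ^ j0 < 2 ^ j" using jj by simp
        then show ?thesis by (simp add: power_strict_increasing_iff)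
      qed
      have N4: "4 * N \<le> 2 ^ j"
      proof -
        have "real (4 * N) < real (2 ^ j)" using jj by simp
        then show ?thesis by (simp only: of_nat_less_iff less_imp_le)
      qed
      \<comment> \<open>From \<open>1 / n <= \<delta> n\<close>. The power of \<open>n\<close> is
        complementary to the one in the bound on \<open>m\<close>, so their product is linear in
        \<open>n\<close>.\<close>
      have xle: "x \<le> L powr (2 * \<theta>) * real n powr \<theta>"
      proof -
        have "L\<^sup>2 / \<delta> n \<le> L\<^sup>2 * real n"
          using divide_left_mono[OF sd(2), of "L\<^sup>2"] sd(1) n0 by simp
        then have "x \<le> (L\<^sup>2 * real n) powr \<theta>"
          unfolding x_def using th sd(1) by (intro powr_mono2) auto
        also have "\<dots> = L powr (2 * \<theta>) * real n powr \<theta>"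
          using L0 n0 by (simp add: powr_mult powr_power2)
        finally show ?thesis .
      qed
      \<comment> \<open>Here both logarithms of the growth condition are spent: one absorbs the
        constant \<open>c0 * L powr (2 * \<theta>) / N\<close>, the other makes the bound on the
        expected number of points per cell at least \<open>2 * ln n\<close>.\<close>
      have qr: "2 * l \<le> real (n div m n) * (2 * real N / 2 ^ j)"
      proof -
        have q: "real (n div m n) = real n / real (m n)"
          using md by (simp add: real_of_nat_div)
        have "real (m n) * 2 ^ j \<le> (c0 * (real n powr (1 - \<theta>) / l\<^sup>2)) * (L powr (2 * \<theta>) * real n powr \<theta>)"
          using mb j(1) xle c0 by (intro mult_mono) auto
        also have "\<dots> = c0 * L powr (2 * \<theta>) * (real n powr (1 - \<theta>) * real n powr \<theta>) / l\<^sup>2" by simp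
        also have "real n powr (1 - \<theta>) * real n powr \<theta> = real n" using n0 by (simp add: powr_add[symmetric])
        also have "c0 * L powr (2 * \<theta>) * real n / l\<^sup>2 \<le> (real N * l) * real n / l\<^sup>2"
          using l1 n0 N by (intro divide_right_mono mult_right_mono) (auto simp: pos_divide_le_eq mult.commute)
        also have "\<dots> = real N * real n / l" using l1 by (simp add: power2_eq_square)
        finally have "l * (real (m n) * 2 ^ j) \<le> real N * real n" using l1 by (simp add: pos_le_divide_eq mult.commute)
        then show ?thesis unfolding q using m0 by (simp add: field_simps)
      qed
      have tail: "8 * real (m n) * real (2 ^ j div (4 * N)) * exp (- 2 * real (n div m n) * (2 * real N / 2 ^ j)) \<le> 1"
      proof -
        have K: "real (2 ^ j div (4 * N)) \<le> L powr (2 * \<theta>) * real n"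
        proof -
          have "real (2 ^ j div (4 * N)) \<le> real (2 ^ j)" by (intro of_nat_mono div_le_dividend)
          also have "\<dots> \<le> L powr (2 * \<theta>) * real n powr \<theta>" using j(1) xle by simp
          also have "\<dots> \<le> L powr (2 * \<theta>) * real n powr 1"
            using n2 th by (intro mult_left_mono powr_mono) auto
          finally show ?thesis using n0 by simp
        qed
        \<comment> \<open>With \<open>q * r >= 2 * ln n\<close> the Chernoff factor is at most
          n^{-4}. The number of machines and the number of cells contribute at most \<open>n\<close>
          and a constant times \<open>n\<close>, and a further power of \<open>n\<close> absorbs
          that constant.\<close>
        have ex: "exp (- 2 * real (n div m n) * (2 * real N / 2 ^ j)) \<le> 1 / real n ^ 4"
        proof -
          have "exp (- 2 * real (n div m n) * (2 * real N / 2 ^ j)) \<le> exp (- (4 * l))"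
            using qr by simp
          also have "\<dots> = 1 / exp l ^ 4" by (simp add: exp_minus inverse_eq_divide exp_of_nat_mult[symmetric])
          finally show ?thesis using n0 by (simp add: l_def)
        qed
        have "8 * real (m n) * real (2 ^ j div (4 * N)) * exp (- 2 * real (n div m n) * (2 * real N / 2 ^ j))
           \<le> 8 * real n * (L powr (2 * \<theta>) * real n) * (1 / real n ^ 4)"
          using mn K ex by (intro mult_mono) auto
        also have "\<dots> = (8 * L powr (2 * \<theta>)) * (real n * real n) / real n ^ 4" by simp
        also have "\<dots> \<le> real n * (real n * real n) / real n ^ 4"
          using elim(4) by (intro divide_right_mono mult_right_mono) auto
        also have "\<dots> = 1 / real n" using n0 by (simp add: power4_eq_xxxx)
        also have "\<dots> \<le> 1" using n2 by simp
        finally show ?thesis .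
      qed
      show ?case
        unfolding th1 \<theta>_def
        by (rule minimax_lower_bound[OF assms(1-3) L assms(5) C N cells D[unfolded \<theta>_def] eps n2 md ml Bp sol d1(1) j0 N4
              j[unfolded x_def \<theta>_def] tail])
    qed
  qed
qed

end
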